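(* Let $a_1,a_2$ be positive integers, let $A$ be the Jacobian algebra of $Q=Q[a_1,a_2]$ and let $T=\bigoplus_{x\in Q_0}M(x)$. Then the endomorphism algebra of $T$ is isomorphic to (the dual of) $A$, $\operatorname{End}_A T\cong A$. Furthermore, the mapping $x\mapsto M(x)$ induces an isomorphism of quivers $Q^{\mathrm{op}}\to Q_{\operatorname{End}_A T}$. In particular, the quiver $Q_{\operatorname{End}_A T}$ of $\operatorname{End}_A T$ has vertices $M(x)$, $x\in Q_0$, and its arrows are those of the oriented cycle $M(r_0)\to M(r_{a_2})\to M(r_{a_2-1})\to\cdots\to M(r_1)\to M(r_0)$, of the branch $M(r_{a_2})\to M(s_{a_1-1})\to\cdots\to M(s_1)$ and of the branch $M(t_{a_1-1})\to\cdots\to M(t_1)\to M(r_0)$.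
   Context: Let $k$ be an algebraically closed field. $Q=Q[a_1,a_2]$, the quiver of $A$, has vertices $r_0,\dots,r_{a_2}$, $s_1,\dots,s_{a_1-1}$, $t_1,\dots,t_{a_1-1}$ (no $s$- or $t$-vertices if $a_1=1$) and arrows forming the oriented cycle $r_0\to r_1\to\cdots\to r_{a_2}\to r_0$, the branch $s_1\to\cdots\to s_{a_1-1}\to r_{a_2}$ and the branch $r_0\to t_1\to\cdots\to t_{a_1-1}$. With the potential $W=r_0\to r_1\to\cdots\to r_{a_2}\to r_0$, the Jacobian algebra is $A=kQ/I$, where $I$ is the two-sided ideal generated by all subpaths of length $a_2$ of the oriented cycle. $A$-modules are finite-dimensional representations of $Q$ satisfying these relations. $Q^{\mathrm{op}}$ is the quiver obtained from $Q$ by reversing all arrows; since $Q\cong Q^{\mathrm{op}}$, the algebra $A$ is isomorphic to its dual. Each $M(x)$ is the representation with the space $k$ at every vertex of its support and $0$ elsewhere, identity maps on arrows between two vertices of the support, and zero maps on the other arrows. Supports: $\operatorname{supp}M(r_i)=Q_0\setminus\{r_i\}$ for $1\le i\le a_2-1$; $\operatorname{supp}M(r_0)=Q_0\setminus\{r_0,t_1,\dots,t_{a_1-1}\}$; $\operatorname{supp}M(r_{a_2})=Q_0\setminus\{r_{a_2},s_1,\dots,s_{a_1-1}\}$; $\operatorname{supp}M(t_i)=\{r_1,\dots,r_{a_2}\}\cup\{s_{i+1},\dots,s_{a_1-1}\}$; $\operatorname{supp}M(s_i)=\{r_0,\dots,r_{a_2-1}\}\cup\{t_1,\dots,t_{i-1}\}$.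 The quiver $Q_{\operatorname{End}_A T}$ has as vertices the indecomposable summands $M(x)$ of $T$, and its arrows $M(x)\to M(y)$ correspond to irreducible morphisms $M(x)\to M(y)$ in $\operatorname{add}T$.
   Formalization: For a_2=1 the arrows r_0→r_1→r_0 are themselves relations and M(r_0), M(r_1) have no morphisms between them, so the quiver claim fails; there the two cycle arrows are dropped from Q and from the list of arrows. For a_2≥2 the claim is as stated. *)

theory Defs
  imports
    "Jordan_Normal_Form.Matrix"
    "Graph_Theory.Digraph_Isomorphism"
    "HOL-Algebra.QuotRing"
    "HOL-Computational_Algebra.Polynomial"
begin

text \<open>
  Algebras over a field \<open>'k\<close> are \<open>module\<close> records: a ring together with a
  scalar multiplication. (The locale \<open>algebra\<close> of HOL-Algebra is not used, as it demands a
  commutative multiplication.)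
\<close>

definition algebra_iso :: "('k, 'a) module \<Rightarrow> ('k, 'b) module \<Rightarrow> bool" where
  "algebra_iso A B \<longleftrightarrow> (\<exists>h \<in> ring_iso A B.
     \<forall>c. \<forall>x \<in> carrier A. h (c \<odot>\<^bsub>A\<^esub> x) = c \<odot>\<^bsub>B\<^esub> h x)"

definition op_algebra :: "('k, 'a) module \<Rightarrow> ('k, 'a) module" where
  "op_algebra A = A\<lparr>mult := \<lambda>x y. y \<otimes>\<^bsub>A\<^esub> x\<rparr>"

definition quotient_algebra :: "('k, 'a) module \<Rightarrow> 'a set \<Rightarrow> ('k, 'a set) module" where
  "quotient_algebra A I =
     \<lparr>carrier = carrier (A Quot I), mult = mult (A Quot I), one = one (A Quot I),
      zero = zero (A Quot I), add = add (A Quot I),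
      module.smult = (\<lambda>c X. \<Union>x\<in>X. I +>\<^bsub>A\<^esub> (c \<odot>\<^bsub>A\<^esub> x))\<rparr>"


section \<open>Quivers and path algebras\<close>

text \<open>A path is given by its starting vertex and the list of its arrows, in the order in which
  they are traversed.\<close>

type_synonym ('v, 'e) qpath = "'v \<times> 'e list"

definition paths :: "('v, 'e) pre_digraph \<Rightarrow> ('v, 'e) qpath set" where
  "paths G = {(u, p). \<exists>v. pre_digraph.awalk G u p v}"

definition path_end :: "('v, 'e) pre_digraph \<Rightarrow> 'v \<Rightarrow> 'e list \<Rightarrow> 'v" where
  "path_end G u p = last (pre_digraph.awalk_verts G u p)"

text \<open>Elements of the path algebra are finitely supported functions on the set of paths; the
  product of two paths \<open>p\<close> and \<open>q\<close> is the path that first traverses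
  \<open>p\<close> and then \<open>q\<close>.\<close>

definition path_algebra ::
    "('v, 'e) pre_digraph \<Rightarrow> ('k::field, ('v, 'e) qpath \<Rightarrow> 'k) module" where
  "path_algebra G =
     \<lparr>carrier = {f. finite {p. f p \<noteq> 0} \<and> {p. f p \<noteq> 0} \<subseteq> paths G},
      mult = (\<lambda>f g (u, p). \<Sum>i\<le>length p.
                f (u, take i p) * g (path_end G u (take i p), drop i p)),
      one = (\<lambda>(u, p). if u \<in> verts G \<and> p = [] then 1 else 0),
      zero = (\<lambda>_. 0),
      add = (\<lambda>f g p. f p + g p),
      module.smult = (\<lambda>c f p. c * f p)\<rparr>"

definition path_elem :: "('v, 'e) qpath \<Rightarrow> ('v, 'e) qpath \<Rightarrow> 'k::field" where
  "path_elem p = (\<lambda>q. if q = p then 1 else 0)"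

definition bound_quiver_algebra ::
    "('v, 'e) pre_digraph \<Rightarrow> ('v, 'e) qpath set \<Rightarrow> ('k::field, (('v, 'e) qpath \<Rightarrow> 'k) set) module" where
  "bound_quiver_algebra G P =
     quotient_algebra (path_algebra G) (genideal (path_algebra G) (path_elem ` P))"

definition op_quiver :: "('v, 'e) pre_digraph \<Rightarrow> ('v, 'e) pre_digraph" where
  "op_quiver G = \<lparr>verts = verts G, arcs = arcs G, tail = head G, head = tail G\<rparr>"

text \<open>If an arrow occurs among the relations, it vanishes in the quotient of the path algebra and
  is therefore not an arrow of the quiver of that algebra.\<close>

definition quiver_of_bound_quiver_algebra ::
    "('v, 'e) pre_digraph \<Rightarrow> ('v, 'e) qpath set \<Rightarrow> ('v, 'e) pre_digraph" where
  "quiver_of_bound_quiver_algebra G P = G\<lparr>arcs := {e \<in> arcs G. (tail G e, [e]) \<notin> P}\<rparr>"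

definition induces_quiver_iso ::
    "('v \<Rightarrow> 'w) \<Rightarrow> ('v, 'e) pre_digraph \<Rightarrow> ('w, 'f) pre_digraph \<Rightarrow> bool" where
  "induces_quiver_iso \<phi> G H \<longleftrightarrow> (\<exists>h. pre_digraph.digraph_isomorphism G h \<and>
     (\<forall>x \<in> verts G. iso_verts h x = \<phi> x) \<and> H = app_iso h G)"


section \<open>Finite-dimensional representations\<close>

text \<open>A finite-dimensional representation has the space \<open>k\<^sup>d\<close> with
  \<open>d = rdim M v\<close> at the vertex \<open>v\<close>, and an arrow acts by a matrix, multiplied with column
  vectors from the left. Morphisms are families of matrices, taken to be \<open>undefined\<close> outside the
  vertices, so that morphisms are equal if they agree on all vertices.\<close>

record ('v, 'e, 'k) rep =
  rdim :: "'v \<Rightarrow> nat"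
  rmap :: "'e \<Rightarrow> 'k mat"

primrec path_mat :: "('v, 'e) pre_digraph \<Rightarrow> ('v, 'e, 'k::field) rep \<Rightarrow> 'v \<Rightarrow> 'e list \<Rightarrow> 'k mat" where
  "path_mat G M u [] = 1\<^sub>m (rdim M u)"
| "path_mat G M u (e # p) = path_mat G M (head G e) p * rmap M e"

definition is_rep :: "('v, 'e) pre_digraph \<Rightarrow> ('v, 'e, 'k::field) rep \<Rightarrow> bool" where
  "is_rep G M \<longleftrightarrow> (\<forall>e \<in> arcs G. rmap M e \<in> carrier_mat (rdim M (head G e)) (rdim M (tail G e)))"

definition is_module ::
    "('v, 'e) pre_digraph \<Rightarrow> ('v, 'e) qpath set \<Rightarrow> ('v, 'e, 'k::field) rep \<Rightarrow> bool" where
  "is_module G P M \<longleftrightarrow> is_rep G M \<and>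
     (\<forall>(u, p) \<in> P. path_mat G M u p = 0\<^sub>m (rdim M (path_end G u p)) (rdim M u))"

definition rep_sum :: "('v, 'e, 'k::field) rep list \<Rightarrow> ('v, 'e, 'k) rep" where
  "rep_sum Ms = \<lparr>rdim = (\<lambda>v. sum_list (map (\<lambda>M. rdim M v) Ms)),
                 rmap = (\<lambda>e. diag_block_mat (map (\<lambda>M. rmap M e) Ms))\<rparr>"

type_synonym ('v, 'k) rep_mor = "'v \<Rightarrow> 'k mat"

definition Hom :: "('v, 'e) pre_digraph \<Rightarrow> ('v, 'e, 'k::field) rep \<Rightarrow> ('v, 'e, 'k) rep
    \<Rightarrow> ('v, 'k) rep_mor set" where
  "Hom G M N = {f \<in> (\<Pi>\<^sub>E v\<in>verts G. carrier_mat (rdim N v) (rdim M v)).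
     \<forall>e \<in> arcs G. rmap N e * f (tail G e) = f (head G e) * rmap M e}"

definition mor_comp :: "('v, 'e) pre_digraph \<Rightarrow> ('v, 'k::field) rep_mor \<Rightarrow> ('v, 'k) rep_mor
    \<Rightarrow> ('v, 'k) rep_mor" where
  "mor_comp G g f = (\<lambda>v\<in>verts G. g v * f v)"

definition mor_id :: "('v, 'e) pre_digraph \<Rightarrow> ('v, 'e, 'k::field) rep \<Rightarrow> ('v, 'k) rep_mor" where
  "mor_id G M = (\<lambda>v\<in>verts G. 1\<^sub>m (rdim M v))"

definition mor_zero :: "('v, 'e) pre_digraph \<Rightarrow> ('v, 'e, 'k::field) rep \<Rightarrow> ('v, 'e, 'k) rep
    \<Rightarrow> ('v, 'k) rep_mor" where
  "mor_zero G M N = (\<lambda>v\<in>verts G. 0\<^sub>m (rdim N v) (rdim M v))"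

definition mor_add :: "('v, 'e) pre_digraph \<Rightarrow> ('v, 'k::field) rep_mor \<Rightarrow> ('v, 'k) rep_mor
    \<Rightarrow> ('v, 'k) rep_mor" where
  "mor_add G f g = (\<lambda>v\<in>verts G. f v + g v)"

definition mor_smult :: "('v, 'e) pre_digraph \<Rightarrow> 'k::field \<Rightarrow> ('v, 'k) rep_mor
    \<Rightarrow> ('v, 'k) rep_mor" where
  "mor_smult G c f = (\<lambda>v\<in>verts G. c \<cdot>\<^sub>m f v)"

definition End_algebra ::
    "('v, 'e) pre_digraph \<Rightarrow> ('v, 'e, 'k::field) rep \<Rightarrow> ('k, ('v, 'k) rep_mor) module" where
  "End_algebra G T =
     \<lparr>carrier = Hom G T T, mult = mor_comp G, one = mor_id G T,
      zero = mor_zero G T T, add = mor_add G, module.smult = mor_smult G\<rparr>"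

definition is_iso :: "('v, 'e) pre_digraph \<Rightarrow> ('v, 'e, 'k::field) rep \<Rightarrow> ('v, 'e, 'k) rep
    \<Rightarrow> ('v, 'k) rep_mor \<Rightarrow> bool" where
  "is_iso G M N f \<longleftrightarrow> f \<in> Hom G M N \<and>
     (\<exists>g \<in> Hom G N M. mor_comp G g f = mor_id G M \<and> mor_comp G f g = mor_id G N)"

definition rep_iso :: "('v, 'e) pre_digraph \<Rightarrow> ('v, 'e, 'k::field) rep \<Rightarrow> ('v, 'e, 'k) rep \<Rightarrow> bool" where
  "rep_iso G M N \<longleftrightarrow> (\<exists>f. is_iso G M N f)"

definition is_zero_rep :: "('v, 'e) pre_digraph \<Rightarrow> ('v, 'e, 'k::field) rep \<Rightarrow> bool" where
  "is_zero_rep G M \<longleftrightarrow> (\<forall>v \<in> verts G. rdim M v = 0)"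

definition indecomposable ::
    "('v, 'e) pre_digraph \<Rightarrow> ('v, 'e) qpath set \<Rightarrow> ('v, 'e, 'k::field) rep \<Rightarrow> bool" where
  "indecomposable G P M \<longleftrightarrow> is_module G P M \<and> \<not> is_zero_rep G M \<and>
     (\<forall>Y Z. is_module G P Y \<and> is_module G P Z \<and> rep_iso G M (rep_sum [Y, Z]) \<longrightarrow>
        is_zero_rep G Y \<or> is_zero_rep G Z)"

definition direct_summand :: "('v, 'e) pre_digraph \<Rightarrow> ('v, 'e) qpath set
    \<Rightarrow> ('v, 'e, 'k::field) rep \<Rightarrow> ('v, 'e, 'k) rep \<Rightarrow> bool" where
  "direct_summand G P X T \<longleftrightarrow> is_module G P X \<and>
     (\<exists>Y. is_module G P Y \<and> rep_iso G T (rep_sum [X, Y]))"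


section \<open>The quiver of an endomorphism algebra\<close>

definition in_add :: "('v, 'e) pre_digraph \<Rightarrow> ('v, 'e) qpath set
    \<Rightarrow> ('v, 'e, 'k::field) rep \<Rightarrow> ('v, 'e, 'k) rep \<Rightarrow> bool" where
  "in_add G P T X \<longleftrightarrow> (\<exists>n. direct_summand G P X (rep_sum (replicate n T)))"

definition split_mono :: "('v, 'e) pre_digraph \<Rightarrow> ('v, 'e, 'k::field) rep \<Rightarrow> ('v, 'e, 'k) rep
    \<Rightarrow> ('v, 'k) rep_mor \<Rightarrow> bool" where
  "split_mono G X Y f \<longleftrightarrow> (\<exists>g \<in> Hom G Y X. mor_comp G g f = mor_id G X)"

definition split_epi :: "('v, 'e) pre_digraph \<Rightarrow> ('v, 'e, 'k::field) rep \<Rightarrow> ('v, 'e, 'k) rep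
    \<Rightarrow> ('v, 'k) rep_mor \<Rightarrow> bool" where
  "split_epi G X Y f \<longleftrightarrow> (\<exists>g \<in> Hom G Y X. mor_comp G f g = mor_id G Y)"

definition irreducible_in_add :: "('v, 'e) pre_digraph \<Rightarrow> ('v, 'e) qpath set
    \<Rightarrow> ('v, 'e, 'k::field) rep \<Rightarrow> ('v, 'e, 'k) rep \<Rightarrow> ('v, 'e, 'k) rep \<Rightarrow> ('v, 'k) rep_mor \<Rightarrow> bool" where
  "irreducible_in_add G P T X Y f \<longleftrightarrow> f \<in> Hom G X Y \<and>
     \<not> split_mono G X Y f \<and> \<not> split_epi G X Y f \<and>
     (\<forall>Z g h. in_add G P T Z \<and> g \<in> Hom G X Z \<and> h \<in> Hom G Z Y \<and> f = mor_comp G h g \<longrightarrow>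
        split_mono G X Z g \<or> split_epi G Z Y h)"

definition rad_mor :: "('v, 'e) pre_digraph \<Rightarrow> ('v, 'e, 'k::field) rep \<Rightarrow> ('v, 'e, 'k) rep
    \<Rightarrow> ('v, 'k) rep_mor set" where
  "rad_mor G X Y = {f \<in> Hom G X Y. \<forall>g \<in> Hom G Y X.
     is_iso G X X (mor_add G (mor_id G X) (mor_smult G (- 1) (mor_comp G g f)))}"

inductive_set rad2_add :: "('v, 'e) pre_digraph \<Rightarrow> ('v, 'e) qpath set
    \<Rightarrow> ('v, 'e, 'k::field) rep \<Rightarrow> ('v, 'e, 'k) rep \<Rightarrow> ('v, 'e, 'k) rep \<Rightarrow> ('v, 'k) rep_mor set"
  for G P T X Y where
  zero: "mor_zero G X Y \<in> rad2_add G P T X Y"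
| add: "f \<in> rad2_add G P T X Y \<Longrightarrow> in_add G P T Z \<Longrightarrow> g \<in> rad_mor G X Z \<Longrightarrow> h \<in> rad_mor G Z Y
    \<Longrightarrow> mor_add G f (mor_comp G h g) \<in> rad2_add G P T X Y"

definition mor_lincomb :: "('v, 'e) pre_digraph \<Rightarrow> ('v, 'e, 'k::field) rep \<Rightarrow> ('v, 'e, 'k) rep
    \<Rightarrow> ('v, 'k) rep_mor set \<Rightarrow> (('v, 'k) rep_mor \<Rightarrow> 'k) \<Rightarrow> ('v, 'k) rep_mor" where
  "mor_lincomb G X Y B c =
     (\<lambda>v\<in>verts G. mat (rdim Y v) (rdim X v) (\<lambda>(i, j). \<Sum>b\<in>B. c b * b v $$ (i, j)))"

text \<open>A set of irreducible morphisms whose residue classes form a basis of the space of radical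
  morphisms modulo the square of the radical of \<open>add T\<close>.\<close>

definition irr_basis :: "('v, 'e) pre_digraph \<Rightarrow> ('v, 'e) qpath set
    \<Rightarrow> ('v, 'e, 'k::field) rep \<Rightarrow> ('v, 'e, 'k) rep \<Rightarrow> ('v, 'e, 'k) rep \<Rightarrow> ('v, 'k) rep_mor set \<Rightarrow> bool" where
  "irr_basis G P T X Y B \<longleftrightarrow> finite B \<and>
     (\<forall>b \<in> B. irreducible_in_add G P T X Y b) \<and> B \<subseteq> rad_mor G X Y \<and>
     (\<forall>f \<in> rad_mor G X Y. \<exists>!c. c \<in> B \<rightarrow>\<^sub>E UNIV \<and>
        mor_add G f (mor_smult G (- 1) (mor_lincomb G X Y B c)) \<in> rad2_add G P T X Y)"

text \<open>The members of \<open>Vs\<close> represent the isomorphism classes of indecomposable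
  direct summands of \<open>T\<close>, each class once.\<close>

definition indecomposable_summands :: "('v, 'e) pre_digraph \<Rightarrow> ('v, 'e) qpath set
    \<Rightarrow> ('v, 'e, 'k::field) rep \<Rightarrow> ('v, 'e, 'k) rep set \<Rightarrow> bool" where
  "indecomposable_summands G P T Vs \<longleftrightarrow>
     (\<forall>X \<in> Vs. indecomposable G P X \<and> direct_summand G P X T) \<and>
     (\<forall>X \<in> Vs. \<forall>Y \<in> Vs. rep_iso G X Y \<longrightarrow> X = Y) \<and>
     (\<forall>N. indecomposable G P N \<and> direct_summand G P N T \<longrightarrow> (\<exists>X \<in> Vs. rep_iso G N X))"

text \<open>The quiver of the endomorphism algebra of \<open>T\<close>, where \<open>Vs\<close> is a
  set of representatives of the indecomposable summands of \<open>T\<close>. An arrow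
  \<open>(X, f, Y)\<close> is an irreducible morphism \<open>f\<close> from
  \<open>X\<close> to \<open>Y\<close> belonging to a chosen basis; up to isomorphism
  the quiver does not depend on the choice of the bases.\<close>

definition End_quiver :: "('v, 'e) pre_digraph \<Rightarrow> ('v, 'e) qpath set
    \<Rightarrow> ('v, 'e, 'k::field) rep \<Rightarrow> ('v, 'e, 'k) rep set
    \<Rightarrow> (('v, 'e, 'k) rep, ('v, 'e, 'k) rep \<times> ('v, 'k) rep_mor \<times> ('v, 'e, 'k) rep) pre_digraph" where
  "End_quiver G P T Vs =
     \<lparr>verts = Vs,
      arcs = {(X, f, Y). X \<in> Vs \<and> Y \<in> Vs \<and> f \<in> (SOME B. irr_basis G P T X Y B)},
      tail = (\<lambda>(X, f, Y). X), head = (\<lambda>(X, f, Y). Y)\<rparr>"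


section \<open>The quiver \<open>Q[a\<^sub>1, a\<^sub>2]\<close>, its Jacobian algebra and the modules \<open>M(x)\<close>\<close>

datatype vertex = Rv nat | Sv nat | Tv nat

type_synonym arrow = "vertex \<times> vertex"

definition Q0 :: "nat \<Rightarrow> nat \<Rightarrow> vertex set" where
  "Q0 a1 a2 = {Rv i | i. i \<le> a2} \<union> {Sv i | i. 1 \<le> i \<and> i \<le> a1 - 1} \<union> {Tv i | i. 1 \<le> i \<and> i \<le> a1 - 1}"

definition Q0_list :: "nat \<Rightarrow> nat \<Rightarrow> vertex list" where
  "Q0_list a1 a2 = map Rv [0..<Suc a2] @ map Sv [1..<a1] @ map Tv [1..<a1]"

definition cycle_arrows :: "nat \<Rightarrow> arrow set" where
  "cycle_arrows a2 = {(Rv i, Rv (i + 1)) | i. i < a2} \<union> {(Rv a2, Rv 0)}"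

definition s_arrows :: "nat \<Rightarrow> nat \<Rightarrow> arrow set" where
  "s_arrows a1 a2 = {(Sv i, Sv (i + 1)) | i. 1 \<le> i \<and> i + 1 \<le> a1 - 1} \<union>
     (if a1 = 1 then {} else {(Sv (a1 - 1), Rv a2)})"

definition t_arrows :: "nat \<Rightarrow> arrow set" where
  "t_arrows a1 = (if a1 = 1 then {} else {(Rv 0, Tv 1)}) \<union>
     {(Tv i, Tv (i + 1)) | i. 1 \<le> i \<and> i + 1 \<le> a1 - 1}"

definition Q :: "nat \<Rightarrow> nat \<Rightarrow> (vertex, arrow) pre_digraph" where
  "Q a1 a2 = \<lparr>verts = Q0 a1 a2, arcs = cycle_arrows a2 \<union> s_arrows a1 a2 \<union> t_arrows a1,
              tail = fst, head = snd\<rparr>"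

definition cycle_subpaths :: "nat \<Rightarrow> nat \<Rightarrow> (vertex, arrow) qpath set" where
  "cycle_subpaths a1 a2 = {(u, p) \<in> paths (Q a1 a2). set p \<subseteq> cycle_arrows a2 \<and> length p = a2}"

definition jacobian_algebra ::
    "nat \<Rightarrow> nat \<Rightarrow> ('k::field, ((vertex, arrow) qpath \<Rightarrow> 'k) set) module" where
  "jacobian_algebra a1 a2 = bound_quiver_algebra (Q a1 a2) (cycle_subpaths a1 a2)"

definition jacobian_quiver :: "nat \<Rightarrow> nat \<Rightarrow> (vertex, arrow) pre_digraph" where
  "jacobian_quiver a1 a2 = quiver_of_bound_quiver_algebra (Q a1 a2) (cycle_subpaths a1 a2)"

fun suppM :: "nat \<Rightarrow> nat \<Rightarrow> vertex \<Rightarrow> vertex set" where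
  "suppM a1 a2 (Rv i) =
     (if i = 0 then Q0 a1 a2 - ({Rv 0} \<union> {Tv j | j. 1 \<le> j \<and> j \<le> a1 - 1})
      else if i = a2 then Q0 a1 a2 - ({Rv a2} \<union> {Sv j | j. 1 \<le> j \<and> j \<le> a1 - 1})
      else Q0 a1 a2 - {Rv i})"
| "suppM a1 a2 (Tv i) = {Rv j | j. 1 \<le> j \<and> j \<le> a2} \<union> {Sv j | j. i + 1 \<le> j \<and> j \<le> a1 - 1}"
| "suppM a1 a2 (Sv i) = {Rv j | j. j \<le> a2 - 1} \<union> {Tv j | j. 1 \<le> j \<and> j \<le> i - 1}"

definition M :: "nat \<Rightarrow> nat \<Rightarrow> vertex \<Rightarrow> (vertex, arrow, 'k::field) rep" where
  "M a1 a2 x =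
     \<lparr>rdim = (\<lambda>v. if v \<in> suppM a1 a2 x then 1 else 0),
      rmap = (\<lambda>(u, v). if u \<in> suppM a1 a2 x \<and> v \<in> suppM a1 a2 x then 1\<^sub>m 1
               else 0\<^sub>m (if v \<in> suppM a1 a2 x then 1 else 0) (if u \<in> suppM a1 a2 x then 1 else 0))\<rparr>"

definition T_module :: "nat \<Rightarrow> nat \<Rightarrow> (vertex, arrow, 'k::field) rep" where
  "T_module a1 a2 = rep_sum (map (M a1 a2) (Q0_list a1 a2))"

lemma Q0_list: "set (Q0_list a1 a2) = Q0 a1 a2" "distinct (Q0_list a1 a2)"
  by (auto simp: Q0_list_def Q0_def distinct_map inj_on_def image_def)

text \<open>For \<open>a2 \<ge> 2\<close> the relations are admissible. For \<open>a2 = 1\<close>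
  the two arrows of the oriented 2-cycle are themselves relations, and the quiver of the Jacobian
  algebra consists of the two branches only.\<close>

lemma jacobian_quiver_ge_2:
  assumes "2 \<le> a2"
  shows "jacobian_quiver a1 a2 = Q a1 a2"
  using assms
  by (auto simp: jacobian_quiver_def quiver_of_bound_quiver_algebra_def cycle_subpaths_def
      intro!: pre_digraph.equality)

lemma jacobian_quiver_1:
  assumes "0 < a1"
  shows "arcs (jacobian_quiver a1 1) = s_arrows a1 1 \<union> t_arrows a1"
  by (auto simp: jacobian_quiver_def quiver_of_bound_quiver_algebra_def cycle_subpaths_def paths_def
      Q_def pre_digraph.awalk_def pre_digraph.cas.simps cycle_arrows_def s_arrows_def t_arrows_def
      Q0_def split: if_splits)

end

theory Submission
  imports Defs
begin

text \<open>
  Both \<open>A\<close> and \<open>End T\<close> have a basis indexed by the pairs \<open>(x, y)\<close> of vertices for which there is a path from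
  \<open>x\<close> to \<open>y\<close> that is nonzero in \<open>A\<close>, with the same multiplication table. The proof makes this table
  explicit as an algebra \<open>inc_algebra\<close> and identifies both algebras with it.

  On the side of \<open>A\<close>: a path enters the oriented cycle from the s-branch and leaves it into the t-branch, so
  its arrows on the cycle are consecutive, and it is zero in \<open>A\<close> exactly if there are at least \<open>a2\<close> of them
  (\<open>bad_walk_factor\<close>). Between two vertices there is at most one nonzero path (\<open>good_walk\<close>, \<open>walk_unique\<close>). Reading off
  the coefficients at these paths is a surjective homomorphism from the path algebra whose kernel is the
  ideal of relations (\<open>to_inc_kernel\<close>).

  On the side of \<open>End T\<close>: a morphism between thin modules is a family of scalars, which is constant along
  the arrows inside the supports. Following these arrows around the cycle and along the branches shows that
  all morphisms \<open>M(y) \<rightarrow> M(x)\<close> are multiples of a single one. It is nonzero exactly if there is a nonzero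
  path from \<open>x\<close> to \<open>y\<close>, and then its support consists of the common support of both modules beyond that path
  (\<open>thin_hom_values\<close>, \<open>Hom_M\<close>). Two such morphisms compose to the third one or to zero, according to
  whether the two paths concatenate to a nonzero path (\<open>mor_supp_comp\<close>). Morphisms run in the opposite direction
  to paths, but so does the composition of maps, and therefore \<open>End T\<close> is isomorphic to \<open>A\<close> itself; as the quiver has an
  anti-automorphism, it is also isomorphic to the opposite algebra.

  In this description the length of paths is additive, and everything else follows from that together
  with \<open>End M(x) = k\<close>. The latter makes the modules \<open>M(x)\<close> indecomposable. An idempotent of \<open>End T\<close> with zero
  diagonal is zero, by induction on the length, so every indecomposable summand of \<open>T\<close> contains some
  \<open>M(x)\<close> as a summand and is isomorphic to it (\<open>indecomposable_summand_T\<close>). Morphisms between different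
  modules \<open>M(x)\<close> are radical. A morphism that belongs to a path of length at least two factors through the
  first step of the path, so it lies in the square of the radical; one that belongs to a path of length one
  does not, because a radical factorisation would have to pass through a vertex strictly inside the path
  (\<open>rad_comp_zero\<close>). Hence the irreducible morphisms are, up to scalars, those belonging to the arrows
  of the quiver that are not relations themselves, with direction reversed.
\<close>

section \<open>Morphisms of representations\<close>

locale quiver = wf_digraph G for G :: "('v, 'e) pre_digraph"
begin

abbreviation comp (infixl "\<star>" 70) where "g \<star> f \<equiv> mor_comp G g f"

text \<open>Finite sums in a Hom space. The two ends are arguments, since an empty family of matrices does not
  determine the size of its sum.\<close>

definition mor_sum :: "('v, 'e, 'k::field) rep \<Rightarrow> ('v, 'e, 'k) rep \<Rightarrow> 'i set \<Rightarrow> ('i \<Rightarrow> ('v, 'k) rep_mor)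
    \<Rightarrow> ('v, 'k) rep_mor" where
  "mor_sum X Y I F = (\<lambda>v\<in>verts G. mat (rdim Y v) (rdim X v) (\<lambda>(i, j). \<Sum>a\<in>I. F a v $$ (i, j)))"

lemma Hom_carrier: "f \<in> Hom G X Y \<Longrightarrow> v \<in> verts G \<Longrightarrow> f v \<in> carrier_mat (rdim Y v) (rdim X v)"
  by (auto simp: Hom_def PiE_def)

lemma Hom_dim [simp]:
  "f \<in> Hom G X Y \<Longrightarrow> v \<in> verts G \<Longrightarrow> dim_row (f v) = rdim Y v"
  "f \<in> Hom G X Y \<Longrightarrow> v \<in> verts G \<Longrightarrow> dim_col (f v) = rdim X v"
  by (auto dest: Hom_carrier)

lemma Hom_arc: "f \<in> Hom G X Y \<Longrightarrow> e \<in> arcs G \<Longrightarrow> rmap Y e * f (tail G e) = f (head G e) * rmap X e"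
  by (auto simp: Hom_def)

lemma HomI:
  assumes "f \<in> extensional (verts G)"
    and "\<And>v. v \<in> verts G \<Longrightarrow> f v \<in> carrier_mat (rdim Y v) (rdim X v)"
    and "\<And>e. e \<in> arcs G \<Longrightarrow> rmap Y e * f (tail G e) = f (head G e) * rmap X e"
  shows "f \<in> Hom G X Y"
  using assms by (auto simp: Hom_def PiE_def)

lemma Hom_eqI:
  assumes "f \<in> Hom G X Y" "g \<in> Hom G X Y" "\<And>v. v \<in> verts G \<Longrightarrow> f v = g v"
  shows "f = g"
  using assms by (auto simp: Hom_def intro: PiE_ext)

lemma rep_carrier:
  "is_rep G X \<Longrightarrow> e \<in> arcs G \<Longrightarrow> rmap X e \<in> carrier_mat (rdim X (head G e)) (rdim X (tail G e))"
  by (auto simp: is_rep_def)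

lemma comp_in_Hom:
  assumes "g \<in> Hom G Y Z" "f \<in> Hom G X Y" "is_rep G X" "is_rep G Y" "is_rep G Z"
  shows "g \<star> f \<in> Hom G X Z"
proof (rule HomI)
  fix e assume e: "e \<in> arcs G"
  define s t where st: "s = tail G e" "t = head G e"
  have v: "s \<in> verts G" "t \<in> verts G" using e by (auto simp: st)
  note c = Hom_carrier[OF assms(1) v(1)] Hom_carrier[OF assms(1) v(2)]
    Hom_carrier[OF assms(2) v(1)] Hom_carrier[OF assms(2) v(2)]
  note r = rep_carrier[OF assms(3) e, folded st] rep_carrier[OF assms(4) e, folded st]
    rep_carrier[OF assms(5) e, folded st]
  have "rmap Z e * (g s * f s) = (rmap Z e * g s) * f s"
    using assoc_mult_mat[OF r(3) c(1) c(3)] by simp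
  also have "\<dots> = (g t * rmap Y e) * f s" using Hom_arc[OF assms(1) e] by (simp add: st)
  also have "\<dots> = g t * (rmap Y e * f s)" using assoc_mult_mat[OF c(2) r(2) c(3)] by simp
  also have "\<dots> = g t * (f t * rmap X e)" using Hom_arc[OF assms(2) e] by (simp add: st)
  also have "\<dots> = (g t * f t) * rmap X e" using assoc_mult_mat[OF c(2) c(4) r(1)] by simp
  finally show "rmap Z e * (g \<star> f) (tail G e) = (g \<star> f) (head G e) * rmap X e"
    using v by (simp add: mor_comp_def st)
qed (use assms in \<open>auto simp: mor_comp_def intro!: mult_carrier_mat dest: Hom_carrier\<close>)

lemma id_in_Hom: "is_rep G X \<Longrightarrow> mor_id G X \<in> Hom G X X"
  by (intro HomI) (auto simp: mor_id_def dest!: rep_carrier)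

lemma zero_in_Hom: "is_rep G X \<Longrightarrow> is_rep G Y \<Longrightarrow> mor_zero G X Y \<in> Hom G X Y"
  by (intro HomI) (auto simp: mor_zero_def dest!: rep_carrier)

lemma smult_in_Hom:
  assumes "is_rep G X" "is_rep G Y" "f \<in> Hom G X Y" shows "mor_smult G c f \<in> Hom G X Y"
proof (rule HomI)
  fix e assume e: "e \<in> arcs G"
  then have v: "tail G e \<in> verts G" "head G e \<in> verts G" by auto
  show "rmap Y e * mor_smult G c f (tail G e) = mor_smult G c f (head G e) * rmap X e"
    using v Hom_arc[OF assms(3) e] mult_smult_distrib[OF rep_carrier[OF assms(2) e] Hom_carrier[OF assms(3) v(1)]]
      mult_smult_assoc_mat[OF Hom_carrier[OF assms(3) v(2)] rep_carrier[OF assms(1) e]]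
    by (simp add: mor_smult_def)
qed (use assms in \<open>auto simp: mor_smult_def dest: Hom_carrier\<close>)

text \<open>Matrix multiplication distributes over the entrywise sums by which \<open>mor_sum\<close> is defined.\<close>

lemma mat_sum_mult_right:
  fixes F :: "'i \<Rightarrow> 'k::field mat"
  assumes "\<And>a. a \<in> I \<Longrightarrow> F a \<in> carrier_mat n m" "B \<in> carrier_mat m k"
  shows "mat n m (\<lambda>(i, j). \<Sum>a\<in>I. F a $$ (i, j)) * B = mat n k (\<lambda>(i, j). \<Sum>a\<in>I. (F a * B) $$ (i, j))"
proof (rule eq_matI)
  fix i j assume "i < dim_row (mat n k (\<lambda>(i, j). \<Sum>a\<in>I. (F a * B) $$ (i, j)))"
    "j < dim_col (mat n k (\<lambda>(i, j). \<Sum>a\<in>I. (F a * B) $$ (i, j)))"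
  then have ij: "i < n" "j < k" by auto
  have "(\<Sum>l = 0..<m. (\<Sum>a\<in>I. F a $$ (i, l)) * B $$ (l, j)) = (\<Sum>a\<in>I. \<Sum>l = 0..<m. F a $$ (i, l) * B $$ (l, j))"
    by (simp add: sum_distrib_right) (rule sum.swap)
  also have "\<dots> = (\<Sum>a\<in>I. (F a * B) $$ (i, j))"
  proof (rule sum.cong)
    fix a assume "a \<in> I"
    then show "(\<Sum>l = 0..<m. F a $$ (i, l) * B $$ (l, j)) = (F a * B) $$ (i, j)"
      using assms(1)[of a] assms(2) ij by (auto simp: scalar_prod_def)
  qed simp
  finally show "(mat n m (\<lambda>(i, j). \<Sum>a\<in>I. F a $$ (i, j)) * B) $$ (i, j)
      = mat n k (\<lambda>(i, j). \<Sum>a\<in>I. (F a * B) $$ (i, j)) $$ (i, j)"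
    using assms(2) ij by (auto simp: scalar_prod_def)
qed (use assms in auto)

lemma mat_sum_mult_left:
  fixes F :: "'i \<Rightarrow> 'k::field mat"
  assumes "\<And>a. a \<in> I \<Longrightarrow> F a \<in> carrier_mat n m" "B \<in> carrier_mat k n"
  shows "B * mat n m (\<lambda>(i, j). \<Sum>a\<in>I. F a $$ (i, j)) = mat k m (\<lambda>(i, j). \<Sum>a\<in>I. (B * F a) $$ (i, j))"
proof (rule eq_matI)
  fix i j assume "i < dim_row (mat k m (\<lambda>(i, j). \<Sum>a\<in>I. (B * F a) $$ (i, j)))"
    "j < dim_col (mat k m (\<lambda>(i, j). \<Sum>a\<in>I. (B * F a) $$ (i, j)))"
  then have ij: "i < k" "j < m" by auto
  have "(\<Sum>l = 0..<n. B $$ (i, l) * (\<Sum>a\<in>I. F a $$ (l, j))) = (\<Sum>a\<in>I. \<Sum>l = 0..<n. B $$ (i, l) * F a $$ (l, j))"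
    by (simp add: sum_distrib_left) (rule sum.swap)
  also have "\<dots> = (\<Sum>a\<in>I. (B * F a) $$ (i, j))"
  proof (rule sum.cong)
    fix a assume "a \<in> I"
    then show "(\<Sum>l = 0..<n. B $$ (i, l) * F a $$ (l, j)) = (B * F a) $$ (i, j)"
      using assms(1)[of a] assms(2) ij by (auto simp: scalar_prod_def)
  qed simp
  finally show "(B * mat n m (\<lambda>(i, j). \<Sum>a\<in>I. F a $$ (i, j))) $$ (i, j)
      = mat k m (\<lambda>(i, j). \<Sum>a\<in>I. (B * F a) $$ (i, j)) $$ (i, j)"
    using assms(2) ij by (auto simp: scalar_prod_def)
qed (use assms in auto)

lemma sum_in_Hom:
  assumes "is_rep G X" "is_rep G Y" "\<And>a. a \<in> I \<Longrightarrow> F a \<in> Hom G X Y"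
  shows "mor_sum X Y I F \<in> Hom G X Y"
proof (rule HomI)
  fix e assume e: "e \<in> arcs G"
  then have v: "tail G e \<in> verts G" "head G e \<in> verts G" by auto
  show "rmap Y e * mor_sum X Y I F (tail G e) = mor_sum X Y I F (head G e) * rmap X e"
    using v mat_sum_mult_left[of I "\<lambda>a. F a (tail G e)", OF Hom_carrier[OF assms(3) v(1)] rep_carrier[OF assms(2) e]]
      mat_sum_mult_right[of I "\<lambda>a. F a (head G e)", OF Hom_carrier[OF assms(3) v(2)] rep_carrier[OF assms(1) e]]
      Hom_arc[OF assms(3) e]
    by (auto simp: mor_sum_def intro!: cong_mat)
qed (auto simp: mor_sum_def)

lemma add_in_Hom:
  assumes "is_rep G X" "is_rep G Y" "f \<in> Hom G X Y" "g \<in> Hom G X Y"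
  shows "mor_add G f g \<in> Hom G X Y"
proof -
  have "mor_add G f g = mor_sum X Y (UNIV :: bool set) (\<lambda>b. if b then f else g)"
    using assms(3,4)
    by (auto simp: mor_add_def mor_sum_def UNIV_bool fun_eq_iff add.commute intro!: eq_matI)
  moreover have "\<dots> \<in> Hom G X Y" using assms by (intro sum_in_Hom) auto
  ultimately show ?thesis by simp
qed

lemma comp_assoc:
  assumes "f \<in> Hom G X Y" "g \<in> Hom G Y Z" "h \<in> Hom G Z W"
  shows "h \<star> g \<star> f = h \<star> (g \<star> f)"
  using assoc_mult_mat[OF assms(3,2,1)[THEN Hom_carrier]] by (auto simp: mor_comp_def fun_eq_iff)

lemma comp_id [simp]:
  assumes "f \<in> Hom G X Y" shows "f \<star> mor_id G X = f" "mor_id G Y \<star> f = f"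
  using assms right_mult_one_mat[OF Hom_carrier[OF assms]] left_mult_one_mat[OF Hom_carrier[OF assms]]
  by (auto simp: mor_comp_def mor_id_def fun_eq_iff Hom_def PiE_def extensional_def)

lemma comp_zero [simp]:
  assumes "f \<in> Hom G X Y" shows "f \<star> mor_zero G Z X = mor_zero G Z Y" "mor_zero G Y Z \<star> f = mor_zero G X Z"
  using right_mult_zero_mat[OF Hom_carrier[OF assms]] left_mult_zero_mat[OF Hom_carrier[OF assms]]
  by (auto simp: mor_comp_def mor_zero_def fun_eq_iff)

lemma comp_smult:
  assumes "f \<in> Hom G X Y" "g \<in> Hom G Y Z"
  shows "g \<star> mor_smult G c f = mor_smult G c (g \<star> f)" "mor_smult G c g \<star> f = mor_smult G c (g \<star> f)"
  using mult_smult_distrib[OF assms(2,1)[THEN Hom_carrier]] mult_smult_assoc_mat[OF assms(2,1)[THEN Hom_carrier]]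
  by (auto simp: mor_comp_def mor_smult_def fun_eq_iff)

lemma comp_add_left:
  assumes "f \<in> Hom G X Y" "g \<in> Hom G Y Z" "g' \<in> Hom G Y Z"
  shows "mor_add G g g' \<star> f = mor_add G (g \<star> f) (g' \<star> f)"
  using add_mult_distrib_mat[OF assms(2,3,1)[THEN Hom_carrier]]
  by (auto simp: mor_comp_def mor_add_def fun_eq_iff)

lemma comp_add_right:
  assumes "f \<in> Hom G X Y" "f' \<in> Hom G X Y" "g \<in> Hom G Y Z"
  shows "g \<star> mor_add G f f' = mor_add G (g \<star> f) (g \<star> f')"
  using mult_add_distrib_mat[OF assms(3,1,2)[THEN Hom_carrier]]
  by (auto simp: mor_comp_def mor_add_def fun_eq_iff)

lemma comp_sum_right:
  assumes "\<And>a. a \<in> I \<Longrightarrow> F a \<in> Hom G X Y" "g \<in> Hom G Y Z"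
  shows "g \<star> mor_sum X Y I F = mor_sum X Z I (\<lambda>a. g \<star> F a)"
proof
  fix v show "(g \<star> mor_sum X Y I F) v = mor_sum X Z I (\<lambda>a. g \<star> F a) v"
    using mat_sum_mult_left[of I "\<lambda>a. F a v" _ _ "g v", OF assms[THEN Hom_carrier]]
    by (cases "v \<in> verts G") (auto simp: mor_comp_def mor_sum_def)
qed

lemma comp_sum_left:
  assumes "\<And>a. a \<in> I \<Longrightarrow> F a \<in> Hom G Y Z" "g \<in> Hom G X Y"
  shows "mor_sum Y Z I F \<star> g = mor_sum X Z I (\<lambda>a. F a \<star> g)"
proof
  fix v show "(mor_sum Y Z I F \<star> g) v = mor_sum X Z I (\<lambda>a. F a \<star> g) v"
    using mat_sum_mult_right[of I "\<lambda>a. F a v" _ _ "g v", OF assms[THEN Hom_carrier]]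
    by (cases "v \<in> verts G") (auto simp: mor_comp_def mor_sum_def)
qed

lemma mor_sum_cong: "(\<And>a. a \<in> I \<Longrightarrow> F a = F' a) \<Longrightarrow> mor_sum X Y I F = mor_sum X Y I F'"
  unfolding mor_sum_def by (auto simp: fun_eq_iff intro!: cong_mat sum.cong)

lemma mor_sum_zero: "(\<And>a. a \<in> I \<Longrightarrow> F a = mor_zero G X Y) \<Longrightarrow> mor_sum X Y I F = mor_zero G X Y"
  unfolding mor_sum_def mor_zero_def by (auto simp: fun_eq_iff intro!: eq_matI)

lemma mor_sum_single:
  assumes "finite I" "b \<in> I" "F b \<in> Hom G X Y" "\<And>a. a \<in> I \<Longrightarrow> a \<noteq> b \<Longrightarrow> F a = mor_zero G X Y"
  shows "mor_sum X Y I F = F b"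
proof
  fix v show "mor_sum X Y I F v = F b v"
  proof (cases "v \<in> verts G")
    case True
    have "(\<Sum>a\<in>I. F a v $$ (i, j)) = F b v $$ (i, j)" if "i < rdim Y v" "j < rdim X v" for i j
    proof -
      have "(\<Sum>a\<in>I. F a v $$ (i, j)) = (\<Sum>a\<in>I. if a = b then F b v $$ (i, j) else 0)"
        using assms(4) True that by (intro sum.cong) (auto simp: mor_zero_def)
      then show ?thesis using assms(1,2) by simp
    qed
    then show ?thesis using True Hom_carrier[OF assms(3) True] by (auto simp: mor_sum_def intro!: eq_matI)
  qed (use assms(3) in \<open>auto simp: mor_sum_def Hom_def PiE_def extensional_def\<close>)
qed

lemma mor_sum_insert:
  assumes "finite I" "b \<notin> I" "F b \<in> Hom G X Y"
  shows "mor_sum X Y (insert b I) F = mor_add G (F b) (mor_sum X Y I F)"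
  using assms
  by (auto simp: mor_sum_def mor_add_def fun_eq_iff intro!: eq_matI)

lemma mor_add_zero [simp]:
  assumes "f \<in> Hom G X Y" shows "mor_add G f (mor_zero G X Y) = f" "mor_add G (mor_zero G X Y) f = f"
  using assms right_add_zero_mat[OF Hom_carrier[OF assms]] left_add_zero_mat[OF Hom_carrier[OF assms]]
  by (auto simp: mor_add_def mor_zero_def fun_eq_iff Hom_def PiE_def extensional_def)

lemma mor_smult_1 [simp]: "f \<in> Hom G X Y \<Longrightarrow> mor_smult G 1 f = f"
  by (auto simp: mor_smult_def fun_eq_iff Hom_def PiE_def extensional_def)

lemma mor_smult_0 [simp]: "f \<in> Hom G X Y \<Longrightarrow> mor_smult G 0 f = mor_zero G X Y"
  by (auto simp: mor_smult_def mor_zero_def fun_eq_iff intro!: eq_matI)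

lemma mor_smult_zero [simp]: "mor_smult G c (mor_zero G X Y) = mor_zero G X Y"
  by (auto simp: mor_smult_def mor_zero_def fun_eq_iff intro!: eq_matI)

lemma mor_smult_smult: "f \<in> Hom G X Y \<Longrightarrow> mor_smult G c (mor_smult G d f) = mor_smult G (c * d) f"
  by (auto simp: mor_smult_def fun_eq_iff intro!: eq_matI)

lemma mor_smult_add: "f \<in> Hom G X Y \<Longrightarrow> mor_add G (mor_smult G c f) (mor_smult G d f) = mor_smult G (c + d) f"
  by (auto simp: mor_smult_def mor_add_def fun_eq_iff algebra_simps intro!: eq_matI)

lemma mor_add_neg: "f \<in> Hom G X Y \<Longrightarrow> mor_add G f (mor_smult G (- 1) f) = mor_zero G X Y"
  using mor_smult_add[of f X Y 1 "-1"] by simp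

lemma mor_add_assoc:
  "f \<in> Hom G X Y \<Longrightarrow> g \<in> Hom G X Y \<Longrightarrow> h \<in> Hom G X Y
    \<Longrightarrow> mor_add G (mor_add G f g) h = mor_add G f (mor_add G g h)"
  by (auto simp: mor_add_def fun_eq_iff add.assoc intro!: eq_matI)

lemma mor_add_comm:
  "f \<in> Hom G X Y \<Longrightarrow> g \<in> Hom G X Y \<Longrightarrow> mor_add G f g = mor_add G g f"
  by (auto simp: mor_add_def fun_eq_iff add.commute intro!: eq_matI)

lemma End_algebra_ring:
  fixes X :: "('v, 'e, 'k::field) rep"
  assumes X: "is_rep G X" shows "ring (End_algebra G X)"
proof (rule ringI)
  note [simp] = End_algebra_def comp_in_Hom[OF _ _ X X X] id_in_Hom[OF X] zero_in_Hom[OF X X] add_in_Hom[OF X X]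
    smult_in_Hom[OF X X]
  show "abelian_group (End_algebra G X)"
  proof (rule abelian_groupI)
    fix f assume "f \<in> carrier (End_algebra G X)"
    then show "\<exists>g\<in>carrier (End_algebra G X). g \<oplus>\<^bsub>End_algebra G X\<^esub> f = \<zero>\<^bsub>End_algebra G X\<^esub>"
      using mor_add_neg[of f X X] mor_add_comm[of f X X]
      by (intro bexI[of _ "mor_smult G (- 1) f"]) auto
  qed (auto intro: mor_add_assoc mor_add_comm)
  show "Group.monoid (End_algebra G X)"
    by (rule monoidI) (auto intro: comp_assoc)
qed (auto simp: End_algebra_def intro: comp_add_left comp_add_right)

end

section \<open>Direct sums of representations\<close>

context quiver begin

text \<open>A direct sum decomposition is recorded by its injections and projections. This makes the notion
  invariant under isomorphism, whereas \<^const>\<open>rep_sum\<close> fixes bases and block diagonal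
  matrices.\<close>

definition is_dsum :: "('v, 'e, 'k::field) rep \<Rightarrow> 'i set \<Rightarrow> ('i \<Rightarrow> ('v, 'e, 'k) rep)
    \<Rightarrow> ('i \<Rightarrow> ('v, 'k) rep_mor) \<Rightarrow> ('i \<Rightarrow> ('v, 'k) rep_mor) \<Rightarrow> bool" where
  "is_dsum X I F \<iota> \<pi> \<longleftrightarrow> finite I \<and> is_rep G X \<and>
     (\<forall>i\<in>I. is_rep G (F i) \<and> \<iota> i \<in> Hom G (F i) X \<and> \<pi> i \<in> Hom G X (F i)) \<and>
     (\<forall>i\<in>I. \<forall>j\<in>I. \<pi> i \<star> \<iota> j = (if i = j then mor_id G (F i) else mor_zero G (F j) (F i))) \<and>
     mor_sum X X I (\<lambda>i. \<iota> i \<star> \<pi> i) = mor_id G X"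

text \<open>The case of two summands, with the four structure maps named. Isomorphisms onto a two-term
  \<^const>\<open>rep_sum\<close> are exchanged for these data by \<open>rep_iso_sum2_iff\<close> below.\<close>

definition is_biproduct :: "('v, 'e, 'k::field) rep \<Rightarrow> ('v, 'e, 'k) rep \<Rightarrow> ('v, 'e, 'k) rep
    \<Rightarrow> ('v, 'k) rep_mor \<Rightarrow> ('v, 'k) rep_mor \<Rightarrow> ('v, 'k) rep_mor \<Rightarrow> ('v, 'k) rep_mor \<Rightarrow> bool" where
  "is_biproduct X Y Z i p j q \<longleftrightarrow> is_rep G X \<and> is_rep G Y \<and> is_rep G Z \<and>
     i \<in> Hom G Y X \<and> p \<in> Hom G X Y \<and> j \<in> Hom G Z X \<and> q \<in> Hom G X Z \<and>
     p \<star> i = mor_id G Y \<and> q \<star> j = mor_id G Z \<and> p \<star> j = mor_zero G Z Y \<and> q \<star> i = mor_zero G Y Z \<and>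
     mor_add G (i \<star> p) (j \<star> q) = mor_id G X"

lemma dsum_decompose:
  assumes "is_dsum X I F \<iota> \<pi>" "is_rep G W" "f \<in> Hom G W X"
  shows "f = mor_sum W X I (\<lambda>i. \<iota> i \<star> (\<pi> i \<star> f))"
proof -
  from assms have "f = mor_sum X X I (\<lambda>i. \<iota> i \<star> \<pi> i) \<star> f" by (simp add: is_dsum_def)
  also have "\<dots> = mor_sum W X I (\<lambda>i. \<iota> i \<star> \<pi> i \<star> f)"
    using assms unfolding is_dsum_def by (intro comp_sum_left; blast intro: comp_in_Hom)
  also have "\<dots> = mor_sum W X I (\<lambda>i. \<iota> i \<star> (\<pi> i \<star> f))"
    using assms by (intro mor_sum_cong comp_assoc) (auto simp: is_dsum_def)
  finally show ?thesis .
qed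

lemma dsum_codecompose:
  assumes "is_dsum X I F \<iota> \<pi>" "is_rep G W" "f \<in> Hom G X W"
  shows "f = mor_sum X W I (\<lambda>i. f \<star> \<iota> i \<star> \<pi> i)"
proof -
  from assms have "f = f \<star> mor_sum X X I (\<lambda>i. \<iota> i \<star> \<pi> i)" by (simp add: is_dsum_def)
  also have "\<dots> = mor_sum X W I (\<lambda>i. f \<star> (\<iota> i \<star> \<pi> i))"
    using assms unfolding is_dsum_def by (intro comp_sum_right; blast intro: comp_in_Hom)
  also have "\<dots> = mor_sum X W I (\<lambda>i. f \<star> \<iota> i \<star> \<pi> i)"
    using assms by (intro mor_sum_cong comp_assoc[symmetric]) (auto simp: is_dsum_def)
  finally show ?thesis .
qed

text \<open>Matrix entries suffice, since \<open>\<Sum> \<iota> i \<star> \<pi> i = 1\<close> can be inserted on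
  both sides.\<close>

lemma dsum_eqI:
  assumes X: "is_dsum X I F \<iota> \<pi>" and f: "f \<in> Hom G X X" "g \<in> Hom G X X"
    and eq: "\<And>i j. i \<in> I \<Longrightarrow> j \<in> I \<Longrightarrow> \<pi> i \<star> (f \<star> \<iota> j) = \<pi> i \<star> (g \<star> \<iota> j)"
  shows "f = g"
proof -
  have r: "is_rep G X" "\<And>i. i \<in> I \<Longrightarrow> is_rep G (F i)" "\<And>i. i \<in> I \<Longrightarrow> \<iota> i \<in> Hom G (F i) X"
    using X by (auto simp: is_dsum_def)
  have "f \<star> \<iota> j = g \<star> \<iota> j" if j: "j \<in> I" for j
  proof -
    have "f \<star> \<iota> j = mor_sum (F j) X I (\<lambda>i. \<iota> i \<star> (\<pi> i \<star> (f \<star> \<iota> j)))"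
      using j r f by (intro dsum_decompose[OF X]; blast intro: comp_in_Hom)
    also have "\<dots> = mor_sum (F j) X I (\<lambda>i. \<iota> i \<star> (\<pi> i \<star> (g \<star> \<iota> j)))"
      using eq j by (intro mor_sum_cong) simp
    also have "\<dots> = g \<star> \<iota> j"
      using j r f by (intro dsum_decompose[OF X, symmetric]; blast intro: comp_in_Hom)
    finally show ?thesis .
  qed
  then have eq': "mor_sum X X I (\<lambda>i. f \<star> \<iota> i \<star> \<pi> i) = mor_sum X X I (\<lambda>i. g \<star> \<iota> i \<star> \<pi> i)"
    by (intro mor_sum_cong) simp
  show ?thesis
    by (rule trans[OF dsum_codecompose[OF X r(1) f(1)] trans[OF eq' dsum_codecompose[OF X r(1) f(2), symmetric]]])
qed

text \<open>Conversely, components may be prescribed freely: sum the given morphisms after composing them with the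
  structure maps.\<close>

lemma dsum_matrix:
  assumes X: "is_dsum X I F \<iota> \<pi>"
    and h: "\<And>i j. i \<in> I \<Longrightarrow> j \<in> I \<Longrightarrow> h i j \<in> Hom G (F j) (F i)"
  obtains f where "f \<in> Hom G X X" "\<And>i j. i \<in> I \<Longrightarrow> j \<in> I \<Longrightarrow> \<pi> i \<star> (f \<star> \<iota> j) = h i j"
proof -
  have r: "is_rep G X" "\<And>i. i \<in> I \<Longrightarrow> is_rep G (F i)" "\<And>i. i \<in> I \<Longrightarrow> \<iota> i \<in> Hom G (F i) X"
     "\<And>i. i \<in> I \<Longrightarrow> \<pi> i \<in> Hom G X (F i)" "finite I"
    "\<And>i. i \<in> I \<Longrightarrow> \<pi> i \<star> \<iota> i = mor_id G (F i)"
    "\<And>i j. i \<in> I \<Longrightarrow> j \<in> I \<Longrightarrow> i \<noteq> j \<Longrightarrow> \<pi> i \<star> \<iota> j = mor_zero G (F j) (F i)"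
    using X by (auto simp: is_dsum_def)
  \<comment> \<open>\<open>col j\<close> is the \<open>j\<close>-th column of the matrix, a morphism into the sum\<close>
  define col where "col j = mor_sum (F j) X I (\<lambda>i. \<iota> i \<star> h i j)" for j
  define f where "f = mor_sum X X I (\<lambda>j. col j \<star> \<pi> j)"
  have col: "col j \<in> Hom G (F j) X" if "j \<in> I" for j
    unfolding col_def using that r h by (intro sum_in_Hom; blast intro: comp_in_Hom)
  have f: "f \<in> Hom G X X" unfolding f_def using r col by (intro sum_in_Hom; blast intro: comp_in_Hom)
  have fj: "f \<star> \<iota> j = col j" if j: "j \<in> I" for j
  proof -
    have "f \<star> \<iota> j = mor_sum (F j) X I (\<lambda>i. col i \<star> \<pi> i \<star> \<iota> j)"
      unfolding f_def using r col j by (intro comp_sum_left; blast intro: comp_in_Hom)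
    also have "\<dots> = col j \<star> \<pi> j \<star> \<iota> j"
    proof (rule mor_sum_single)
      fix i assume "i \<in> I" "i \<noteq> j"
      then show "col i \<star> \<pi> i \<star> \<iota> j = mor_zero G (F j) X"
        using j r(7) comp_assoc[OF r(3) r(4) col] comp_zero[OF col] by simp
    qed (use r col j in \<open>(blast intro: comp_in_Hom)+\<close>)
    also have "\<dots> = col j" using j r(6) comp_assoc[OF r(3) r(4) col] comp_id(1)[OF col] by simp
    finally show ?thesis .
  qed
  have "\<pi> i \<star> (f \<star> \<iota> j) = h i j" if ij: "i \<in> I" "j \<in> I" for i j
  proof -
    have "\<pi> i \<star> (f \<star> \<iota> j) = mor_sum (F j) (F i) I (\<lambda>l. \<pi> i \<star> (\<iota> l \<star> h l j))"
      unfolding fj[OF ij(2)] unfolding col_def using r h ij by (intro comp_sum_right; blast intro: comp_in_Hom)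
    also have "\<dots> = \<pi> i \<star> (\<iota> i \<star> h i j)"
    proof (rule mor_sum_single)
      fix l assume "l \<in> I" "l \<noteq> i"
      then show "\<pi> i \<star> (\<iota> l \<star> h l j) = mor_zero G (F j) (F i)"
        using ij r(7) comp_assoc[OF h r(3) r(4), symmetric] comp_zero[OF h] by simp
    qed (use r h ij in \<open>(blast intro: comp_in_Hom)+\<close>)
    also have "\<dots> = h i j" using ij r(6) comp_assoc[OF h r(3) r(4), symmetric] comp_id(2)[OF h] by simp
    finally show ?thesis .
  qed
  with f show ?thesis by (rule that)
qed

text \<open>Two sums of the same family are identified by \<open>\<Sum> \<iota>' i \<star> \<pi> i\<close>, whose
  inverse is the same expression with the roles exchanged.\<close>

lemma dsum_iso:
  assumes X: "is_dsum X I F \<iota> \<pi>" and X': "is_dsum X' I F \<iota>' \<pi>'"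
  shows "rep_iso G X X'"
proof -
  have 1: "mor_sum X' X I (\<lambda>i. \<iota> i \<star> \<pi>' i) \<star> mor_sum X X' I (\<lambda>i. \<iota>' i \<star> \<pi> i) = mor_id G X"
    and 2: "mor_sum X X' I (\<lambda>i. \<iota>' i \<star> \<pi> i) \<in> Hom G X X'"
    if X: "is_dsum X I F \<iota> \<pi>" and X': "is_dsum X' I F \<iota>' \<pi>'" for X X' \<iota> \<iota>' \<pi> \<pi>'
  proof -
    have r: "is_rep G X" "\<And>i. i \<in> I \<Longrightarrow> is_rep G (F i)" "\<And>i. i \<in> I \<Longrightarrow> \<iota> i \<in> Hom G (F i) X"
       "\<And>i. i \<in> I \<Longrightarrow> \<pi> i \<in> Hom G X (F i)" "finite I"
      "mor_sum X X I (\<lambda>i. \<iota> i \<star> \<pi> i) = mor_id G X"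
      using X by (auto simp: is_dsum_def)
    have r': "is_rep G X'" "\<And>i. i \<in> I \<Longrightarrow> \<iota>' i \<in> Hom G (F i) X'"
       "\<And>i. i \<in> I \<Longrightarrow> \<pi>' i \<in> Hom G X' (F i)"
      "\<And>i. i \<in> I \<Longrightarrow> \<pi>' i \<star> \<iota>' i = mor_id G (F i)"
      "\<And>i j. i \<in> I \<Longrightarrow> j \<in> I \<Longrightarrow> i \<noteq> j \<Longrightarrow> \<pi>' i \<star> \<iota>' j = mor_zero G (F j) (F i)"
      using X' by (auto simp: is_dsum_def)
    define f where "f = mor_sum X X' I (\<lambda>i. \<iota>' i \<star> \<pi> i)"
    show f: "mor_sum X X' I (\<lambda>i. \<iota>' i \<star> \<pi> i) \<in> Hom G X X'"
      using r r' by (intro sum_in_Hom; blast intro: comp_in_Hom)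
    have pf: "\<pi>' i \<star> f = \<pi> i" if i: "i \<in> I" for i
    proof -
      have "\<pi>' i \<star> f = mor_sum X (F i) I (\<lambda>j. \<pi>' i \<star> (\<iota>' j \<star> \<pi> j))"
        unfolding f_def using r r' i by (intro comp_sum_right; blast intro: comp_in_Hom)
      also have "\<dots> = \<pi>' i \<star> (\<iota>' i \<star> \<pi> i)"
      proof (rule mor_sum_single)
        fix j assume "j \<in> I" "j \<noteq> i"
        then show "\<pi>' i \<star> (\<iota>' j \<star> \<pi> j) = mor_zero G X (F i)"
          using i r'(5) comp_assoc[OF r(4) r'(2) r'(3), symmetric] comp_zero[OF r(4)] by simp
      qed (use r r' i in \<open>(blast intro: comp_in_Hom)+\<close>)
      also have "\<dots> = \<pi> i"
        using i r'(4) comp_assoc[OF r(4) r'(2) r'(3), symmetric] comp_id[OF r(4)] by simp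
      finally show ?thesis .
    qed
    have "mor_sum X' X I (\<lambda>i. \<iota> i \<star> \<pi>' i) \<star> f = mor_sum X X I (\<lambda>i. \<iota> i \<star> \<pi>' i \<star> f)"
      using r r' f unfolding f_def by (intro comp_sum_left; blast intro: comp_in_Hom)
    also have "\<dots> = mor_sum X X I (\<lambda>i. \<iota> i \<star> \<pi> i)"
      using comp_assoc[OF f r'(3) r(3)] pf by (intro mor_sum_cong) (auto simp: f_def)
    finally show "mor_sum X' X I (\<lambda>i. \<iota> i \<star> \<pi>' i) \<star> mor_sum X X' I (\<lambda>i. \<iota>' i \<star> \<pi> i) = mor_id G X"
      using r(6) by (simp add: f_def)
  qed
  show ?thesis
    unfolding rep_iso_def is_iso_def using 1[OF X X'] 1[OF X' X] 2[OF X X'] 2[OF X' X] by blast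
qed

lemma dsum_transport:
  assumes X: "is_dsum X I F \<iota> \<pi>" and X': "is_rep G X'" and f: "f \<in> Hom G X' X" and g: "g \<in> Hom G X X'"
    and gf: "g \<star> f = mor_id G X'" and fg: "f \<star> g = mor_id G X"
  shows "is_dsum X' I F (\<lambda>i. g \<star> \<iota> i) (\<lambda>i. \<pi> i \<star> f)"
proof -
  have r: "is_rep G X" "\<And>i. i \<in> I \<Longrightarrow> is_rep G (F i)" "\<And>i. i \<in> I \<Longrightarrow> \<iota> i \<in> Hom G (F i) X"
     "\<And>i. i \<in> I \<Longrightarrow> \<pi> i \<in> Hom G X (F i)" "finite I"
    "mor_sum X X I (\<lambda>i. \<iota> i \<star> \<pi> i) = mor_id G X"
    "\<And>i j. i \<in> I \<Longrightarrow> j \<in> I \<Longrightarrow> \<pi> i \<star> \<iota> j = (if i = j then mor_id G (F i) else mor_zero G (F j) (F i))"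
    using X by (auto simp: is_dsum_def)
  have "\<pi> i \<star> f \<star> (g \<star> \<iota> j) = \<pi> i \<star> \<iota> j" if "i \<in> I" "j \<in> I" for i j
    using comp_assoc[OF comp_in_Hom[OF g r(3) r(2) r(1) X'] f r(4)] comp_assoc[OF r(3) g f] that r
    by (simp add: fg comp_id[OF r(3)])
  moreover have "mor_sum X' X' I (\<lambda>i. g \<star> \<iota> i \<star> (\<pi> i \<star> f)) = mor_id G X'"
  proof -
    have "g \<star> (mor_sum X X I (\<lambda>i. \<iota> i \<star> \<pi> i) \<star> f) = g \<star> mor_sum X' X I (\<lambda>i. \<iota> i \<star> \<pi> i \<star> f)"
      using r f by (subst comp_sum_left; (blast intro: comp_in_Hom)?)
    also have "\<dots> = mor_sum X' X' I (\<lambda>i. g \<star> (\<iota> i \<star> \<pi> i \<star> f))"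
      using r f g X' by (intro comp_sum_right; blast intro: comp_in_Hom)
    also have "\<dots> = mor_sum X' X' I (\<lambda>i. g \<star> \<iota> i \<star> (\<pi> i \<star> f))"
      using comp_assoc[OF f r(4) r(3)] comp_assoc[OF comp_in_Hom[OF r(4) f X' r(1) r(2)] r(3) g] r
      by (intro mor_sum_cong) auto
    finally show ?thesis using r(6) gf comp_id(2)[OF f] by simp
  qed
  moreover have "g \<star> \<iota> i \<in> Hom G (F i) X'" "\<pi> i \<star> f \<in> Hom G X' (F i)" if "i \<in> I" for i
    using that r f g X' by (blast intro: comp_in_Hom)+
  ultimately show ?thesis
    using r(2,5,7) X' unfolding is_dsum_def by auto
qed

lemma biproduct_dsum:
  assumes "is_biproduct X Y Z i p j q"
  shows "is_dsum X UNIV (\<lambda>b. if b then Y else Z) (\<lambda>b. if b then i else j) (\<lambda>b. if b then p else q)"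
  unfolding is_dsum_def
proof (intro conjI)
  have r: "is_rep G X" "is_rep G Y" "is_rep G Z" "i \<in> Hom G Y X" "p \<in> Hom G X Y" "j \<in> Hom G Z X" "q \<in> Hom G X Z"
    using assms by (auto simp: is_biproduct_def)
  have c: "i \<star> p \<in> Hom G X X" "j \<star> q \<in> Hom G X X" using r by (blast intro: comp_in_Hom)+
  have "mor_sum X X UNIV (\<lambda>b. (if b then i else j) \<star> (if b then p else q)) = mor_add G (i \<star> p) (j \<star> q)"
    using c by (auto simp: mor_add_def mor_sum_def UNIV_bool fun_eq_iff add.commute intro!: eq_matI)
  then show "mor_sum X X UNIV (\<lambda>b. (if b then i else j) \<star> (if b then p else q)) = mor_id G X"
    using assms by (simp add: is_biproduct_def)
qed (use assms in \<open>auto simp: is_biproduct_def\<close>)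

lemma dsum_biproduct:
  assumes "is_dsum X UNIV (\<lambda>b. if b then Y else Z) \<iota> \<pi>"
  shows "is_biproduct X Y Z (\<iota> True) (\<pi> True) (\<iota> False) (\<pi> False)"
proof -
  have r: "is_rep G X" "is_rep G Y" "is_rep G Z" "\<iota> True \<in> Hom G Y X" "\<pi> True \<in> Hom G X Y"
      "\<iota> False \<in> Hom G Z X" "\<pi> False \<in> Hom G X Z"
    and eq: "mor_sum X X UNIV (\<lambda>b. \<iota> b \<star> \<pi> b) = mor_id G X"
    and z: "\<pi> True \<star> \<iota> True = mor_id G Y" "\<pi> False \<star> \<iota> False = mor_id G Z"
      "\<pi> True \<star> \<iota> False = mor_zero G Z Y" "\<pi> False \<star> \<iota> True = mor_zero G Y Z"
    using assms by (auto simp: is_dsum_def all_bool_eq)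
  have c: "\<iota> True \<star> \<pi> True \<in> Hom G X X" "\<iota> False \<star> \<pi> False \<in> Hom G X X"
    using r by (blast intro: comp_in_Hom)+
  have "mor_sum X X UNIV (\<lambda>b. \<iota> b \<star> \<pi> b) = mor_add G (\<iota> True \<star> \<pi> True) (\<iota> False \<star> \<pi> False)"
    using c by (auto simp: mor_add_def mor_sum_def UNIV_bool fun_eq_iff add.commute intro!: eq_matI)
  then show ?thesis using r eq z by (simp add: is_biproduct_def)
qed

text \<open>The induction step by which a list of summands becomes a decomposition: if one summand is split off and
  the complement is decomposed, then so is the whole.\<close>

lemma biproduct_insert_dsum:
  assumes B: "is_biproduct X (F x) Z i p j q" and Z: "is_dsum Z I F \<iota> \<pi>" and x: "x \<notin> I"
  shows "is_dsum X (insert x I) F (\<lambda>y. if y = x then i else j \<star> \<iota> y) (\<lambda>y. if y = x then p else \<pi> y \<star> q)"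
    (is "is_dsum X _ F ?i ?p")
proof -
  have b: "is_rep G X" "is_rep G (F x)" "is_rep G Z" "i \<in> Hom G (F x) X" "p \<in> Hom G X (F x)"
      "j \<in> Hom G Z X" "q \<in> Hom G X Z"
      "p \<star> i = mor_id G (F x)" "q \<star> j = mor_id G Z" "p \<star> j = mor_zero G Z (F x)" "q \<star> i = mor_zero G (F x) Z"
      "mor_add G (i \<star> p) (j \<star> q) = mor_id G X"
    using B by (auto simp: is_biproduct_def)
  have r: "\<And>i. i \<in> I \<Longrightarrow> is_rep G (F i)" "\<And>i. i \<in> I \<Longrightarrow> \<iota> i \<in> Hom G (F i) Z"
     "\<And>i. i \<in> I \<Longrightarrow> \<pi> i \<in> Hom G Z (F i)" "finite I"
    "mor_sum Z Z I (\<lambda>i. \<iota> i \<star> \<pi> i) = mor_id G Z"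
    "\<And>i j. i \<in> I \<Longrightarrow> j \<in> I \<Longrightarrow> \<pi> i \<star> \<iota> j = (if i = j then mor_id G (F i) else mor_zero G (F j) (F i))"
    using Z by (auto simp: is_dsum_def)
  have 1: "p \<star> (j \<star> \<iota> y) = mor_zero G (F y) (F x)" if "y \<in> I" for y
    using comp_assoc[OF r(2) b(6) b(5), OF that, symmetric] comp_zero[OF r(2)[OF that]] b(10) by simp
  have 2: "\<pi> y \<star> q \<star> i = mor_zero G (F x) (F y)" if "y \<in> I" for y
    using comp_assoc[OF b(4) b(7) r(3), OF that] comp_zero[OF r(3)[OF that]] b(11) by simp
  have 3: "\<pi> y \<star> q \<star> (j \<star> \<iota> z) = \<pi> y \<star> \<iota> z" if "y \<in> I" "z \<in> I" for y z
    using comp_assoc[OF comp_in_Hom[OF b(6) r(2) r(1) b(3) b(1)] b(7) r(3), OF that(2) that(2) that(1)]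
      comp_assoc[OF r(2) b(6) b(7), OF that(2), symmetric] comp_id[OF r(2)[OF that(2)]] b(9) by simp
  have jq: "j \<star> q = mor_sum X X I (\<lambda>y. ?i y \<star> ?p y)"
  proof -
    have "j \<star> q = j \<star> (mor_sum Z Z I (\<lambda>i. \<iota> i \<star> \<pi> i) \<star> q)"
      using r(5) comp_id[OF b(7)] by simp
    also have "\<dots> = j \<star> mor_sum X Z I (\<lambda>i. \<iota> i \<star> \<pi> i \<star> q)"
      using r b by (subst comp_sum_left; (blast intro: comp_in_Hom)?)
    also have "\<dots> = mor_sum X X I (\<lambda>i. j \<star> (\<iota> i \<star> \<pi> i \<star> q))"
      using r b by (intro comp_sum_right; blast intro: comp_in_Hom)
    also have "\<dots> = mor_sum X X I (\<lambda>y. ?i y \<star> ?p y)"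
      using comp_assoc[OF b(7) r(3) r(2)] comp_assoc[OF comp_in_Hom[OF r(3) b(7) b(1,3) r(1)] r(2) b(6)] x
      by (intro mor_sum_cong) auto
    finally show ?thesis .
  qed
  have ip: "i \<star> p \<in> Hom G X X" using b by (blast intro: comp_in_Hom)
  have "mor_sum X X (insert x I) (\<lambda>y. ?i y \<star> ?p y) = mor_add G (?i x \<star> ?p x) (mor_sum X X I (\<lambda>y. ?i y \<star> ?p y))"
    by (rule mor_sum_insert[OF r(4) x]) (simp add: ip)
  then have 4: "mor_sum X X (insert x I) (\<lambda>y. ?i y \<star> ?p y) = mor_id G X"
    using b(12) by (simp only: jq[symmetric] if_True simp_thms)
  have 5: "j \<star> \<iota> y \<in> Hom G (F y) X" "\<pi> y \<star> q \<in> Hom G X (F y)" if "y \<in> I" for y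
    using that b r by (blast intro: comp_in_Hom)+
  show ?thesis
    unfolding is_dsum_def
  proof (intro conjI ballI)
    fix y z assume yz: "y \<in> insert x I" "z \<in> insert x I"
    show "?p y \<star> ?i z = (if y = z then mor_id G (F y) else mor_zero G (F z) (F y))"
    proof (cases "y = x")
      case True
      then show ?thesis using b(8) 1[of z] yz(2) by (cases "z = x") simp_all
    next
      case False
      then have y: "y \<in> I" using yz by simp
      show ?thesis
      proof (cases "z = x")
        case True
        then show ?thesis using False 2[OF y] by simp
      next
        case z: False
        then have "z \<in> I" using yz by simp
        with 3[OF y] r(6)[OF y] z False show ?thesis by simp
      qed
    qed
  next
    fix y assume y: "y \<in> insert x I"
    show "is_rep G (F y)" using y b(2) r(1) by blast
    show "?i y \<in> Hom G (F y) X" using y b(4) 5(1)[of y] by (cases "y = x") simp_all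
    show "?p y \<in> Hom G X (F y)" using y b(5) 5(2)[of y] by (cases "y = x") simp_all
  qed (use b(1) r(4) 4 in \<open>simp_all only: finite_insert\<close>)
qed

end

text \<open>The coordinate inclusion of \<open>k\<close> consecutive coordinates, starting at position
  \<open>s\<close>, into a space of dimension \<open>m\<close>; \<open>proj_mat\<close> is its
  transpose, the coordinate projection.\<close>

definition incl_mat :: "nat \<Rightarrow> nat \<Rightarrow> nat \<Rightarrow> 'k::field mat" where
  "incl_mat m s k = mat m k (\<lambda>(i, j). if i = s + j then 1 else 0)"

definition proj_mat :: "nat \<Rightarrow> nat \<Rightarrow> nat \<Rightarrow> 'k::field mat" where
  "proj_mat k s m = mat k m (\<lambda>(i, j). if j = s + i then 1 else 0)"

lemma incl_mat_carrier [simp]: "incl_mat m s k \<in> carrier_mat m k" "proj_mat k s m \<in> carrier_mat k m"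
  "dim_row (incl_mat m s k) = m" "dim_col (incl_mat m s k) = k"
  "dim_row (proj_mat k s m) = k" "dim_col (proj_mat k s m) = m"
  by (auto simp: incl_mat_def proj_mat_def)

lemma mult_incl_mat:
  assumes "A \<in> carrier_mat n m"
  shows "s + k \<le> m \<Longrightarrow> A * incl_mat m s k = mat n k (\<lambda>(i, j). A $$ (i, s + j))"
    and "s + k \<le> n \<Longrightarrow> proj_mat k s n * A = mat k m (\<lambda>(i, j). A $$ (s + i, j))"
  using assms by (auto intro!: eq_matI simp: scalar_prod_def incl_mat_def proj_mat_def if_distrib if_distribR cong: if_cong)

lemma sum_shifted_delta:
  fixes f :: "nat \<Rightarrow> 'k::field"
  shows "(\<Sum>l = 0..<n. (if i = s + l then 1 else 0) * f l) = (if s \<le> i \<and> i < s + n then f (i - s) else 0)"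
    and "(\<Sum>l = 0..<n. f l * (if i = s + l then 1 else 0)) = (if s \<le> i \<and> i < s + n then f (i - s) else 0)"
proof -
  have "(\<Sum>l = 0..<n. (if i = s + l then 1 else 0) * f l) = (\<Sum>l = 0..<n. if l = i - s then (if s \<le> i then f l else 0) else 0)"
    by (rule sum.cong) auto
  also have "\<dots> = (if s \<le> i \<and> i < s + n then f (i - s) else 0)" by (subst sum.delta) auto
  finally show *: "(\<Sum>l = 0..<n. (if i = s + l then 1 else 0) * f l) = (if s \<le> i \<and> i < s + n then f (i - s) else 0)" .
  show "(\<Sum>l = 0..<n. f l * (if i = s + l then 1 else 0)) = (if s \<le> i \<and> i < s + n then f (i - s) else 0)"
    unfolding *[symmetric] by (simp only: mult.commute)
qed

lemma incl_mat_mult: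
  assumes "A \<in> carrier_mat n m"
  shows "incl_mat k s n * A = mat k m (\<lambda>(i, j). if s \<le> i \<and> i < s + n then A $$ (i - s, j) else 0)"
    and "A * proj_mat m s k = mat n k (\<lambda>(i, j). if s \<le> j \<and> j < s + m then A $$ (i, j - s) else 0)"
proof -
  have d: "dim_row A = n" "dim_col A = m" using assms by auto
  show "incl_mat k s n * A = mat k m (\<lambda>(i, j). if s \<le> i \<and> i < s + n then A $$ (i - s, j) else 0)"
  proof (rule eq_matI)
    fix i j assume "i < dim_row (mat k m (\<lambda>(i, j). if s \<le> i \<and> i < s + n then A $$ (i - s, j) else 0))"
      "j < dim_col (mat k m (\<lambda>(i, j). if s \<le> i \<and> i < s + n then A $$ (i - s, j) else 0))"
    then have ij: "i < k" "j < m" by auto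
    have "(incl_mat k s n * A) $$ (i, j) = (\<Sum>l = 0..<n. (if i = s + l then 1 else 0) * A $$ (l, j))"
      using ij d by (simp add: scalar_prod_def incl_mat_def)
    then show "(incl_mat k s n * A) $$ (i, j) = mat k m (\<lambda>(i, j). if s \<le> i \<and> i < s + n then A $$ (i - s, j) else 0) $$ (i, j)"
      using ij sum_shifted_delta(1)[of i s "\<lambda>l. A $$ (l, j)" n] by simp
  qed (simp_all add: d)
  show "A * proj_mat m s k = mat n k (\<lambda>(i, j). if s \<le> j \<and> j < s + m then A $$ (i, j - s) else 0)"
  proof (rule eq_matI)
    fix i j assume "i < dim_row (mat n k (\<lambda>(i, j). if s \<le> j \<and> j < s + m then A $$ (i, j - s) else 0))"
      "j < dim_col (mat n k (\<lambda>(i, j). if s \<le> j \<and> j < s + m then A $$ (i, j - s) else 0))"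
    then have ij: "i < n" "j < k" by auto
    have "(A * proj_mat m s k) $$ (i, j) = (\<Sum>l = 0..<m. A $$ (i, l) * (if j = s + l then 1 else 0))"
      using ij d by (simp add: scalar_prod_def proj_mat_def)
    then show "(A * proj_mat m s k) $$ (i, j) = mat n k (\<lambda>(i, j). if s \<le> j \<and> j < s + m then A $$ (i, j - s) else 0) $$ (i, j)"
      using ij sum_shifted_delta(2)[of "\<lambda>l. A $$ (i, l)" j s m] by simp
  qed (simp_all add: d)
qed

text \<open>These are the conditions for the coordinate inclusions and projections to be morphisms, when
  the arrows act by block diagonal matrices.\<close>

lemma block_diagonal_summands:
  fixes A B :: "'k::field mat"
  assumes A: "A \<in> carrier_mat a b" and B: "B \<in> carrier_mat c d"
  defines "X \<equiv> four_block_mat A (0\<^sub>m a d) (0\<^sub>m c b) B"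
  shows "X * incl_mat (b + d) 0 b = incl_mat (a + c) 0 a * A"
    and "A * proj_mat b 0 (b + d) = proj_mat a 0 (a + c) * X"
    and "X * incl_mat (b + d) b d = incl_mat (a + c) a c * B"
    and "B * proj_mat d b (b + d) = proj_mat c a (a + c) * X"
proof -
  have X: "X \<in> carrier_mat (a + c) (b + d)" using A B by (simp add: X_def)
  have d: "dim_row A = a" "dim_col A = b" "dim_row B = c" "dim_col B = d" using A B by auto
  note m = mult_incl_mat[OF X] incl_mat_mult[OF A] incl_mat_mult[OF B]
  show "X * incl_mat (b + d) 0 b = incl_mat (a + c) 0 a * A"
    by (subst m, simp, subst m) (auto simp: X_def d intro!: cong_mat)
  show "A * proj_mat b 0 (b + d) = proj_mat a 0 (a + c) * X"
    by (subst m, subst m, simp) (auto simp: X_def d intro!: cong_mat)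
  show "X * incl_mat (b + d) b d = incl_mat (a + c) a c * B"
    by (subst m, simp, subst m) (auto simp: X_def d intro!: cong_mat)
  show "B * proj_mat d b (b + d) = proj_mat c a (a + c) * X"
    by (subst m, subst m, simp) (auto simp: X_def d intro!: cong_mat)
qed

lemma summand_mats:
  fixes n m :: nat
  shows "proj_mat n 0 (n + m) * incl_mat (n + m) 0 n = (1\<^sub>m n :: 'k::field mat)"
    and "proj_mat m n (n + m) * incl_mat (n + m) n m = (1\<^sub>m m :: 'k mat)"
    and "proj_mat n 0 (n + m) * incl_mat (n + m) n m = (0\<^sub>m n m :: 'k mat)"
    and "proj_mat m n (n + m) * incl_mat (n + m) 0 n = (0\<^sub>m m n :: 'k mat)"
    and "incl_mat (n + m) 0 n * proj_mat n 0 (n + m) + incl_mat (n + m) n m * proj_mat m n (n + m) = (1\<^sub>m (n + m) :: 'k mat)"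
proof -
  note p = mult_incl_mat(2)[OF incl_mat_carrier(1)] and i = incl_mat_mult(1)[OF incl_mat_carrier(2)]
  show "proj_mat n 0 (n + m) * incl_mat (n + m) 0 n = (1\<^sub>m n :: 'k::field mat)"
    by (subst p) (auto simp: incl_mat_def intro!: eq_matI)
  show "proj_mat m n (n + m) * incl_mat (n + m) n m = (1\<^sub>m m :: 'k mat)"
    by (subst p) (auto simp: incl_mat_def intro!: eq_matI)
  show "proj_mat n 0 (n + m) * incl_mat (n + m) n m = (0\<^sub>m n m :: 'k mat)"
    by (subst p) (auto simp: incl_mat_def intro!: eq_matI)
  show "proj_mat m n (n + m) * incl_mat (n + m) 0 n = (0\<^sub>m m n :: 'k mat)"
    by (subst p) (auto simp: incl_mat_def intro!: eq_matI)
  show "incl_mat (n + m) 0 n * proj_mat n 0 (n + m) + incl_mat (n + m) n m * proj_mat m n (n + m) = (1\<^sub>m (n + m) :: 'k mat)"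
    by (subst i, subst i) (auto simp: proj_mat_def intro!: eq_matI)
qed

lemma rep_sum_Cons:
  "rdim (rep_sum (Y # Ys)) v = rdim Y v + rdim (rep_sum Ys) v"
  "rmap (rep_sum (Y # Ys)) e = four_block_mat (rmap Y e) (0\<^sub>m (dim_row (rmap Y e)) (dim_col (rmap (rep_sum Ys) e)))
     (0\<^sub>m (dim_row (rmap (rep_sum Ys) e)) (dim_col (rmap Y e))) (rmap (rep_sum Ys) e)"
  by (auto simp: rep_sum_def Let_def)

context quiver begin

lemma rep_sum_Cons_biproduct:
  fixes Y :: "('v, 'e, 'k::field) rep"
  assumes "is_rep G Y" "is_rep G (rep_sum Ys)"
  shows "\<exists>i p j q. is_biproduct (rep_sum (Y # Ys)) Y (rep_sum Ys) i p j q"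
proof -
  define X Z where XZ: "X = rep_sum (Y # Ys)" "Z = rep_sum Ys"
  define i :: "('v, 'k) rep_mor" where "i = (\<lambda>v\<in>verts G. incl_mat (rdim X v) 0 (rdim Y v))"
  define p :: "('v, 'k) rep_mor" where "p = (\<lambda>v\<in>verts G. proj_mat (rdim Y v) 0 (rdim X v))"
  define j :: "('v, 'k) rep_mor" where "j = (\<lambda>v\<in>verts G. incl_mat (rdim X v) (rdim Y v) (rdim Z v))"
  define q :: "('v, 'k) rep_mor" where "q = (\<lambda>v\<in>verts G. proj_mat (rdim Z v) (rdim Y v) (rdim X v))"
  have d: "rdim X v = rdim Y v + rdim Z v" for v using rep_sum_Cons(1) by (simp add: XZ)
  have rY: "rmap Y e \<in> carrier_mat (rdim Y (head G e)) (rdim Y (tail G e))"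
    and rZ: "rmap Z e \<in> carrier_mat (rdim Z (head G e)) (rdim Z (tail G e))" if "e \<in> arcs G" for e
    using assms[THEN rep_carrier, OF that] by (simp_all add: XZ)
  have m: "rmap X e = four_block_mat (rmap Y e) (0\<^sub>m (rdim Y (head G e)) (rdim Z (tail G e)))
      (0\<^sub>m (rdim Z (head G e)) (rdim Y (tail G e))) (rmap Z e)" if "e \<in> arcs G" for e
    using rY[OF that] rZ[OF that] by (simp add: XZ(1) rep_sum_Cons(2) XZ(2)[symmetric])
  have X: "is_rep G X" unfolding is_rep_def using m rY rZ by (auto simp: d)
  have H: "i \<in> Hom G Y X" "p \<in> Hom G X Y" "j \<in> Hom G Z X" "q \<in> Hom G X Z"
    using block_diagonal_summands[OF rY rZ]
    by (auto intro!: HomI simp: d i_def p_def j_def q_def m)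
  have "is_biproduct X Y Z i p j q"
    unfolding is_biproduct_def using assms X H
    by (auto simp: XZ(2)[symmetric] mor_add_def mor_comp_def mor_zero_def mor_id_def fun_eq_iff
        i_def p_def j_def q_def d summand_mats)
  then show ?thesis unfolding XZ by blast
qed

lemma is_rep_sum_Nil: "is_rep G (rep_sum [])"
  by (simp add: is_rep_def rep_sum_def)

lemma rep_sum_dsum:
  fixes F :: "'i \<Rightarrow> ('v, 'e, 'k::field) rep"
  assumes "distinct xs" "\<And>x. x \<in> set xs \<Longrightarrow> is_rep G (F x)"
  shows "\<exists>\<iota> \<pi>. is_dsum (rep_sum (map F xs)) (set xs) F \<iota> \<pi>"
  using assms
proof (induction xs)
  case Nil
  have "mor_sum (rep_sum []) (rep_sum []) {} F = mor_id G (rep_sum [])" for F :: "'i \<Rightarrow> ('v, 'k) rep_mor"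
    by (auto simp: mor_sum_def mor_id_def rep_sum_def fun_eq_iff intro!: eq_matI)
  then show ?case using is_rep_sum_Nil by (simp add: is_dsum_def)
next
  case (Cons x xs)
  then obtain \<iota> \<pi> where d: "is_dsum (rep_sum (map F xs)) (set xs) F \<iota> \<pi>" by auto
  then have "is_rep G (rep_sum (map F xs))" by (simp add: is_dsum_def)
  with Cons.prems rep_sum_Cons_biproduct[of "F x" "map F xs"] obtain i p j q
    where "is_biproduct (rep_sum (map F (x # xs))) (F x) (rep_sum (map F xs)) i p j q" by auto
  from biproduct_insert_dsum[OF this d] Cons.prems show ?case by auto
qed

text \<open>Reduces direct summands and decomposability, which are defined by concrete block diagonal sums, to
  equations between morphisms.\<close>

lemma rep_iso_sum2_iff:
  assumes "is_rep G X" "is_rep G Y" "is_rep G Z"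
  shows "rep_iso G X (rep_sum [Y, Z]) \<longleftrightarrow> (\<exists>i p j q. is_biproduct X Y Z i p j q)"
proof -
  have "\<exists>\<iota> \<pi>. is_dsum (rep_sum [Y, Z]) UNIV (\<lambda>b. if b then Y else Z) \<iota> \<pi>"
    using rep_sum_dsum[of "[True, False]" "\<lambda>b. if b then Y else Z"] assms by (simp add: UNIV_bool insert_commute)
  then obtain \<iota> \<pi> where d: "is_dsum (rep_sum [Y, Z]) UNIV (\<lambda>b. if b then Y else Z) \<iota> \<pi>" by blast
  show ?thesis
  proof
    assume "rep_iso G X (rep_sum [Y, Z])"
    then obtain f g where "f \<in> Hom G X (rep_sum [Y, Z])" "g \<in> Hom G (rep_sum [Y, Z]) X"
      "g \<star> f = mor_id G X" "f \<star> g = mor_id G (rep_sum [Y, Z])" by (auto simp: rep_iso_def is_iso_def)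
    from dsum_biproduct[OF dsum_transport[OF d assms(1) this]]
    show "\<exists>i p j q. is_biproduct X Y Z i p j q" by blast
  next
    assume "\<exists>i p j q. is_biproduct X Y Z i p j q"
    then show "rep_iso G X (rep_sum [Y, Z])" using dsum_iso[OF biproduct_dsum d] by blast
  qed
qed

end

section \<open>Modules and splitting off summands\<close>

text \<open>A right inverse \<open>f\<close> of a row vector \<open>g\<close> spans a complement of the kernel of
  \<open>g\<close>, and the kernel has an explicit basis: as \<open>g f = 1\<close>, some entry
  \<open>g\<^sub>j\<close> is nonzero, and the vectors
  \<open>e\<^sub>t - (g\<^sub>t / g\<^sub>j) e\<^sub>j\<close> with \<open>t \<noteq> j\<close> form a
  basis. They are the columns of \<open>K\<close>. The dual coordinates are read off from the projection
  \<open>1 - f g\<close> by dropping its \<open>j\<close>-th coordinate, which gives \<open>L\<close>.\<close>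

lemma complement_of_split_vector:
  fixes f g :: "'k::field mat"
  assumes f: "f \<in> carrier_mat n m" and g: "g \<in> carrier_mat m n" and gf: "g * f = 1\<^sub>m m" and m: "m \<le> 1"
  shows "\<exists>K L. K \<in> carrier_mat n (n - m) \<and> L \<in> carrier_mat (n - m) n \<and> L * K = 1\<^sub>m (n - m) \<and>
    f * g + K * L = 1\<^sub>m n \<and> L * f = 0\<^sub>m (n - m) m \<and> g * K = 0\<^sub>m m (n - m)"
proof (cases "m = 0")
  case True
  then have "f * g = 0\<^sub>m n n" using f g by (intro eq_matI) (auto simp: scalar_prod_def)
  then show ?thesis using f g True
    by (intro exI[of _ "1\<^sub>m n"]) (auto intro!: eq_matI)
next
  case False
  with m have m1: "m = 1" by simp
  define F where "F r = f $$ (r, 0)" for r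
  define H where "H r = g $$ (0, r)" for r
  have HF: "(\<Sum>r<n. H r * F r) = 1"
  proof -
    have "(g * f) $$ (0, 0) = (\<Sum>r<n. H r * F r)"
      using f g m1 by (auto simp: scalar_prod_def H_def F_def atLeast0LessThan)
    then show ?thesis using gf m1 by simp
  qed
  then obtain j where j: "j < n" "H j \<noteq> 0" by (metis (no_types, lifting) lessThan_iff mult_zero_left sum.neutral zero_neq_one)
  obtain s where "bij_betw s {0..<card ({..<n} - {j})} ({..<n} - {j})"
    using ex_bij_betw_nat_finite[of "{..<n} - {j}"] by blast
  then have s: "bij_betw s {0..<n - 1} ({..<n} - {j})" using j by simp
  have s1: "s c < n" "s c \<noteq> j" if "c < n - 1" for c
    using s that by (auto simp: bij_betw_def)
  have s2: "s c = s c' \<longleftrightarrow> c = c'" if "c < n - 1" "c' < n - 1" for c c'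
    using s that by (auto simp: bij_betw_def inj_on_def)
  \<comment> \<open>\<open>s\<close> enumerates the indices other than \<open>j\<close>; \<open>k\<close> holds the basis of the kernel of \<open>g\<close>, and \<open>l\<close> the projection \<open>1 - f g\<close>\<close>
  define k where "k r t = (if r = t then 1 else if r = j then - H t / H j else 0)" for r t
  define l where "l t r = (if r = t then 1 else 0) - F t * H r" for t r
  define K where "K = mat n (n - 1) (\<lambda>(r, c). k r (s c))"
  define L where "L = mat (n - 1) n (\<lambda>(c, r). l (s c) r)"
  have gK0: "(\<Sum>r<n. H r * k r (s c)) = 0" if c: "c < n - 1" for c
  proof -
    have "(\<Sum>r<n. H r * k r (s c)) = (\<Sum>r<n. (if r = s c then H (s c) else 0) + (if r = j then - H (s c) else 0))"
      using s1[OF c] j by (intro sum.cong) (auto simp: k_def)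
    then show ?thesis using s1[OF c] j by (simp add: sum.distrib)
  qed
  have LK: "(\<Sum>r<n. l (s c) r * k r (s c')) = (if c = c' then 1 else 0)" if c: "c < n - 1" "c' < n - 1" for c c'
  proof -
    have "(\<Sum>r<n. l (s c) r * k r (s c')) = (\<Sum>r<n. (if r = s c then k r (s c') else 0) - F (s c) * (H r * k r (s c')))"
      by (intro sum.cong) (auto simp: l_def algebra_simps)
    also have "\<dots> = k (s c) (s c')"
      using s1[OF c(1)] gK0[OF c(2)] by (simp add: sum_subtractf sum_distrib_left[symmetric])
    finally show ?thesis using s1 s2 c by (simp add: k_def)
  qed
  have Lf: "(\<Sum>r<n. l (s c) r * F r) = 0" if c: "c < n - 1" for c
  proof -
    have "(\<Sum>r<n. l (s c) r * F r) = (\<Sum>r<n. (if r = s c then F r else 0) - F (s c) * (H r * F r))"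
      by (intro sum.cong) (auto simp: l_def algebra_simps)
    then show ?thesis using s1[OF c] HF by (simp add: sum_subtractf sum_distrib_left[symmetric])
  qed
  have KL: "F r * H r' + (\<Sum>c<n - 1. k r (s c) * l (s c) r') = (if r = r' then 1 else 0)" if r: "r < n" "r' < n" for r r'
  proof -
    have "(\<Sum>c<n - 1. k r (s c) * l (s c) r') = (\<Sum>t\<in>{..<n} - {j}. k r t * l t r')"
      using sum.reindex_bij_betw[OF s, of "\<lambda>t. k r t * l t r'"] by (simp add: atLeast0LessThan)
    also have "\<dots> = (if r = r' then 1 else 0) - F r * H r'"
    proof (cases "r = j")
      case True
      have HFj: "(\<Sum>t\<in>{..<n} - {j}. H t * F t) = 1 - H j * F j" using HF j by (simp add: sum_diff1)
      have "(\<Sum>t\<in>{..<n} - {j}. k r t * l t r') = (\<Sum>t\<in>{..<n} - {j}. ((if t = r' then - H t / H j else 0) + H r' / H j * (H t * F t)))"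
        using True j by (intro sum.cong) (auto simp: k_def l_def field_simps)
      also have "\<dots> = (if r' = j then 0 else - H r' / H j) + H r' / H j * (1 - H j * F j)"
        using r j HFj by (simp only: sum.distrib sum_distrib_left[symmetric]) simp
      also have "\<dots> = (if r = r' then 1 else 0) - F r * H r'" using True j by (auto simp: field_simps)
      finally show ?thesis .
    next
      case False
      have "(\<Sum>t\<in>{..<n} - {j}. k r t * l t r') = (\<Sum>t\<in>{..<n} - {j}. if t = r then l r r' else 0)"
        using False by (intro sum.cong) (auto simp: k_def)
      then show ?thesis using False r by (simp add: l_def)
    qed
    finally show ?thesis by simp
  qed
  have d: "dim_row f = n" "dim_col f = 1" "dim_row g = 1" "dim_col g = n" using f g m1 by auto
  have "L * K = 1\<^sub>m (n - 1)"
    using LK by (intro eq_matI) (auto simp: K_def L_def scalar_prod_def atLeast0LessThan)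
  moreover have "f * g + K * L = 1\<^sub>m n"
    using KL d by (intro eq_matI) (auto simp: K_def L_def F_def H_def scalar_prod_def atLeast0LessThan)
  moreover have "L * f = 0\<^sub>m (n - 1) 1"
    using Lf d by (intro eq_matI) (auto simp: L_def F_def scalar_prod_def atLeast0LessThan)
  moreover have "g * K = 0\<^sub>m 1 (n - 1)"
    using gK0 d by (intro eq_matI) (auto simp: K_def H_def scalar_prod_def atLeast0LessThan)
  ultimately show ?thesis using m1 by (intro exI[of _ K] exI[of _ L]) (auto simp: K_def L_def)
qed

context quiver begin

lemma cas_path_end: "cas u p v \<Longrightarrow> path_end G u p = v"
  unfolding path_end_def by (induction p arbitrary: u) auto

lemma path_mat_carrier:
  assumes "is_rep G X" "awalk u p v"
  shows "path_mat G X u p \<in> carrier_mat (rdim X v) (rdim X u)"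
  using assms(2)
proof (induction p arbitrary: u)
  case (Cons e p)
  then have e: "e \<in> arcs G" "tail G e = u" "awalk (head G e) p v" by (auto simp: awalk_Cons_iff)
  then show ?case using Cons.IH[OF e(3)] rep_carrier[OF assms(1) e(1)] by auto
qed (auto simp: awalk_Nil_iff)

text \<open>Morphisms are natural with respect to all paths. Hence relations pass to retracts and to direct sums, as
  the two lemmas about modules below record.\<close>

lemma Hom_path_mat:
  assumes "is_rep G X" "is_rep G Y" "f \<in> Hom G X Y" "awalk u p v"
  shows "path_mat G Y u p * f u = f v * path_mat G X u p"
  using assms(4)
proof (induction p arbitrary: u)
  case Nil
  then have "u = v" "v \<in> verts G" by (auto simp: awalk_Nil_iff)
  then show ?case
    using left_mult_one_mat[OF Hom_carrier[OF assms(3)]] right_mult_one_mat[OF Hom_carrier[OF assms(3)]] by simp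
next
  case (Cons e p)
  then have e: "e \<in> arcs G" "tail G e = u" "awalk (head G e) p v" by (auto simp: awalk_Cons_iff)
  then have v: "v \<in> verts G" "head G e \<in> verts G" "u \<in> verts G" by auto
  note c = Hom_carrier[OF assms(3)] rep_carrier[OF assms(1) e(1), unfolded e(2)] rep_carrier[OF assms(2) e(1), unfolded e(2)]
    path_mat_carrier[OF assms(1) e(3)] path_mat_carrier[OF assms(2) e(3)]
  let ?h = "head G e"
  have "path_mat G Y u (e # p) * f u = path_mat G Y ?h p * (rmap Y e * f u)"
    using assoc_mult_mat[OF c(5) c(3) c(1)[OF v(3)]] by simp
  also have "\<dots> = path_mat G Y ?h p * (f ?h * rmap X e)" using Hom_arc[OF assms(3) e(1)] e(2) by simp
  also have "\<dots> = path_mat G Y ?h p * f ?h * rmap X e" using assoc_mult_mat[OF c(5) c(1)[OF v(2)] c(2)] by simp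
  also have "\<dots> = f v * path_mat G X ?h p * rmap X e" using Cons.IH[OF e(3)] by simp
  also have "\<dots> = f v * path_mat G X u (e # p)" using assoc_mult_mat[OF c(1)[OF v(1)] c(4) c(2)] by simp
  finally show ?case .
qed

lemma module_is_rep: "is_module G P X \<Longrightarrow> is_rep G X" by (simp add: is_module_def)

lemma module_iff:
  assumes "P \<subseteq> paths G" "is_rep G X"
  shows "is_module G P X \<longleftrightarrow> (\<forall>u p v. (u, p) \<in> P \<longrightarrow> awalk u p v \<longrightarrow> path_mat G X u p = 0\<^sub>m (rdim X v) (rdim X u))"
proof -
  have "\<exists>v. awalk u p v \<and> path_end G u p = v" if "(u, p) \<in> P" for u p
    using assms that cas_path_end by (auto simp: paths_def awalk_def)
  moreover have "path_end G u p = v" if "awalk u p v" for u p v using that cas_path_end by (auto simp: awalk_def)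
  ultimately show ?thesis using assms unfolding is_module_def by fastforce
qed

lemma module_retract:
  assumes P: "P \<subseteq> paths G" and N: "is_module G P N" and N': "is_rep G N'"
    and K: "K \<in> Hom G N' N" and L: "L \<in> Hom G N N'" and LK: "L \<star> K = mor_id G N'"
  shows "is_module G P N'"
  unfolding module_iff[OF P N']
proof (intro allI impI)
  fix u p v assume p: "(u, p) \<in> P" "awalk u p v"
  then have v: "u \<in> verts G" "v \<in> verts G" by auto
  note N1 = module_is_rep[OF N]
  have 0: "path_mat G N u p = 0\<^sub>m (rdim N v) (rdim N u)" using N p by (simp add: module_iff[OF P N1])
  have "path_mat G N' u p = (L v * K v) * path_mat G N' u p"
    using fun_cong[OF LK, of v] v path_mat_carrier[OF N' p(2)] by (simp add: mor_comp_def mor_id_def)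
  also have "\<dots> = L v * (K v * path_mat G N' u p)"
    by (rule assoc_mult_mat[OF Hom_carrier[OF L v(2)] Hom_carrier[OF K v(2)] path_mat_carrier[OF N' p(2)]])
  also have "\<dots> = L v * (0\<^sub>m (rdim N v) (rdim N u) * K u)" using Hom_path_mat[OF N' N1 K p(2)] 0 by simp
  also have "\<dots> = 0\<^sub>m (rdim N' v) (rdim N' u)"
    using left_mult_zero_mat[OF Hom_carrier[OF K v(1)]] right_mult_zero_mat[OF Hom_carrier[OF L v(2)]] by simp
  finally show "path_mat G N' u p = 0\<^sub>m (rdim N' v) (rdim N' u)" .
qed

lemma module_dsum:
  assumes P: "P \<subseteq> paths G" and X: "is_dsum X I F \<iota> \<pi>" and F: "\<And>i. i \<in> I \<Longrightarrow> is_module G P (F i)"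
  shows "is_module G P X"
proof -
  have r: "is_rep G X" "\<And>i. i \<in> I \<Longrightarrow> is_rep G (F i)" "\<And>i. i \<in> I \<Longrightarrow> \<iota> i \<in> Hom G (F i) X"
     "\<And>i. i \<in> I \<Longrightarrow> \<pi> i \<in> Hom G X (F i)" "finite I"
    "mor_sum X X I (\<lambda>i. \<iota> i \<star> \<pi> i) = mor_id G X"
    using X by (auto simp: is_dsum_def)
  show ?thesis
    unfolding module_iff[OF P r(1)]
  proof (intro allI impI)
    fix u p v assume p: "(u, p) \<in> P" "awalk u p v"
    then have v: "u \<in> verts G" "v \<in> verts G" by auto
    let ?p = "path_mat G X u p"
    have z: "(\<iota> i v * \<pi> i v) * ?p = 0\<^sub>m (rdim X v) (rdim X u)" if i: "i \<in> I" for i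
    proof -
      have "(\<iota> i v * \<pi> i v) * ?p = \<iota> i v * (\<pi> i v * ?p)"
        by (rule assoc_mult_mat[OF Hom_carrier[OF r(3)[OF i] v(2)] Hom_carrier[OF r(4)[OF i] v(2)] path_mat_carrier[OF r(1) p(2)]])
      also have "\<dots> = \<iota> i v * (0\<^sub>m (rdim (F i) v) (rdim (F i) u) * \<pi> i u)"
        using Hom_path_mat[OF r(1) r(2)[OF i] r(4)[OF i] p(2)] F[OF i] p by (simp add: module_iff[OF P r(2)[OF i]])
      also have "\<dots> = 0\<^sub>m (rdim X v) (rdim X u)"
        using left_mult_zero_mat[OF Hom_carrier[OF r(4)[OF i] v(1)]] right_mult_zero_mat[OF Hom_carrier[OF r(3)[OF i] v(2)]] by simp
      finally show ?thesis .
    qed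
    have "?p = mat (rdim X v) (rdim X v) (\<lambda>(a, b). \<Sum>i\<in>I. (\<iota> i v * \<pi> i v) $$ (a, b)) * ?p"
      using fun_cong[OF r(6), of v] v path_mat_carrier[OF r(1) p(2)] by (simp add: mor_sum_def mor_comp_def mor_id_def)
    also have "\<dots> = mat (rdim X v) (rdim X u) (\<lambda>(a, b). \<Sum>i\<in>I. ((\<iota> i v * \<pi> i v) * ?p) $$ (a, b))"
      by (rule mat_sum_mult_right[OF mult_carrier_mat[OF Hom_carrier[OF r(3) v(2)] Hom_carrier[OF r(4) v(2)]] path_mat_carrier[OF r(1) p(2)]])
    also have "\<dots> = 0\<^sub>m (rdim X v) (rdim X u)" using z by (intro eq_matI) auto
    finally show "?p = 0\<^sub>m (rdim X v) (rdim X u)" .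
  qed
qed

text \<open>If \<open>g f = 1\<close>, then \<open>f\<close> embeds \<open>Y\<close> as a summand of
  \<open>N\<close> with complement the kernel of \<open>g\<close>. Here the complement is needed as a
  representation on coordinate spaces, so a basis of the kernel is chosen at every vertex;
  \<open>Y\<close> being thin, the kernel of a single row vector suffices. An arrow \<open>R\<close> of
  \<open>N\<close> acts on the complement as \<open>L R K\<close>. The maps \<open>K\<close> and
  \<open>L\<close> become morphisms because \<open>K L = 1 - f g\<close> and because \<open>f\<close>
  and \<open>g\<close> commute with the arrows.\<close>

lemma split_thin_retract:
  assumes P: "P \<subseteq> paths G" and N: "is_module G P N" and Y: "is_rep G Y" and thin: "\<And>v. rdim Y v \<le> 1"
    and f: "f \<in> Hom G Y N" and g: "g \<in> Hom G N Y" and gf: "g \<star> f = mor_id G Y"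
  shows "\<exists>N' j q. is_module G P N' \<and> is_biproduct N Y N' f g j q"
proof -
  note N1 = module_is_rep[OF N]
  \<comment> \<open>the bases of the kernels are chosen simultaneously at all vertices\<close>
  define C where "C v K L \<longleftrightarrow> K \<in> carrier_mat (rdim N v) (rdim N v - rdim Y v) \<and> L \<in> carrier_mat (rdim N v - rdim Y v) (rdim N v) \<and>
    L * K = 1\<^sub>m (rdim N v - rdim Y v) \<and> f v * g v + K * L = 1\<^sub>m (rdim N v) \<and>
    L * f v = 0\<^sub>m (rdim N v - rdim Y v) (rdim Y v) \<and> g v * K = 0\<^sub>m (rdim Y v) (rdim N v - rdim Y v)" for v K L
  have "\<exists>K L. K \<in> carrier_mat (rdim N v) (rdim N v - rdim Y v) \<and> L \<in> carrier_mat (rdim N v - rdim Y v) (rdim N v) \<and>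
    L * K = 1\<^sub>m (rdim N v - rdim Y v) \<and> f v * g v + K * L = 1\<^sub>m (rdim N v) \<and>
    L * f v = 0\<^sub>m (rdim N v - rdim Y v) (rdim Y v) \<and> g v * K = 0\<^sub>m (rdim Y v) (rdim N v - rdim Y v)"
    if v: "v \<in> verts G" for v
    using fun_cong[OF gf, of v] v
    by (intro complement_of_split_vector[OF Hom_carrier[OF f v] Hom_carrier[OF g v] _ thin])
       (simp add: mor_comp_def mor_id_def)
  then have "\<forall>v. \<exists>KL. v \<in> verts G \<longrightarrow> C v (fst KL) (snd KL)" by (auto simp: C_def)
  then obtain w where w: "\<And>v. v \<in> verts G \<Longrightarrow> C v (fst (w v)) (snd (w v))" by (metis (lifting))
  define K L where "K v = fst (w v)" and "L v = snd (w v)" for v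
  have "C v (K v) (L v)" if "v \<in> verts G" for v using w[OF that] by (simp add: K_def L_def)
  then have KL: "\<And>v. v \<in> verts G \<Longrightarrow> K v \<in> carrier_mat (rdim N v) (rdim N v - rdim Y v)"
    "\<And>v. v \<in> verts G \<Longrightarrow> L v \<in> carrier_mat (rdim N v - rdim Y v) (rdim N v)"
    "\<And>v. v \<in> verts G \<Longrightarrow> L v * K v = 1\<^sub>m (rdim N v - rdim Y v)"
    "\<And>v. v \<in> verts G \<Longrightarrow> f v * g v + K v * L v = 1\<^sub>m (rdim N v)"
    "\<And>v. v \<in> verts G \<Longrightarrow> L v * f v = 0\<^sub>m (rdim N v - rdim Y v) (rdim Y v)"
    "\<And>v. v \<in> verts G \<Longrightarrow> g v * K v = 0\<^sub>m (rdim Y v) (rdim N v - rdim Y v)"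
    by (simp_all add: C_def)
  define N' where "N' = \<lparr>rdim = (\<lambda>v. rdim N v - rdim Y v), rmap = (\<lambda>e. L (head G e) * (rmap N e * K (tail G e)))\<rparr>"
  have d: "rdim N' v = rdim N v - rdim Y v" for v by (simp add: N'_def)
  note KL = KL[folded d]
  define j where "j = (\<lambda>v\<in>verts G. K v)"
  define q where "q = (\<lambda>v\<in>verts G. L v)"
  have m: "rmap N' e = L (head G e) * (rmap N e * K (tail G e))" for e by (simp add: N'_def)
  have N': "is_rep G N'" unfolding is_rep_def m using KL(1,2) N1
    by (auto intro!: mult_carrier_mat dest: rep_carrier)
  have arc: "rmap N e * K (tail G e) = K (head G e) * rmap N' e" "rmap N' e * L (tail G e) = L (head G e) * rmap N e"
    if e: "e \<in> arcs G" for e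
  proof -
    define s t where st: "s = tail G e" "t = head G e"
    have v: "s \<in> verts G" "t \<in> verts G" using e by (auto simp: st)
    note c = rep_carrier[OF N1 e, folded st] Hom_carrier[OF f] Hom_carrier[OF g] KL(1,2) rep_carrier[OF Y e, folded st]
    let ?R = "rmap N e" let ?S = "rmap Y e"
    have RK: "?R * K s \<in> carrier_mat (rdim N t) (rdim N' s)" using c(1) c(4)[OF v(1)] by (rule mult_carrier_mat)
    have LR: "L t * ?R \<in> carrier_mat (rdim N' t) (rdim N s)" using c(5)[OF v(2)] c(1) by (rule mult_carrier_mat)
    have "f t * g t * (?R * K s) = f t * (g t * (?R * K s))"
      by (rule assoc_mult_mat[OF c(2)[OF v(2)] c(3)[OF v(2)] RK])
    also have "g t * (?R * K s) = (g t * ?R) * K s"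
      by (rule assoc_mult_mat[OF c(3)[OF v(2)] c(1) c(4)[OF v(1)], symmetric])
    also have "\<dots> = ?S * g s * K s" using Hom_arc[OF g e] by (simp add: st)
    also have "\<dots> = ?S * (g s * K s)" by (rule assoc_mult_mat[OF c(6) c(3)[OF v(1)] c(4)[OF v(1)]])
    also have "f t * \<dots> = 0\<^sub>m (rdim N t) (rdim N' s)"
      using KL(6)[OF v(1)] right_mult_zero_mat[OF c(6)] right_mult_zero_mat[OF c(2)[OF v(2)]] by simp
    finally have z: "f t * g t * (?R * K s) = 0\<^sub>m (rdim N t) (rdim N' s)" .
    have "?R * K s = (f t * g t + K t * L t) * (?R * K s)" using KL(4)[OF v(2)] left_mult_one_mat[OF RK] by simp
    also have "\<dots> = f t * g t * (?R * K s) + K t * L t * (?R * K s)"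
      by (rule add_mult_distrib_mat[OF mult_carrier_mat[OF c(2)[OF v(2)] c(3)[OF v(2)]] mult_carrier_mat[OF c(4)[OF v(2)] c(5)[OF v(2)]] RK])
    also have "\<dots> = K t * L t * (?R * K s)"
      using z mult_carrier_mat[OF mult_carrier_mat[OF c(4)[OF v(2)] c(5)[OF v(2)]] RK] by simp
    also have "\<dots> = K t * (L t * (?R * K s))"
      by (rule assoc_mult_mat[OF c(4)[OF v(2)] c(5)[OF v(2)] RK])
    finally show "?R * K (tail G e) = K (head G e) * rmap N' e" by (simp add: m st)
    have "L t * ?R * (f s * g s) = L t * (?R * (f s * g s))"
      by (rule assoc_mult_mat[OF c(5)[OF v(2)] c(1) mult_carrier_mat[OF c(2)[OF v(1)] c(3)[OF v(1)]]])
    also have "?R * (f s * g s) = (?R * f s) * g s"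
      by (rule assoc_mult_mat[OF c(1) c(2)[OF v(1)] c(3)[OF v(1)], symmetric])
    also have "\<dots> = f t * ?S * g s" using Hom_arc[OF f e] by (simp add: st)
    also have "\<dots> = f t * (?S * g s)" by (rule assoc_mult_mat[OF c(2)[OF v(2)] c(6) c(3)[OF v(1)]])
    also have "L t * \<dots> = (L t * f t) * (?S * g s)"
      by (rule assoc_mult_mat[OF c(5)[OF v(2)] c(2)[OF v(2)] mult_carrier_mat[OF c(6) c(3)[OF v(1)]], symmetric])
    also have "\<dots> = 0\<^sub>m (rdim N' t) (rdim N s)"
      using KL(5)[OF v(2)] left_mult_zero_mat[OF mult_carrier_mat[OF c(6) c(3)[OF v(1)]]] by simp
    finally have z: "L t * ?R * (f s * g s) = 0\<^sub>m (rdim N' t) (rdim N s)" .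
    have "L t * ?R = L t * ?R * (f s * g s + K s * L s)" using KL(4)[OF v(1)] right_mult_one_mat[OF LR] by simp
    also have "\<dots> = L t * ?R * (f s * g s) + L t * ?R * (K s * L s)"
      by (rule mult_add_distrib_mat[OF LR mult_carrier_mat[OF c(2)[OF v(1)] c(3)[OF v(1)]] mult_carrier_mat[OF c(4)[OF v(1)] c(5)[OF v(1)]]])
    also have "\<dots> = L t * ?R * (K s * L s)"
      using z mult_carrier_mat[OF LR mult_carrier_mat[OF c(4)[OF v(1)] c(5)[OF v(1)]]] by simp
    also have "\<dots> = L t * ?R * K s * L s"
      by (rule assoc_mult_mat[OF LR c(4)[OF v(1)] c(5)[OF v(1)], symmetric])
    also have "\<dots> = L t * (?R * K s) * L s"
      using assoc_mult_mat[OF c(5)[OF v(2)] c(1) c(4)[OF v(1)]] by simp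
    finally show "rmap N' e * L (tail G e) = L (head G e) * ?R" by (simp add: m st)
  qed
  have j: "j \<in> Hom G N' N" and q: "q \<in> Hom G N N'"
    using KL(1,2) arc by (auto intro!: HomI simp: j_def q_def)
  have qj: "q \<star> j = mor_id G N'" using KL(3) by (auto simp: mor_comp_def mor_id_def j_def q_def fun_eq_iff)
  have "is_biproduct N Y N' f g j q"
    unfolding is_biproduct_def using N1 Y N' f g gf j q qj KL(4,5,6)
    by (auto simp: mor_comp_def mor_id_def mor_zero_def mor_add_def j_def q_def fun_eq_iff)
  moreover have "is_module G P N'" by (rule module_retract[OF P N N' j q qj])
  ultimately show ?thesis by blast
qed

end

section \<open>Combinatorics of the quiver\<close>

text \<open>Reachability by some path of the quiver: the s-branch only leads into the cycle, the t-branch only out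
  of it, and no path leads from one branch back to an earlier vertex of it.\<close>

fun reaches :: "vertex \<Rightarrow> vertex \<Rightarrow> bool" where
  "reaches (Sv i) (Sv j) = (i \<le> j)"
| "reaches (Tv i) (Tv j) = (i \<le> j)"
| "reaches (Rv i) (Sv j) = False"
| "reaches (Tv i) (Rv j) = False"
| "reaches (Tv i) (Sv j) = False"
| "reaches _ _ = True"

locale cycle_quiver =
  fixes a1 a2 :: nat
  assumes a1: "1 \<le> a1" and a2: "1 \<le> a2"
begin

text \<open>Branch vertices are projected to the vertex of the cycle at which their branch is attached; a vertex of
  the cycle is given by its index.\<close>

fun foot :: "vertex \<Rightarrow> nat" where
  "foot (Rv i) = i"
| "foot (Sv i) = a2"
| "foot (Tv i) = 0"

text \<open>The number of arrows of the cycle on the shortest path from \<open>r\<^sub>i\<close> to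
  \<open>r\<^sub>j\<close>.\<close>

definition cyc_dist :: "nat \<Rightarrow> nat \<Rightarrow> nat" where
  "cyc_dist i j = (if i \<le> j then j - i else j + Suc a2 - i)"

definition cyc_pred :: "nat \<Rightarrow> nat" where "cyc_pred i = (if i = 0 then a2 else i - 1)"

text \<open>The number of arrows of the s-branch from a vertex to the cycle; correspondingly,
  \<open>depth_out\<close> counts the arrows of the t-branch from the cycle to a vertex.\<close>

fun depth_in :: "vertex \<Rightarrow> nat" where
  "depth_in (Sv i) = a1 - i" | "depth_in _ = 0"

fun depth_out :: "vertex \<Rightarrow> nat" where
  "depth_out (Tv i) = i" | "depth_out _ = 0"

text \<open>Whether some path from \<open>x\<close> to \<open>y\<close> is nonzero in the Jacobian algebra. Such a
  path contains fewer than \<open>a2\<close> arrows of the cycle, hence runs through the cycle without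
  wrapping around.\<close>

definition has_nz_path :: "vertex \<Rightarrow> vertex \<Rightarrow> bool" where
  "has_nz_path x y \<longleftrightarrow> x \<in> Q0 a1 a2 \<and> y \<in> Q0 a1 a2 \<and> reaches x y \<and> cyc_dist (foot x) (foot y) < a2"

text \<open>The length of the nonzero path from \<open>x\<close> to \<open>y\<close>: its parts in the s-branch, in
  the cycle and in the t-branch.\<close>

definition path_len :: "vertex \<Rightarrow> vertex \<Rightarrow> nat" where
  "path_len x y = (depth_in x - depth_in y) + cyc_dist (foot x) (foot y) + (depth_out y - depth_out x)"

text \<open>The nonzero path from \<open>x\<close> to \<open>y\<close> runs through \<open>z\<close>. The condition
  on the distances excludes that the paths from \<open>x\<close> to \<open>z\<close> and from
  \<open>z\<close> to \<open>y\<close> together go around the cycle.\<close>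

definition between :: "vertex \<Rightarrow> vertex \<Rightarrow> vertex \<Rightarrow> bool" where
  "between x z y \<longleftrightarrow> has_nz_path x z \<and> has_nz_path z y \<and> has_nz_path x y \<and>
     cyc_dist (foot x) (foot z) + cyc_dist (foot z) (foot y) = cyc_dist (foot x) (foot y)"

text \<open>The support of the morphism \<open>M(y) \<rightarrow> M(x)\<close> that belongs to the nonzero path from
  \<open>x\<close> to \<open>y\<close>: the common support of both modules without the vertices that lie
  over the stretch of the cycle from the foot of \<open>x\<close> to the foot of \<open>y\<close>.\<close>

definition mor_supp :: "vertex \<Rightarrow> vertex \<Rightarrow> vertex set" where
  "mor_supp x y = {v \<in> suppM a1 a2 x \<inter> suppM a1 a2 y. has_nz_path x y \<and> cyc_dist (foot x) (foot y) < cyc_dist (foot x) (foot v)}"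

lemma Q0_simps [simp]:
  "Rv i \<in> Q0 a1 a2 \<longleftrightarrow> i \<le> a2" "Sv i \<in> Q0 a1 a2 \<longleftrightarrow> 1 \<le> i \<and> i < a1" "Tv i \<in> Q0 a1 a2 \<longleftrightarrow> 1 \<le> i \<and> i < a1"
  by (auto simp: Q0_def)

lemma foot_le: "x \<in> Q0 a1 a2 \<Longrightarrow> foot x \<le> a2"
  by (cases x) auto

text \<open>A uniform description of the five kinds of supports. The module \<open>M(x)\<close> vanishes on all
  vertices with the same foot as \<open>x\<close>; if \<open>x\<close> is a branch vertex, it vanishes
  moreover on a part of the opposite branch.\<close>

lemma mem_suppM:
  assumes "x \<in> Q0 a1 a2"
  shows "v \<in> suppM a1 a2 x \<longleftrightarrow> v \<in> Q0 a1 a2 \<and> foot v \<noteq> foot x \<and>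
    (case (v, x) of (Sv k, Tv i) \<Rightarrow> i < k | (Tv k, Sv i) \<Rightarrow> k < i | _ \<Rightarrow> True)"
  using assms a2 by (cases x; cases v) (auto simp: Q0_def)

lemma suppM_Q0: "x \<in> Q0 a1 a2 \<Longrightarrow> suppM a1 a2 x \<subseteq> Q0 a1 a2"
  using mem_suppM by blast

inductive_set arrows :: "arrow set" where
  "i < a2 \<Longrightarrow> (Rv i, Rv (Suc i)) \<in> arrows"
| "(Rv a2, Rv 0) \<in> arrows"
| "1 \<le> i \<Longrightarrow> Suc i < a1 \<Longrightarrow> (Sv i, Sv (Suc i)) \<in> arrows"
| "1 < a1 \<Longrightarrow> (Sv (a1 - 1), Rv a2) \<in> arrows"
| "1 < a1 \<Longrightarrow> (Rv 0, Tv 1) \<in> arrows"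
| "1 \<le> i \<Longrightarrow> Suc i < a1 \<Longrightarrow> (Tv i, Tv (Suc i)) \<in> arrows"

lemma arcs_Q: "arcs (Q a1 a2) = arrows"
proof -
  have "(u, w) \<in> arcs (Q a1 a2) \<longleftrightarrow> (u, w) \<in> arrows" for u w
    using a1 unfolding arrows.simps[of u w] Q_def cycle_arrows_def s_arrows_def t_arrows_def
    by (cases "a1 = 1") (auto simp: less_diff_conv)
  then show ?thesis by auto
qed

lemma Q_simps [simp]: "verts (Q a1 a2) = Q0 a1 a2" "tail (Q a1 a2) = fst" "head (Q a1 a2) = snd"
  by (auto simp: Q_def)

lemma arrows_Q0: "(u, w) \<in> arrows \<Longrightarrow> u \<in> Q0 a1 a2 \<and> w \<in> Q0 a1 a2"
  using a2 by (auto elim!: arrows.cases)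

lemma cyc_dist_simps [simp]: "cyc_dist i i = 0" by (simp add: cyc_dist_def)

lemma cyc_dist_le: "i \<le> a2 \<Longrightarrow> j \<le> a2 \<Longrightarrow> cyc_dist i j \<le> a2" by (auto simp: cyc_dist_def)

lemma cyc_dist_shift:
  assumes "i \<le> a2" "j \<le> a2" "l \<le> a2"
  shows "cyc_dist l j = (if cyc_dist i l \<le> cyc_dist i j then cyc_dist i j - cyc_dist i l else cyc_dist i j + Suc a2 - cyc_dist i l)"
  using assms unfolding cyc_dist_def by (cases "i \<le> l"; cases "l \<le> j"; cases "i \<le> j") auto

lemma reaches_trans: "reaches x z \<Longrightarrow> reaches z y \<Longrightarrow> reaches x y"
  by (cases x; cases y; cases z) auto

lemma has_nz_path_refl [simp]: "has_nz_path x x \<longleftrightarrow> x \<in> Q0 a1 a2"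
  using a2 by (cases x) (auto simp: has_nz_path_def)

text \<open>This is what makes the indicator function of \<open>mor_supp x y\<close> a morphism: only arrows from
  the support of the source to the support of the target impose a condition, and such an arrow neither
  enters nor leaves the set. On the cycle, the set could only be left or entered at the feet of
  \<open>x\<close> and \<open>y\<close>. On the branches, an arrow with one end outside the common
  support would contradict that \<open>x\<close> reaches \<open>y\<close>.\<close>

lemma mor_supp_arc:
  assumes "(u, w) \<in> arrows" "u \<in> suppM a1 a2 y" "w \<in> suppM a1 a2 x" "x \<in> Q0 a1 a2" "y \<in> Q0 a1 a2"
  shows "u \<in> mor_supp x y \<longleftrightarrow> w \<in> mor_supp x y"
proof (cases "has_nz_path x y")
  case True
  then have adm: "reaches x y" by (simp add: has_nz_path_def)
  note f = foot_le[OF assms(4)] foot_le[OF assms(5)] and mem = mem_suppM[OF assms(4)] mem_suppM[OF assms(5)]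
  have 1: "foot w \<noteq> foot x" "foot u \<noteq> foot y" using assms(2,3) by (auto simp: mem)
  have 2: "cyc_dist (foot x) (foot y) < cyc_dist (foot x) (foot u) \<longleftrightarrow> cyc_dist (foot x) (foot y) < cyc_dist (foot x) (foot w)"
    using assms(1) 1 f by (cases rule: arrows.cases) (auto simp: cyc_dist_def split: if_splits)
  have 3: "u \<in> suppM a1 a2 x" if "foot u \<noteq> foot x"
    using assms(1)
  proof (cases rule: arrows.cases)
    case (3 i)
    then show ?thesis using that assms(2,3) adm by (cases x; cases y) (auto simp: mem)
  next
    case 4
    then show ?thesis using that assms(2,3) adm by (cases x; cases y) (auto simp: mem)
  qed (use that assms(3) in \<open>auto simp: mem split: vertex.splits\<close>)
  have 4: "w \<in> suppM a1 a2 y" if "foot w \<noteq> foot y"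
    using assms(1)
  proof (cases rule: arrows.cases)
    case 5
    then show ?thesis using that assms(2,3) adm by (cases x; cases y) (auto simp: mem)
  next
    case (6 i)
    then show ?thesis using that assms(2,3) adm by (cases x; cases y) (auto simp: mem)
  qed (use that assms(2) in \<open>auto simp: mem split: vertex.splits\<close>)
  have "cyc_dist (foot x) (foot y) < cyc_dist (foot x) (foot u) \<Longrightarrow> foot u \<noteq> foot x"
    "cyc_dist (foot x) (foot y) < cyc_dist (foot x) (foot w) \<Longrightarrow> foot w \<noteq> foot y" by (metis cyc_dist_simps not_less_zero, metis less_irrefl)
  then show ?thesis using 2 3 4 assms(2,3) by (auto simp: mor_supp_def True)
qed (simp add: mor_supp_def)

text \<open>Going around the cycle from the foot of \<open>x\<close>, this is the last vertex, so no nonzero path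
  starting in \<open>x\<close> runs over it. Coefficients of morphisms are read off there.\<close>

lemma top_in_mor_supp:
  assumes "has_nz_path x y" shows "Rv (cyc_pred (foot x)) \<in> mor_supp x y"
proof -
  have x: "x \<in> Q0 a1 a2" "y \<in> Q0 a1 a2" "cyc_dist (foot x) (foot y) < a2"
    using assms by (auto simp: has_nz_path_def)
  note f = foot_le[OF x(1)] foot_le[OF x(2)]
  have "cyc_dist (foot x) (cyc_pred (foot x)) = a2" "cyc_pred (foot x) \<noteq> foot x" "cyc_pred (foot x) \<le> a2"
    using f a2 by (auto simp: cyc_dist_def cyc_pred_def)
  moreover from this x(3) have "cyc_pred (foot x) \<noteq> foot y" by auto
  ultimately show ?thesis using assms x by (auto simp: mor_supp_def mem_suppM)
qed

text \<open>The composition law of the morphisms between the modules. A point of the cycle beyond the stretch from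
  \<open>x\<close> to \<open>z\<close> and beyond the stretch from \<open>z\<close> to \<open>y\<close>
  exists exactly if these stretches do not cover the cycle, and then it lies beyond their concatenation.\<close>

lemma mor_supp_comp:
  assumes "has_nz_path x z" "has_nz_path z y"
  shows "mor_supp x z \<inter> mor_supp z y = (if between x z y then mor_supp x y else {})"
proof -
  have q: "x \<in> Q0 a1 a2" "y \<in> Q0 a1 a2" "z \<in> Q0 a1 a2" and adm: "reaches x z" "reaches z y" "reaches x y"
    using assms reaches_trans by (auto simp: has_nz_path_def)
  note f = q[THEN foot_le]
  have supp: "v \<in> suppM a1 a2 z" if "v \<in> suppM a1 a2 x" "v \<in> suppM a1 a2 y" "foot v \<noteq> foot z" for v
  proof (cases z)
    case (Rv l)
    then show ?thesis using that unfolding q(3)[THEN mem_suppM] q(1)[THEN mem_suppM] by (auto split: vertex.split)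
  next
    case z: (Sv l)
    then obtain i where "x = Sv i" "i \<le> l" using adm(1) by (cases x) auto
    then show ?thesis using that(1,3) z unfolding q(3)[THEN mem_suppM] q(1)[THEN mem_suppM] by (auto split: vertex.splits)
  next
    case z: (Tv l)
    then obtain j where "y = Tv j" "l \<le> j" using adm(2) by (cases y) auto
    then show ?thesis using that(2,3) z unfolding q(3)[THEN mem_suppM] q(2)[THEN mem_suppM] by (auto split: vertex.splits)
  qed
  \<comment> \<open>measured from \<open>i\<close>, a point \<open>k\<close> lies beyond both stretches iff they fit together without wrapping and \<open>k\<close> lies beyond the end\<close>
  have *: "cyc_dist i l < cyc_dist i k \<and> cyc_dist l j < cyc_dist l k \<longleftrightarrow> cyc_dist i l + cyc_dist l j = cyc_dist i j \<and> cyc_dist i j < cyc_dist i k"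
    if "i \<le> a2" "j \<le> a2" "l \<le> a2" "k \<le> a2" for i j k l
    using cyc_dist_le[OF that(1,2)] cyc_dist_le[OF that(1,3)] cyc_dist_le[OF that(1,4)]
    unfolding cyc_dist_shift[OF that(1,2,3)] cyc_dist_shift[OF that(1,4,3)] by auto
  show ?thesis
  proof (intro equalityI subsetI)
    fix v assume v: "v \<in> mor_supp x z \<inter> mor_supp z y"
    then have vs: "v \<in> suppM a1 a2 x" "v \<in> suppM a1 a2 y" "v \<in> Q0 a1 a2"
      using suppM_Q0[OF q(1)] by (auto simp: mor_supp_def)
    have "cyc_dist (foot x) (foot z) + cyc_dist (foot z) (foot y) = cyc_dist (foot x) (foot y) \<and> cyc_dist (foot x) (foot y) < cyc_dist (foot x) (foot v)"
      using v *[OF f(1,2,3) foot_le[OF vs(3)]] by (auto simp: mor_supp_def)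
    moreover from this have "has_nz_path x y"
      using q adm cyc_dist_le[OF f(1) foot_le[OF vs(3)]] by (auto simp: has_nz_path_def)
    ultimately show "v \<in> (if between x z y then mor_supp x y else {})"
      using vs assms by (auto simp: between_def mor_supp_def)
  next
    fix v assume "v \<in> (if between x z y then mor_supp x y else {})"
    then have v: "v \<in> mor_supp x y" "between x z y" by (auto split: if_splits)
    then have vs: "v \<in> suppM a1 a2 x" "v \<in> suppM a1 a2 y" "v \<in> Q0 a1 a2"
      using suppM_Q0[OF q(1)] by (auto simp: mor_supp_def)
    have "cyc_dist (foot x) (foot z) < cyc_dist (foot x) (foot v) \<and> cyc_dist (foot z) (foot y) < cyc_dist (foot z) (foot v)"
      using v *[OF f(1,2,3) foot_le[OF vs(3)]] by (auto simp: mor_supp_def between_def)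
    moreover from this have "foot v \<noteq> foot z" by auto
    ultimately show "v \<in> mor_supp x z \<inter> mor_supp z y"
      using vs supp[OF vs(1,2)] assms by (auto simp: mor_supp_def)
  qed
qed

text \<open>Along the cycle, a function that is unchanged by all arrows except those leaving
  \<open>r\<^sub>j\<close> and those entering \<open>r\<^sub>i\<close> takes two values: one on the
  stretch from \<open>i\<close> to \<open>j\<close> and one on the rest. The first value is 0, as it is
  attained at the ends of the stretch.\<close>

lemma cycle_values:
  fixes f :: "nat \<Rightarrow> 'b::zero"
  assumes ij: "i \<le> a2" "j \<le> a2" and f0: "f i = 0" "f j = 0"
    and step: "\<And>k. k < a2 \<Longrightarrow> k \<noteq> j \<Longrightarrow> Suc k \<noteq> i \<Longrightarrow> f k = f (Suc k)" "a2 \<noteq> j \<Longrightarrow> 0 \<noteq> i \<Longrightarrow> f a2 = f 0"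
    and k: "k \<le> a2"
  shows "f k = (if cyc_dist i k \<le> cyc_dist i j then 0 else f (cyc_pred i))"
proof -
  \<comment> \<open>\<open>pos n\<close> is the vertex of the cycle \<open>n\<close> steps after \<open>i\<close>; only the steps leaving \<open>j\<close> and entering \<open>i\<close> may change the value\<close>
  define pos where "pos n = (if i + n \<le> a2 then i + n else i + n - Suc a2)" for n
  have pos: "cyc_dist i (pos n) = n" if "n \<le> a2" for n using that ij by (auto simp: pos_def cyc_dist_def)
  have nxt: "f (pos n) = f (pos (Suc n))" if "n < a2" "n \<noteq> cyc_dist i j" for n
  proof -
    have j: "pos n \<noteq> j" using that pos[of n] by auto
    show ?thesis
    proof (cases "pos n = a2")
      case True
      then have "pos (Suc n) = 0" using that ij by (auto simp: pos_def split: if_splits)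
      then show ?thesis using step(2) j True that ij by (auto simp: pos_def split: if_splits)
    next
      case False
      then have "pos (Suc n) = Suc (pos n)" "pos n < a2" "Suc (pos n) \<noteq> i"
        using that ij by (auto simp: pos_def split: if_splits)
      then show ?thesis using step(1)[of "pos n"] j by simp
    qed
  qed
  have A: "f (pos n) = 0" if "n \<le> cyc_dist i j" for n
    using that
  proof (induction n)
    case (Suc n)
    then show ?case using nxt[of n] cyc_dist_le[OF ij] by simp
  qed (use f0 ij in \<open>auto simp: pos_def\<close>)
  have B: "f (pos n) = f (pos a2)" if "n \<le> a2" "cyc_dist i j < n" for n
    using that by (induction rule: inc_induct) (use nxt in auto)
  have "pos a2 = cyc_pred i" "pos (cyc_dist i k) = k" "cyc_dist i k \<le> a2"
    using ij k by (auto simp: pos_def cyc_pred_def cyc_dist_def)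
  then show ?thesis using A[of "cyc_dist i k"] B[of "cyc_dist i k"] by auto
qed

text \<open>The scalars \<open>c\<close> by which a morphism \<open>M(y) \<rightarrow> M(x)\<close> acts are
  determined by a single one. An arrow \<open>u \<rightarrow> w\<close> forces \<open>c u = c w\<close>
  if \<open>u\<close> is in the support of the source and \<open>w\<close> in that of the target. On the
  cycle, these conditions leave one constant on the arc beyond the foot of \<open>y\<close>
  (\<open>cycle_values\<close>), and on a branch they transport the value of its foot. If there is no
  nonzero path from \<open>x\<close> to \<open>y\<close>, then either this arc is empty, or
  \<open>x\<close> does not reach \<open>y\<close>; in the latter case an arrow of a branch joins the
  common support to a vertex outside, where \<open>c\<close> is 0, so the constant is 0.\<close>

lemma thin_hom_values:
  fixes c :: "vertex \<Rightarrow> 'b::zero"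
  assumes x: "x \<in> Q0 a1 a2" and y: "y \<in> Q0 a1 a2"
    and c0: "\<And>v. v \<in> Q0 a1 a2 \<Longrightarrow> v \<notin> suppM a1 a2 x \<inter> suppM a1 a2 y \<Longrightarrow> c v = 0"
    and arc: "\<And>u w. (u, w) \<in> arrows \<Longrightarrow> u \<in> suppM a1 a2 y \<Longrightarrow> w \<in> suppM a1 a2 x \<Longrightarrow> c u = c w"
  shows "\<exists>C. \<forall>v\<in>Q0 a1 a2. c v = (if v \<in> mor_supp x y then C else 0)"
proof -
  let ?X = "suppM a1 a2 x" and ?Y = "suppM a1 a2 y"
  note fx = foot_le[OF x] and fy = foot_le[OF y]
  note mem = mem_suppM[OF x] mem_suppM[OF y]
  define C where "C = c (Rv (cyc_pred (foot x)))"
  \<comment> \<open>on the cycle, the arrow condition only fails for the arrows leaving the foot of \<open>y\<close> or entering the foot of \<open>x\<close>\<close>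
  have R: "c (Rv k) = (if cyc_dist (foot x) k \<le> cyc_dist (foot x) (foot y) then 0 else C)" if "k \<le> a2" for k
    unfolding C_def
  proof (rule cycle_values[of "foot x" "foot y" "\<lambda>k. c (Rv k)" k])
    show "c (Rv (foot x)) = 0" using fx by (intro c0) (auto simp: mem)
    show "c (Rv (foot y)) = 0" using fy by (intro c0) (auto simp: mem)
    fix k assume "k < a2" "k \<noteq> foot y" "Suc k \<noteq> foot x"
    then show "c (Rv k) = c (Rv (Suc k))" by (intro arc arrows.intros) (auto simp: mem)
  next
    assume "a2 \<noteq> foot y" "0 \<noteq> foot x"
    then show "c (Rv a2) = c (Rv 0)" by (intro arc arrows.intros) (auto simp: mem)
  qed (use fx fy that in auto)
  \<comment> \<open>the common support contains the rest of the s-branch with \<open>s\<^sub>k\<close>, and the initial part of the t-branch with \<open>t\<^sub>k\<close>\<close>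
  have S: "c (Sv k) = c (Rv a2)" if "Sv k \<in> ?X" "Sv k \<in> ?Y" for k
  proof -
    have *: "foot x \<noteq> a2" "foot y \<noteq> a2" "1 \<le> k" "k \<le> a1 - 1" using that by (auto simp: mem)
    have up: "Sv m \<in> ?X" "Sv m \<in> ?Y" if "k \<le> m" "m \<le> a1 - 1" for m
      using that \<open>Sv k \<in> ?X\<close> \<open>Sv k \<in> ?Y\<close> a1 by (auto simp: mem split: vertex.splits)
    have "c (Sv m) = c (Rv a2)" if "m \<le> a1 - 1" "k \<le> m" for m
      using that
    proof (induction rule: inc_induct)
      case base
      show ?case by (rule arc[OF arrows.intros(4)]) (use * up[of "a1 - 1"] in \<open>auto simp: mem split: vertex.splits\<close>)
    next
      case (step m)
      have "c (Sv m) = c (Sv (Suc m))"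
        by (rule arc[OF arrows.intros(3)]) (use * step up[of m] up[of "Suc m"] in auto)
      with step show ?case by auto
    qed
    then show ?thesis using *(4) by simp
  qed
  have T: "c (Tv k) = c (Rv 0)" if "Tv k \<in> ?X" "Tv k \<in> ?Y" for k
  proof -
    have *: "foot x \<noteq> 0" "foot y \<noteq> 0" "1 \<le> k" "k < a1" using that by (auto simp: mem)
    have down: "Tv m \<in> ?X" "Tv m \<in> ?Y" if "m \<le> k" "1 \<le> m" for m
      using that \<open>Tv k \<in> ?X\<close> \<open>Tv k \<in> ?Y\<close> by (auto simp: mem split: vertex.splits)
    have "1 \<le> m \<Longrightarrow> m \<le> k \<Longrightarrow> c (Tv m) = c (Rv 0)" for m
    proof (induction m rule: dec_induct)
      case base
      show ?case by (rule arc[OF arrows.intros(5), symmetric]) (use * down[of 1] in \<open>auto simp: mem split: vertex.splits\<close>)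
    next
      case (step m)
      have "c (Tv m) = c (Tv (Suc m))"
        by (rule arc[OF arrows.intros(6)]) (use * step down[of m] down[of "Suc m"] in auto)
      with step show ?case by auto
    qed
    then show ?thesis using *(3) by simp
  qed
  have foot: "c v = c (Rv (foot v))" if "v \<in> ?X" "v \<in> ?Y" for v
    using S T that by (cases v) auto
  show ?thesis
  proof (cases "has_nz_path x y")
    case True
    have "c v = (if v \<in> mor_supp x y then C else 0)" if v: "v \<in> Q0 a1 a2" for v
      using c0[OF v] foot[of v] R[OF foot_le[OF v]] True
      by (cases "v \<in> ?X"; cases "v \<in> ?Y") (auto simp: mor_supp_def)
    then show ?thesis by blast
  next
    case False
    have "c (Rv k) = 0" if k: "k \<le> a2" for k
    proof (cases "cyc_dist (foot x) (foot y) < a2")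
      case False
      then show ?thesis using R[OF k] cyc_dist_le[OF fx k] by auto
    next
      case True
      then have nadm: "\<not> reaches x y" using False x y by (auto simp: has_nz_path_def)
      \<comment> \<open>\<open>M(s\<^sub>j)\<close> vanishes at \<open>t\<^sub>j\<close> but not just before it, so the arrow into \<open>t\<^sub>j\<close> kills the constant\<close>
      have T0: "c (Rv 0) = 0" if yj: "y = Sv j" and j: "Tv j \<in> ?X" for j
      proof -
        have "Tv j \<notin> ?Y" using yj by (auto simp: mem)
        then have 0: "c (Tv j) = 0" using j by (intro c0) (auto simp: mem)
        show ?thesis
        proof (cases "j = 1")
          case True
          have "(Rv 0, Tv j) \<in> arrows"
            unfolding True by (rule arrows.intros(5)) (use True j in \<open>auto simp: mem\<close>)
          then have "c (Rv 0) = c (Tv j)" using j yj y a2 by (intro arc) (auto simp: mem)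
          then show ?thesis using 0 by simp
        next
          case False
          then have jp: "Suc (j - 1) = j" "1 \<le> j - 1" "j < a1" using j by (auto simp: mem)
          then have j': "Tv (j - 1) \<in> ?X" "Tv (j - 1) \<in> ?Y"
            using j yj y by (auto simp: mem split: vertex.splits)
          have "c (Tv (j - 1)) = c (Tv (Suc (j - 1)))"
            by (rule arc[OF arrows.intros(6)]) (use jp j j' in auto)
          then have "c (Tv (j - 1)) = c (Tv j)" using jp by simp
          then show ?thesis using 0 T[OF j'(1,2)] by simp
        qed
      qed
      \<comment> \<open>dually, \<open>M(t\<^sub>i)\<close> vanishes at \<open>s\<^sub>i\<close> but not just after it\<close>
      have S0: "c (Rv a2) = 0" if xi: "x = Tv i" and i: "Sv i \<in> ?Y" for i
      proof -
        have "Sv i \<notin> ?X" using xi by (auto simp: mem)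
        then have 0: "c (Sv i) = 0" using i by (intro c0) (auto simp: mem)
        show ?thesis
        proof (cases "i = a1 - 1")
          case True
          have "(Sv i, Rv a2) \<in> arrows"
            unfolding True by (rule arrows.intros(4)) (use i in \<open>auto simp: mem\<close>)
          then have "c (Sv i) = c (Rv a2)" using i xi a2 by (intro arc) (auto simp: mem)
          then show ?thesis using 0 by simp
        next
          case False
          then have i': "Sv (Suc i) \<in> ?X" "Sv (Suc i) \<in> ?Y" "(Sv i, Sv (Suc i)) \<in> arrows"
            using i xi x by (auto simp: mem intro!: arrows.intros split: vertex.splits)
          then have "c (Sv i) = c (Sv (Suc i))" using i by (intro arc) auto
          then show ?thesis using 0 S[OF i'(1,2)] by simp
        qed
      qed
      have "C = 0"
      proof (cases x; cases y)
        fix i j assume xy: "x = Rv i" "y = Sv j"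
        then have "i \<noteq> 0" using True by (auto simp: cyc_dist_def split: if_splits)
        then have "c (Rv 0) = 0" using xy y by (intro T0[of j]) (auto simp: mem)
        then show ?thesis using R[of 0] xy x \<open>i \<noteq> 0\<close> by (auto simp: cyc_dist_def split: if_splits)
      next
        fix i j assume xy: "x = Tv i" "y = Rv j"
        then have "j \<noteq> a2" using True by (auto simp: cyc_dist_def split: if_splits)
        then have "c (Rv a2) = 0" using xy x by (intro S0[of i]) (auto simp: mem)
        then show ?thesis using R[of a2] xy y \<open>j \<noteq> a2\<close> by (auto simp: cyc_dist_def split: if_splits)
      next
        fix i j assume xy: "x = Sv i" "y = Sv j"
        then have "c (Rv 0) = 0" using nadm y a2 by (intro T0[of j]) (auto simp: mem)
        then show ?thesis using R[of 0] xy a2 by (auto simp: cyc_dist_def split: if_splits)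
      next
        fix i j assume xy: "x = Tv i" "y = Tv j"
        then have "c (Rv a2) = 0" using nadm x a2 by (intro S0[of i]) (auto simp: mem)
        then show ?thesis using R[of a2] xy a2 by (auto simp: cyc_dist_def split: if_splits)
      qed (use nadm True in \<open>auto simp: cyc_dist_def split: if_splits\<close>)
      then show ?thesis using R[OF k] by simp
    qed
    then have "c v = 0" if "v \<in> Q0 a1 a2" for v
      using c0[OF that] foot[of v] foot_le[OF that] by (cases "v \<in> ?X \<inter> ?Y") auto
    then show ?thesis by (intro exI[of _ "c (Rv 0)"]) (simp add: mor_supp_def False)
  qed
qed

lemma path_len_refl [simp]: "path_len x x = 0" by (simp add: path_len_def)

lemma path_len_add:
  assumes "between x z y" shows "path_len x y = path_len x z + path_len z y"
  using assms unfolding between_def has_nz_path_def path_len_def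
  by (cases x; cases y; cases z) auto

lemma path_len_pos:
  assumes "has_nz_path x y" "x \<noteq> y" shows "1 \<le> path_len x y"
  using assms unfolding has_nz_path_def path_len_def
  by (cases x; cases y) (auto simp: cyc_dist_def split: if_splits)

lemma between_refl [simp]: "between x x y \<longleftrightarrow> has_nz_path x y" "between x y y \<longleftrightarrow> has_nz_path x y"
  using a2 by (auto simp: between_def has_nz_path_def)

lemma between_antisym:
  assumes "between x z x" shows "z = x"
  using path_len_add[OF assms] path_len_pos[of x z] assms by (auto simp: between_def)

text \<open>Lets statements about nonzero paths be proved by induction on the length, and provides the factorisation
  of a path that is longer than an arrow.\<close>

lemma first_step:
  assumes "has_nz_path x y" "x \<noteq> y"
  obtains x' where "(x, x') \<in> arrows" "between x x' y" "path_len x x' = 1"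
proof -
  have q: "x \<in> Q0 a1 a2" "y \<in> Q0 a1 a2" "reaches x y" "cyc_dist (foot x) (foot y) < a2"
    using assms by (auto simp: has_nz_path_def)
  note f = q(1,2)[THEN foot_le]
  note result = that
  have goal: thesis if x': "(x, x') \<in> arrows" "reaches x x'" "reaches x' y" "path_len x x' = 1"
      "cyc_dist (foot x) (foot x') + cyc_dist (foot x') (foot y) = cyc_dist (foot x) (foot y)" for x'
  proof (rule result[OF x'(1) _ x'(4)])
    have "x' \<in> Q0 a1 a2" using arrows_Q0[OF x'(1)] by simp
    moreover from x'(5) have "cyc_dist (foot x) (foot x') \<le> cyc_dist (foot x) (foot y)"
      "cyc_dist (foot x') (foot y) \<le> cyc_dist (foot x) (foot y)" by linarith+
    ultimately show "between x x' y" using q x'(2,3,5) assms(1) unfolding between_def has_nz_path_def by linarith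
  qed
  show thesis
  proof (cases x)
    case x: (Sv i)
    show thesis
    proof (cases "Suc i = a1")
      case True
      have "(x, Rv a2) \<in> arrows" unfolding x using True q(1) x arrows.intros(4) by auto
      then show thesis using assms(2) q x True by (intro goal[of "Rv a2"]; cases y) (auto simp: path_len_def)
    next
      case False
      have "(x, Sv (Suc i)) \<in> arrows" unfolding x using False q(1) x by (intro arrows.intros) auto
      then show thesis using assms(2) q x False by (intro goal[of "Sv (Suc i)"]; cases y) (auto simp: path_len_def)
    qed
  next
    case x: (Tv i)
    then obtain j where y: "y = Tv j" "i < j" using q(3) assms(2) by (cases y) auto
    have "(x, Tv (Suc i)) \<in> arrows" unfolding x using q(1,2) x y by (intro arrows.intros) auto
    then show thesis using x y by (intro goal[of "Tv (Suc i)"]) (auto simp: path_len_def)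
  next
    case x: (Rv i)
    have y: "y \<noteq> Sv j" for j using q(3) x by (cases y) auto
    show thesis
    proof (cases "i = foot y")
      case True
      then obtain j where j: "y = Tv j" "1 \<le> j" "j < a1" "i = 0" using x y assms(2) q(2) by (cases y) auto
      have "(x, Tv 1) \<in> arrows" unfolding x j(4) by (rule arrows.intros(5)) (use j in auto)
      then show thesis using x j by (intro goal[of "Tv 1"]) (auto simp: path_len_def)
    next
      case ne: False
      show thesis
      proof (cases "i = a2")
        case True
        then have "(x, Rv 0) \<in> arrows" unfolding x by (auto intro: arrows.intros)
        moreover have "cyc_dist i 0 = 1" "cyc_dist i (foot y) = Suc (cyc_dist 0 (foot y))"
          using True ne a2 f by (auto simp: cyc_dist_def)
        moreover have "reaches (Rv 0) y" using y by (cases y) auto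
        ultimately show thesis using x by (intro goal[of "Rv 0"]) (auto simp: path_len_def)
      next
        case False
        then have "(x, Rv (Suc i)) \<in> arrows" unfolding x using q(1) x by (intro arrows.intros) auto
        moreover have "cyc_dist i (Suc i) = 1" "cyc_dist i (foot y) = Suc (cyc_dist (Suc i) (foot y))"
          using False ne a2 f q(1) x by (auto simp: cyc_dist_def)
        moreover have "reaches (Rv (Suc i)) y" using y by (cases y) auto
        ultimately show thesis using x by (intro goal[of "Rv (Suc i)"]) (auto simp: path_len_def)
      qed
    qed
  qed
qed

lemma arrow_path_len:
  assumes "(u, w) \<in> arrows" shows "reaches u w" "u \<noteq> w" "path_len u w = 1"
  using assms a2 by (auto elim!: arrows.cases simp: path_len_def cyc_dist_def)

text \<open>The anti-automorphism of the quiver: it reflects the cycle and exchanges the two branches.\<close>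

fun dual :: "vertex \<Rightarrow> vertex" where
  "dual (Rv i) = Rv (a2 - i)"
| "dual (Sv i) = Tv (a1 - i)"
| "dual (Tv i) = Sv (a1 - i)"

lemma dual_Q0: "x \<in> Q0 a1 a2 \<Longrightarrow> dual x \<in> Q0 a1 a2"
  by (cases x) auto

lemma dual_dual: "x \<in> Q0 a1 a2 \<Longrightarrow> dual (dual x) = x"
  by (cases x) auto

lemma has_nz_path_dual: "x \<in> Q0 a1 a2 \<Longrightarrow> y \<in> Q0 a1 a2 \<Longrightarrow> has_nz_path (dual y) (dual x) \<longleftrightarrow> has_nz_path x y"
  unfolding has_nz_path_def by (cases x; cases y) (auto simp: cyc_dist_def)

lemma cyc_dist_dual: "x \<in> Q0 a1 a2 \<Longrightarrow> y \<in> Q0 a1 a2 \<Longrightarrow> cyc_dist (foot (dual y)) (foot (dual x)) = cyc_dist (foot x) (foot y)"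
  by (cases x; cases y) (auto simp: cyc_dist_def)

lemma between_dual: "x \<in> Q0 a1 a2 \<Longrightarrow> y \<in> Q0 a1 a2 \<Longrightarrow> z \<in> Q0 a1 a2 \<Longrightarrow> between (dual y) (dual z) (dual x) \<longleftrightarrow> between x z y"
  unfolding between_def by (auto simp: has_nz_path_dual cyc_dist_dual)

lemma suppM_inj:
  assumes "x \<in> Q0 a1 a2" "y \<in> Q0 a1 a2" "suppM a1 a2 x = suppM a1 a2 y"
  shows "x = y"
proof -
  have "v \<in> suppM a1 a2 x \<longleftrightarrow> v \<in> suppM a1 a2 y" for v using assms(3) by simp
  note * = this[unfolded mem_suppM[OF assms(1)] mem_suppM[OF assms(2)]]
  have f: "foot x = foot y"
    using *[of "Rv (foot x)"] *[of "Rv (foot y)"] foot_le[OF assms(1)] foot_le[OF assms(2)] by auto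
  have S: "\<exists>j\<le>i. y = Sv j"
    if x: "Sv i \<in> Q0 a1 a2" and y: "y \<in> Q0 a1 a2" "a2 = foot y" and eq: "suppM a1 a2 (Sv i) = suppM a1 a2 y" for i y
  proof -
    have "Tv i \<notin> suppM a1 a2 (Sv i)" unfolding mem_suppM[OF x] by simp
    then have "Tv i \<notin> suppM a1 a2 y" unfolding eq .
    then show ?thesis using x y a2 unfolding mem_suppM[OF y(1)] by (cases y) auto
  qed
  have T: "\<exists>j\<ge>i. y = Tv j"
    if x: "Tv i \<in> Q0 a1 a2" and y: "y \<in> Q0 a1 a2" "0 = foot y" and eq: "suppM a1 a2 (Tv i) = suppM a1 a2 y" for i y
  proof -
    have "Sv i \<notin> suppM a1 a2 (Tv i)" unfolding mem_suppM[OF x] by simp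
    then have "Sv i \<notin> suppM a1 a2 y" unfolding eq .
    then show ?thesis using x y a2 unfolding mem_suppM[OF y(1)] by (cases y) auto
  qed
  note assms = assms(1,2) f assms(3)
  show ?thesis
  proof (cases x)
    case x: (Sv i)
    then obtain j where j: "y = Sv j" "j \<le> i" using S[of i y] assms by auto
    have "i \<le> j" using S[of j x] assms[unfolded x j(1)] x by auto
    then show ?thesis using x j by simp
  next
    case x: (Tv i)
    then obtain j where j: "y = Tv j" "i \<le> j" using T[of i y] assms by auto
    have "j \<le> i" using T[of j x] assms[unfolded x j(1)] x by auto
    then show ?thesis using x j by simp
  next
    case x: (Rv i)
    show ?thesis
    proof (cases y)
      case y: (Sv j)
      have "\<exists>j'\<le>j. x = Sv j'" by (rule S) (use assms y in \<open>simp_all del: suppM.simps\<close>)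
      then show ?thesis using x by auto
    next
      case y: (Tv j)
      have "\<exists>j'\<ge>j. x = Tv j'" by (rule T) (use assms y in \<open>simp_all del: suppM.simps\<close>)
      then show ?thesis using x by auto
    qed (use x assms in auto)
  qed
qed

end

section \<open>Morphisms between the thin modules\<close>

context quiver begin

lemma path_mat_append:
  assumes "is_rep G X" "awalk u p v" "awalk v q w"
  shows "path_mat G X u (p @ q) = path_mat G X v q * path_mat G X u p"
  using assms(2)
proof (induction p arbitrary: u)
  case Nil
  then show ?case using right_mult_one_mat[OF path_mat_carrier[OF assms(1,3)]] by (auto simp: awalk_Nil_iff)
next
  case (Cons e p)
  then have e: "e \<in> arcs G" "tail G e = u" "awalk (head G e) p v" by (auto simp: awalk_Cons_iff)
  show ?case
    using Cons.IH[OF e(3)] e(2)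
      assoc_mult_mat[OF path_mat_carrier[OF assms(1,3)] path_mat_carrier[OF assms(1) e(3)] rep_carrier[OF assms(1) e(1)]]
    by simp
qed

end

sublocale cycle_quiver \<subseteq> quiver "Q a1 a2"
  by unfold_locales (use arrows_Q0 in \<open>force simp: arcs_Q\<close>)+

context cycle_quiver begin

abbreviation "MM \<equiv> M a1 a2"

abbreviation "\<Q> \<equiv> Q a1 a2"

abbreviation comp_Q (infixl "\<star>" 70) where "g \<star> f \<equiv> mor_comp \<Q> g f"

lemma M_rdim: "rdim (MM x) v = (if v \<in> suppM a1 a2 x then 1 else 0)"
  by (simp add: M_def)

lemma M_rmap: "rmap (MM x) (u, v) = (if u \<in> suppM a1 a2 x \<and> v \<in> suppM a1 a2 x then 1\<^sub>m 1
    else 0\<^sub>m (if v \<in> suppM a1 a2 x then 1 else 0) (if u \<in> suppM a1 a2 x then 1 else 0))"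
  by (simp add: M_def)

lemma is_rep_M: "is_rep \<Q> (MM x)"
  by (auto simp: is_rep_def M_rmap M_rdim)

text \<open>A morphism between thin modules is a family of matrices of size at most one, hence a family of scalars;
  where one of the spaces is zero, the scalar is 0.\<close>

definition thin_val :: "('k::field) mat \<Rightarrow> 'k" where
  "thin_val A = (if dim_row A = 1 \<and> dim_col A = 1 then A $$ (0, 0) else 0)"

lemma thin_mat_eqI:
  assumes "A \<in> carrier_mat n m" "B \<in> carrier_mat n m" "n \<le> 1" "m \<le> 1" "thin_val A = thin_val B"
  shows "A = B"
proof (rule eq_matI)
  fix i j assume "i < dim_row B" "j < dim_col B"
  then have "i = 0" "j = 0" "n = 1" "m = 1" using assms by auto
  then show "A $$ (i, j) = B $$ (i, j)" using assms by (auto simp: thin_val_def)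
qed (use assms in auto)

lemma thin_mat_mult:
  assumes "A \<in> carrier_mat n l" "B \<in> carrier_mat l m" "n \<le> 1" "m \<le> 1" "l \<le> 1"
  shows "thin_val (A * B) = thin_val A * thin_val B"
proof (cases "l = 0")
  case False
  with assms have "l = 1" by simp
  with assms show ?thesis by (auto simp: thin_val_def scalar_prod_def)
qed (use assms in \<open>auto simp: thin_val_def scalar_prod_def\<close>)

lemma thin_val_simps [simp]:
  "thin_val (1\<^sub>m (Suc 0)) = 1" "thin_val (1\<^sub>m 0) = 0" "thin_val (0\<^sub>m n m) = 0"
  by (auto simp: thin_val_def)

lemma thin_val_add: "A \<in> carrier_mat n m \<Longrightarrow> B \<in> carrier_mat n m \<Longrightarrow> thin_val (A + B) = thin_val A + thin_val B"
  by (auto simp: thin_val_def)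

lemma thin_val_smult: "thin_val (c \<cdot>\<^sub>m A) = c * thin_val A"
  by (auto simp: thin_val_def)

lemma rdim_M_le: "rdim (MM x) v \<le> 1" by (simp add: M_rdim)

lemma Hom_thin_val_arc:
  assumes f: "f \<in> Hom \<Q> (MM y) (MM x)" and e: "(u, w) \<in> arrows"
    and uw: "u \<in> suppM a1 a2 y" "w \<in> suppM a1 a2 x"
  shows "thin_val (f u) = thin_val (f w)"
proof -
  have v: "u \<in> verts \<Q>" "w \<in> verts \<Q>" using arrows_Q0[OF e] by auto
  have e': "(u, w) \<in> arcs \<Q>" using e by (simp add: arcs_Q)
  have c: "f u \<in> carrier_mat (rdim (MM x) u) 1" "f w \<in> carrier_mat 1 (rdim (MM y) w)"
    using Hom_carrier[OF f v(1)] Hom_carrier[OF f v(2)] uw by (simp_all add: M_rdim)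
  have "thin_val (rmap (MM x) (u, w) * f u) = thin_val (f w * rmap (MM y) (u, w))"
    using Hom_arc[OF f e'] by simp
  moreover have "thin_val (rmap (MM x) (u, w) * f u) = thin_val (f u)"
    using uw c(1) by (auto simp: M_rmap M_rdim thin_val_def scalar_prod_def split: if_splits)
  moreover have "thin_val (f w * rmap (MM y) (u, w)) = thin_val (f w)"
    using uw c(2) by (auto simp: M_rmap M_rdim thin_val_def scalar_prod_def split: if_splits)
  ultimately show ?thesis by simp
qed

text \<open>The morphism \<open>M(y) \<rightarrow> M(x)\<close> attached to the nonzero path from \<open>x\<close>
  to \<open>y\<close>; it is zero if there is no such path. Paths and morphisms point in opposite
  directions, so \<open>basis_mor x z \<star> basis_mor z y\<close> corresponds to the path from
  \<open>x\<close> through \<open>z\<close> to \<open>y\<close>.\<close>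

definition basis_mor :: "vertex \<Rightarrow> vertex \<Rightarrow> (vertex, 'k::field) rep_mor" where
  "basis_mor x y = (\<lambda>v\<in>Q0 a1 a2. if v \<in> mor_supp x y then 1\<^sub>m 1
     else 0\<^sub>m (rdim (MM x :: (vertex, arrow, 'k) rep) v) (rdim (MM y :: (vertex, arrow, 'k) rep) v))"

lemma basis_mor_carrier:
  assumes "v \<in> Q0 a1 a2"
  shows "basis_mor x y v \<in> carrier_mat (rdim (MM x :: (vertex, arrow, 'k::field) rep) v) (rdim (MM y :: (vertex, arrow, 'k) rep) v)"
  using assms by (auto simp: basis_mor_def M_rdim mor_supp_def)

lemma thin_val_basis_mor: "v \<in> Q0 a1 a2 \<Longrightarrow> thin_val (basis_mor x y v) = (if v \<in> mor_supp x y then 1 else 0)"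
  by (auto simp: basis_mor_def)

lemma basis_mor_in_Hom:
  assumes x: "x \<in> Q0 a1 a2" and y: "y \<in> Q0 a1 a2"
  shows "basis_mor x y \<in> Hom \<Q> (MM y) (MM x :: (vertex, arrow, 'k::field) rep)"
proof (rule HomI)
  fix e assume "e \<in> arcs \<Q>"
  then obtain u w where e: "e = (u, w)" "(u, w) \<in> arrows" by (cases e) (auto simp: arcs_Q)
  have v: "u \<in> Q0 a1 a2" "w \<in> Q0 a1 a2" using arrows_Q0[OF e(2)] by auto
  have ea: "(u, w) \<in> arcs \<Q>" using e by (simp add: arcs_Q)
  let ?X = "MM x :: (vertex, arrow, 'k) rep" and ?Y = "MM y :: (vertex, arrow, 'k) rep"
  note c = rep_carrier[OF is_rep_M ea, simplified]
  show "rmap ?X e * basis_mor x y (tail \<Q> e) = basis_mor x y (head \<Q> e) * rmap ?Y e"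
  proof (rule thin_mat_eqI[of _ "rdim ?X w" "rdim ?Y u"])
    have "thin_val (rmap ?X e * basis_mor x y u) = thin_val (rmap ?X e) * thin_val (basis_mor x y u)"
      unfolding e(1) by (rule thin_mat_mult[OF c basis_mor_carrier[OF v(1)] rdim_M_le rdim_M_le rdim_M_le])
    moreover have "thin_val (basis_mor x y w * rmap ?Y e) = thin_val (basis_mor x y w) * thin_val (rmap ?Y e)"
      unfolding e(1) by (rule thin_mat_mult[OF basis_mor_carrier[OF v(2)] c rdim_M_le rdim_M_le rdim_M_le])
    moreover have "thin_val (rmap ?X e) * thin_val (basis_mor x y u) = thin_val (basis_mor x y w) * thin_val (rmap ?Y e)"
      using mor_supp_arc[OF e(2) _ _ x y] by (auto simp: thin_val_basis_mor[OF v(1)] thin_val_basis_mor[OF v(2)] e(1) M_rmap) (auto simp: mor_supp_def)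
    ultimately show "thin_val (rmap ?X e * basis_mor x y (tail \<Q> e)) = thin_val (basis_mor x y (head \<Q> e) * rmap ?Y e)"
      by (simp add: e(1))
    show "rmap ?X e * basis_mor x y (tail \<Q> e) \<in> carrier_mat (rdim ?X w) (rdim ?Y u)"
      using mult_carrier_mat[OF c basis_mor_carrier[OF v(1)]] by (simp add: e(1))
    show "basis_mor x y (head \<Q> e) * rmap ?Y e \<in> carrier_mat (rdim ?X w) (rdim ?Y u)"
      using mult_carrier_mat[OF basis_mor_carrier[OF v(2)] c] by (simp add: e(1))
  qed (rule rdim_M_le)+
next
  fix v assume "v \<in> verts \<Q>"
  then show "basis_mor x y v \<in> carrier_mat (rdim (MM x :: (vertex, arrow, 'k) rep) v) (rdim (MM y :: (vertex, arrow, 'k) rep) v)"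
    by (intro basis_mor_carrier) simp
qed (simp add: basis_mor_def)

lemma thin_Hom_eqI:
  assumes "f \<in> Hom \<Q> (MM y) (MM x)" "g \<in> Hom \<Q> (MM y) (MM x)" "\<And>v. v \<in> Q0 a1 a2 \<Longrightarrow> thin_val (f v) = thin_val (g v)"
  shows "f = g"
proof (rule Hom_eqI[OF assms(1,2)])
  fix v assume v: "v \<in> verts \<Q>"
  show "f v = g v"
    by (rule thin_mat_eqI[OF Hom_carrier[OF assms(1) v] Hom_carrier[OF assms(2) v] rdim_M_le rdim_M_le])
       (use v assms(3) in simp)
qed

lemma thin_val_comp:
  assumes "f \<in> Hom \<Q> (MM y) (MM z)" "g \<in> Hom \<Q> (MM z) (MM x)" "v \<in> Q0 a1 a2"
  shows "thin_val ((g \<star> f) v) = thin_val (g v) * thin_val (f v)"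
proof -
  have v: "v \<in> verts \<Q>" using assms(3) by simp
  show ?thesis
    using thin_mat_mult[OF Hom_carrier[OF assms(2) v] Hom_carrier[OF assms(1) v] rdim_M_le rdim_M_le rdim_M_le] v
    by (simp add: mor_comp_def)
qed

text \<open>The coordinate with respect to \<open>basis_mor x y\<close>, read off at a vertex where this morphism is
  the identity. Without a nonzero path the morphism space is zero, and so is the coordinate.\<close>

definition coef :: "vertex \<Rightarrow> vertex \<Rightarrow> (vertex, 'k::field) rep_mor \<Rightarrow> 'k" where
  "coef x y f = (if has_nz_path x y then thin_val (f (Rv (cyc_pred (foot x)))) else 0)"

lemma has_nz_path_Q0: "has_nz_path x y \<Longrightarrow> x \<in> Q0 a1 a2 \<and> y \<in> Q0 a1 a2" by (simp add: has_nz_path_def)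

lemma top_Q0: "x \<in> Q0 a1 a2 \<Longrightarrow> Rv (cyc_pred (foot x)) \<in> Q0 a1 a2"
  using foot_le[of x] by (auto simp: cyc_pred_def)

text \<open>Every space of morphisms between the modules is at most one-dimensional. All later computations take
  place in these coordinates.\<close>

lemma Hom_M:
  assumes x: "x \<in> Q0 a1 a2" and y: "y \<in> Q0 a1 a2" and f: "f \<in> Hom \<Q> (MM y) (MM x)"
  shows "f = mor_smult \<Q> (coef x y f) (basis_mor x y)"
proof -
  have "\<exists>C. \<forall>v\<in>Q0 a1 a2. thin_val (f v) = (if v \<in> mor_supp x y then C else 0)"
  proof (rule thin_hom_values[OF x y])
    fix v assume "v \<in> Q0 a1 a2" "v \<notin> suppM a1 a2 x \<inter> suppM a1 a2 y"
    then show "thin_val (f v) = 0" using Hom_dim[OF f, of v] by (auto simp: thin_val_def M_rdim)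
  qed (rule Hom_thin_val_arc[OF f])
  then obtain C where C: "\<And>v. v \<in> Q0 a1 a2 \<Longrightarrow> thin_val (f v) = (if v \<in> mor_supp x y then C else 0)" by blast
  have "C = coef x y f" if "has_nz_path x y"
    using C[OF top_Q0[OF x]] top_in_mor_supp[OF that] that by (simp add: coef_def)
  then have "thin_val (f v) = thin_val (mor_smult \<Q> (coef x y f) (basis_mor x y) v)" if "v \<in> Q0 a1 a2" for v
    using that C by (auto simp: mor_smult_def thin_val_smult thin_val_basis_mor mor_supp_def)
  then show ?thesis
    by (intro thin_Hom_eqI[OF f] smult_in_Hom basis_mor_in_Hom is_rep_M x y)
qed

lemma basis_mor_zero: "\<not> has_nz_path x y \<Longrightarrow> basis_mor x y = mor_zero \<Q> (MM y) (MM x)"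
  by (auto simp: basis_mor_def mor_zero_def mor_supp_def fun_eq_iff)

lemma basis_mor_nonzero:
  assumes "has_nz_path x y" shows "basis_mor x y \<noteq> (mor_zero \<Q> (MM y) (MM x) :: (vertex, 'k::field) rep_mor)"
proof
  let ?v = "Rv (cyc_pred (foot x))"
  have v: "?v \<in> Q0 a1 a2" using assms top_Q0 has_nz_path_Q0 by blast
  assume "basis_mor x y = (mor_zero \<Q> (MM y) (MM x) :: (vertex, 'k) rep_mor)"
  then have "thin_val (basis_mor x y ?v :: 'k mat) = 0" using v by (simp add: mor_zero_def)
  then show False using v top_in_mor_supp[OF assms] by (simp add: thin_val_basis_mor)
qed

lemma basis_mor_refl: assumes "x \<in> Q0 a1 a2" shows "basis_mor x x = mor_id \<Q> (MM x)"
proof (rule thin_Hom_eqI[OF basis_mor_in_Hom[OF assms assms] id_in_Hom[OF is_rep_M]])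
  fix v assume v: "v \<in> Q0 a1 a2"
  have "v \<in> mor_supp x x \<longleftrightarrow> v \<in> suppM a1 a2 x"
    using assms foot_le[OF assms] foot_le[OF v] by (auto simp: mor_supp_def mem_suppM cyc_dist_def)
  then show "thin_val (basis_mor x x v) = thin_val (mor_id \<Q> (MM x) v)"
    using v by (simp add: thin_val_basis_mor mor_id_def M_rdim)
qed

lemma basis_mor_comp:
  assumes "x \<in> Q0 a1 a2" "y \<in> Q0 a1 a2" "z \<in> Q0 a1 a2"
  shows "basis_mor x z \<star> basis_mor z y = (if between x z y then basis_mor x y else mor_zero \<Q> (MM y) (MM x))"
proof (rule thin_Hom_eqI)
  show "basis_mor x z \<star> basis_mor z y \<in> Hom \<Q> (MM y) (MM x)"
    using assms by (intro comp_in_Hom[of _ "MM z"] basis_mor_in_Hom is_rep_M)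
  show "(if between x z y then basis_mor x y else mor_zero \<Q> (MM y) (MM x)) \<in> Hom \<Q> (MM y) (MM x)"
    using assms by (simp add: basis_mor_in_Hom zero_in_Hom is_rep_M)
  fix v assume v: "v \<in> Q0 a1 a2"
  have "v \<in> mor_supp x z \<inter> mor_supp z y \<longleftrightarrow> v \<in> (if between x z y then mor_supp x y else {})"
    using mor_supp_comp[of x z y] by (cases "has_nz_path x z \<and> has_nz_path z y") (auto simp: mor_supp_def between_def)
  then show "thin_val ((basis_mor x z \<star> basis_mor z y) v) = thin_val ((if between x z y then basis_mor x y else mor_zero \<Q> (MM y) (MM x)) v)"
    using v thin_val_comp[OF basis_mor_in_Hom basis_mor_in_Hom v, of z y x] assms
    by (auto simp: thin_val_basis_mor mor_zero_def split: if_splits)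
qed

lemma coef_smult_basis_mor: "has_nz_path x y \<Longrightarrow> coef x y (mor_smult \<Q> c (basis_mor x y)) = c"
  using top_in_mor_supp[of x y] top_Q0[of x] has_nz_path_Q0[of x y]
  by (simp add: coef_def mor_smult_def thin_val_smult thin_val_basis_mor)

lemma coef_basis_mor: "has_nz_path x y \<Longrightarrow> coef x y (basis_mor x y) = 1"
  using top_in_mor_supp[of x y] top_Q0[of x] has_nz_path_Q0[of x y] by (simp add: coef_def thin_val_basis_mor)

lemma coef_zero: "coef x y (mor_zero \<Q> (MM y) (MM x)) = 0"
  using top_Q0[of x] has_nz_path_Q0[of x y] by (simp add: coef_def mor_zero_def)

lemma coef_smult: "coef x y (mor_smult \<Q> c f) = c * coef x y f"
  using top_Q0[of x] has_nz_path_Q0[of x y] by (simp add: coef_def mor_smult_def thin_val_smult)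

lemma coef_add:
  assumes "f \<in> Hom \<Q> (MM y) (MM x)" "g \<in> Hom \<Q> (MM y) (MM x)"
  shows "coef x y (mor_add \<Q> f g) = coef x y f + coef x y g"
proof (cases "has_nz_path x y")
  case True
  then have "Rv (cyc_pred (foot x)) \<in> verts \<Q>" using top_Q0 has_nz_path_Q0 by simp
  then show ?thesis
    using thin_val_add[OF Hom_carrier[OF assms(1)] Hom_carrier[OF assms(2)]] by (simp add: coef_def mor_add_def)
qed (simp add: coef_def)

lemma coef_sum:
  assumes "finite I" "\<And>i. i \<in> I \<Longrightarrow> F i \<in> Hom \<Q> (MM y) (MM x)"
  shows "coef x y (mor_sum (MM y) (MM x) I F) = (\<Sum>i\<in>I. coef x y (F i))"
  using assms
proof (induction I)
  case empty
  then show ?case using mor_sum_zero[of "{}" F "MM y" "MM x"] coef_zero by simp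
next
  case (insert i I)
  then have "coef x y (mor_sum (MM y) (MM x) (insert i I) F) = coef x y (F i) + coef x y (mor_sum (MM y) (MM x) I F)"
    using coef_add[of "F i" y x "mor_sum (MM y) (MM x) I F"] sum_in_Hom[OF is_rep_M is_rep_M, of I F y x]
    by (simp add: mor_sum_insert)
  then show ?case using insert by simp
qed

lemma coef_eqI:
  assumes "x \<in> Q0 a1 a2" "y \<in> Q0 a1 a2" "f \<in> Hom \<Q> (MM y) (MM x)" "g \<in> Hom \<Q> (MM y) (MM x)"
    "coef x y f = coef x y g"
  shows "f = g"
  using Hom_M[OF assms(1-3)] Hom_M[OF assms(1,2,4)] assms(5) by simp

lemma comp_M:
  assumes x: "x \<in> Q0 a1 a2" and y: "y \<in> Q0 a1 a2" and z: "z \<in> Q0 a1 a2"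
    and g: "g \<in> Hom \<Q> (MM z) (MM x)" and f: "f \<in> Hom \<Q> (MM y) (MM z)"
  shows "g \<star> f = (if between x z y then mor_smult \<Q> (coef x z g * coef z y f) (basis_mor x y) else mor_zero \<Q> (MM y) (MM x))"
proof -
  note b = basis_mor_in_Hom[OF x z] basis_mor_in_Hom[OF z y]
  have "g \<star> f = mor_smult \<Q> (coef x z g) (basis_mor x z) \<star> mor_smult \<Q> (coef z y f) (basis_mor z y)"
    using Hom_M[OF x z g] Hom_M[OF z y f] by simp
  also have "\<dots> = mor_smult \<Q> (coef x z g) (mor_smult \<Q> (coef z y f) (basis_mor x z \<star> basis_mor z y))"
    by (simp only: comp_smult(2)[OF smult_in_Hom[OF is_rep_M is_rep_M b(2)] b(1)] comp_smult(1)[OF b(2) b(1)])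
  also have "\<dots> = (if between x z y then mor_smult \<Q> (coef x z g * coef z y f) (basis_mor x y) else mor_zero \<Q> (MM y) (MM x))"
    by (simp add: basis_mor_comp[OF x y z] mor_smult_smult[OF basis_mor_in_Hom[OF x y]])
  finally show ?thesis .
qed

lemma coef_comp:
  assumes "x \<in> Q0 a1 a2" "y \<in> Q0 a1 a2" "z \<in> Q0 a1 a2"
    and "g \<in> Hom \<Q> (MM z) (MM x)" "f \<in> Hom \<Q> (MM y) (MM z)"
  shows "coef x y (g \<star> f) = (if between x z y then coef x z g * coef z y f else 0)"
  using comp_M[OF assms] by (auto simp: coef_smult_basis_mor coef_zero between_def)

subsection \<open>The relations\<close>

lemma cycle_walk_end:
  assumes "i \<le> a2" "set p \<subseteq> cycle_arrows a2" "cas (Rv i) p v"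
  shows "v = Rv ((i + length p) mod Suc a2)"
  using assms
proof (induction p arbitrary: i)
  case (Cons e p)
  then have e: "e \<in> cycle_arrows a2" "fst e = Rv i" "cas (snd e) p v" by auto
  then have "snd e = Rv (Suc i mod Suc a2)" using Cons.prems(1) by (auto simp: cycle_arrows_def mod_Suc)
  with e Cons.prems Cons.IH[of "Suc i mod Suc a2"] have "v = Rv ((Suc i mod Suc a2 + length p) mod Suc a2)"
    by (simp add: less_Suc_eq_le[symmetric])
  then show ?case by (simp add: mod_simps)
qed auto

lemma cyc_dist_mod: "i \<le> a2 \<Longrightarrow> j \<le> a2 \<Longrightarrow> (i + cyc_dist i j) mod Suc a2 = j"
  using mod_add_self2[of j "Suc a2"] by (auto simp: cyc_dist_def simp del: mod_add_self2)

lemma relations_paths: "cycle_subpaths a1 a2 \<subseteq> paths \<Q>"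
  by (auto simp: cycle_subpaths_def)

text \<open>A path of length \<open>a2\<close> in the cycle visits all its vertices, in particular the foot of
  \<open>x\<close>, where \<open>M(x)\<close> is zero.\<close>

lemma is_module_M:
  assumes x: "x \<in> Q0 a1 a2" shows "is_module \<Q> (cycle_subpaths a1 a2) (MM x :: (vertex, arrow, 'k::field) rep)"
  unfolding module_iff[OF relations_paths is_rep_M]
proof (intro allI impI)
  let ?X = "MM x :: (vertex, arrow, 'k) rep"
  have X: "is_rep \<Q> ?X" by (rule is_rep_M)
  fix u p v assume p: "(u, p) \<in> cycle_subpaths a1 a2" "awalk u p v"
  then have l: "length p = a2" "set p \<subseteq> cycle_arrows a2" by (auto simp: cycle_subpaths_def)
  then obtain i where u: "u = Rv i" using p(2) a2
    by (cases p) (auto simp: awalk_Cons_iff cycle_arrows_def)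
  have i: "i \<le> a2" using p(2) u by auto
  define n where "n = cyc_dist i (foot x)"
  have n: "n \<le> length p" using cyc_dist_le[OF i foot_le[OF x]] l by (simp add: n_def)
  obtain w where w: "awalk u (take n p) w" "awalk w (drop n p) v"
    using p(2) by (metis append_take_drop_id awalk_append_iff)
  have "w = Rv (foot x)"
    using cycle_walk_end[of i "take n p" w] i l w(1) u n cyc_dist_mod[OF i foot_le[OF x]]
    by (auto simp: awalk_def n_def dest: in_set_takeD)
  then have w0: "rdim ?X w = 0" by (auto simp: M_rdim mem_suppM[OF x])
  have "path_mat \<Q> ?X u p = path_mat \<Q> ?X w (drop n p) * path_mat \<Q> ?X u (take n p)"
    using path_mat_append[OF X w] by simp
  also have "\<dots> = 0\<^sub>m (rdim ?X v) (rdim ?X u)"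
    using path_mat_carrier[OF X w(1)] path_mat_carrier[OF X w(2)]
    by (intro eq_matI) (simp_all add: scalar_prod_def w0)
  finally show "path_mat \<Q> ?X u p = 0\<^sub>m (rdim ?X v) (rdim ?X u)" .
qed

section \<open>The endomorphism algebra\<close>

text \<open>A common model of \<open>A\<close> and \<open>End T\<close>, in the spirit of an incidence algebra: it
  has one basis element for every pair of vertices joined by a nonzero path, and two basis elements
  multiply to the concatenated path or to zero.\<close>

definition inc_algebra :: "('k::field, vertex \<times> vertex \<Rightarrow> 'k) module" where
  "inc_algebra = \<lparr>carrier = {c. \<forall>x y. \<not> has_nz_path x y \<longrightarrow> c (x, y) = 0},
     mult = (\<lambda>c d (x, y). \<Sum>z\<in>{z. between x z y}. c (x, z) * d (z, y)),
     one = (\<lambda>(x, y). if x = y \<and> x \<in> Q0 a1 a2 then 1 else 0),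
     zero = (\<lambda>_. 0),
     add = (\<lambda>c d p. c p + d p),
     module.smult = (\<lambda>a c p. a * c p)\<rparr>"

lemma finite_Q0: "finite (Q0 a1 a2)"
  using Q0_list(1)[of a1 a2] by (metis List.finite_set)

lemma T_dsum:
  obtains \<iota> \<pi> where "is_dsum (T_module a1 a2 :: (vertex, arrow, 'k::field) rep) (Q0 a1 a2) MM \<iota> \<pi>"
  using rep_sum_dsum[OF Q0_list(2)[of a1 a2], of "MM :: _ \<Rightarrow> (vertex, arrow, 'k) rep"] is_rep_M
  unfolding Q0_list(1) T_module_def by blast

lemma T_is_module: "is_module \<Q> (cycle_subpaths a1 a2) (T_module a1 a2 :: (vertex, arrow, 'k::field) rep)"
proof -
  obtain \<iota> \<pi> where "is_dsum (T_module a1 a2 :: (vertex, arrow, 'k) rep) (Q0 a1 a2) MM \<iota> \<pi>" by (rule T_dsum)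
  from module_dsum[OF relations_paths this] is_module_M show ?thesis by blast
qed

text \<open>The matrix of an endomorphism of a direct sum of the modules \<open>M(x)\<close>, with the components
  replaced by their coordinates.\<close>

definition entries :: "(vertex \<Rightarrow> (vertex, 'k::field) rep_mor) \<Rightarrow> (vertex \<Rightarrow> (vertex, 'k) rep_mor)
    \<Rightarrow> (vertex, 'k) rep_mor \<Rightarrow> vertex \<times> vertex \<Rightarrow> 'k" where
  "entries \<iota> \<pi> f = (\<lambda>(x, y). coef x y (\<pi> x \<star> (f \<star> \<iota> y)))"

text \<open>The matrix of components of an endomorphism of \<open>T\<close> may be prescribed freely and determines
  it; by \<open>Hom_M\<close> each component is a scalar, and by \<open>coef_comp\<close> the matrix
  product becomes the product of the model.\<close>

lemma entries_iso:
  fixes T :: "(vertex, arrow, 'k::field) rep"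
  assumes T: "is_dsum T (Q0 a1 a2) MM \<iota> \<pi>"
  shows "entries \<iota> \<pi> \<in> ring_iso (End_algebra \<Q> T) inc_algebra"
    and "f \<in> Hom \<Q> T T \<Longrightarrow> entries \<iota> \<pi> (mor_smult \<Q> c f) = (\<lambda>p. c * entries \<iota> \<pi> f p)"
proof -
  let ?h = "entries \<iota> \<pi>"
  have r: "is_rep \<Q> T" "\<And>x. x \<in> Q0 a1 a2 \<Longrightarrow> \<iota> x \<in> Hom \<Q> (MM x) T" "\<And>x. x \<in> Q0 a1 a2 \<Longrightarrow> \<pi> x \<in> Hom \<Q> T (MM x)"
    "\<And>x y. x \<in> Q0 a1 a2 \<Longrightarrow> y \<in> Q0 a1 a2 \<Longrightarrow>
      \<pi> x \<star> \<iota> y = (if x = y then mor_id \<Q> (MM x) else mor_zero \<Q> (MM y) (MM x))"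
    using T by (auto simp: is_dsum_def)
  have e: "\<pi> x \<star> (f \<star> \<iota> y) \<in> Hom \<Q> (MM y) (MM x)" "f \<star> \<iota> y \<in> Hom \<Q> (MM y) T"
    if "f \<in> Hom \<Q> T T" "x \<in> Q0 a1 a2" "y \<in> Q0 a1 a2" for f x y
    using that r(1) r(2)[of y] r(3)[of x] is_rep_M by (blast intro: comp_in_Hom)+
  have h0: "?h f (x, y) = 0" if "\<not> has_nz_path x y" for f x y using that by (simp add: entries_def coef_def)
  have eqI: "c = d" if "c \<in> carrier inc_algebra" "d \<in> carrier inc_algebra" "\<And>x y. has_nz_path x y \<Longrightarrow> c (x, y) = d (x, y)"
    for c d :: "vertex \<times> vertex \<Rightarrow> 'k"
  proof
    fix p show "c p = d p" using that by (cases p; cases "has_nz_path (fst p) (snd p)") (auto simp: inc_algebra_def)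
  qed
  have hc: "?h f \<in> carrier inc_algebra" for f using h0 by (simp add: inc_algebra_def)
  have fin: "{z. between x z y} \<subseteq> Q0 a1 a2" for x y
    using has_nz_path_Q0 by (auto simp: between_def)
  have mult: "?h (f \<star> g) (x, y) = (\<Sum>z\<in>{z. between x z y}. ?h f (x, z) * ?h g (z, y))"
    if f: "f \<in> Hom \<Q> T T" and g: "g \<in> Hom \<Q> T T" and "has_nz_path x y" for f g x y
  proof -
    have x: "x \<in> Q0 a1 a2" and y: "y \<in> Q0 a1 a2" using has_nz_path_Q0[OF that(3)] by auto
    have 1: "\<iota> z \<star> (\<pi> z \<star> (g \<star> \<iota> y)) \<in> Hom \<Q> (MM y) T" if "z \<in> Q0 a1 a2" for z
      using e(1)[OF g that y] r(2)[OF that] r(1) is_rep_M by (blast intro: comp_in_Hom)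
    have 2: "f \<star> (\<iota> z \<star> (\<pi> z \<star> (g \<star> \<iota> y))) \<in> Hom \<Q> (MM y) T" if "z \<in> Q0 a1 a2" for z
      by (rule comp_in_Hom[OF f 1[OF that] is_rep_M r(1) r(1)])
    have 3: "\<pi> x \<star> (f \<star> \<iota> z) \<star> (\<pi> z \<star> (g \<star> \<iota> y)) \<in> Hom \<Q> (MM y) (MM x)" if "z \<in> Q0 a1 a2" for z
      by (rule comp_in_Hom[OF e(1)[OF f x that] e(1)[OF g that y] is_rep_M is_rep_M is_rep_M])
    define S where "S = (\<lambda>z. \<iota> z \<star> (\<pi> z \<star> (g \<star> \<iota> y)))"
    define S' where "S' = (\<lambda>z. \<pi> x \<star> (f \<star> \<iota> z) \<star> (\<pi> z \<star> (g \<star> \<iota> y)))"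
    have s1: "f \<star> g \<star> \<iota> y = f \<star> (g \<star> \<iota> y)" by (rule comp_assoc[OF r(2)[OF y] g f])
    have s2: "g \<star> \<iota> y = mor_sum (MM y) T (Q0 a1 a2) S"
      unfolding S_def by (rule dsum_decompose[OF T is_rep_M e(2)[OF g x y]])
    have s3: "f \<star> mor_sum (MM y) T (Q0 a1 a2) S = mor_sum (MM y) T (Q0 a1 a2) (\<lambda>z. f \<star> S z)"
      by (rule comp_sum_right[OF _ f]) (simp add: S_def 1)
    have s4: "\<pi> x \<star> mor_sum (MM y) T (Q0 a1 a2) (\<lambda>z. f \<star> S z) = mor_sum (MM y) (MM x) (Q0 a1 a2) (\<lambda>z. \<pi> x \<star> (f \<star> S z))"
      by (rule comp_sum_right[OF _ r(3)[OF x]]) (simp add: S_def 2)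
    have s5: "mor_sum (MM y) (MM x) (Q0 a1 a2) (\<lambda>z. \<pi> x \<star> (f \<star> S z)) = mor_sum (MM y) (MM x) (Q0 a1 a2) S'"
    proof (rule mor_sum_cong)
      fix z assume z: "z \<in> Q0 a1 a2"
      note E = e(1)[OF g z y]
      show "\<pi> x \<star> (f \<star> S z) = S' z"
        unfolding S_def S'_def using comp_assoc[OF E r(2)[OF z] f] comp_assoc[OF E e(2)[OF f x z] r(3)[OF x]] by simp
    qed
    have "?h (f \<star> g) (x, y) = coef x y (mor_sum (MM y) (MM x) (Q0 a1 a2) S')"
      by (simp only: entries_def s1 s2 s3 s4 s5 prod.case)
    also have "\<dots> = (\<Sum>z\<in>Q0 a1 a2. coef x y (S' z))"
      by (rule coef_sum[OF finite_Q0]) (simp add: S'_def 3)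
    also have "\<dots> = (\<Sum>z\<in>Q0 a1 a2. if between x z y then ?h f (x, z) * ?h g (z, y) else 0)"
      using coef_comp[OF x y _ e(1)[OF f x] e(1)[OF g _ y]] by (intro sum.cong) (auto simp: entries_def S'_def)
    also have "\<dots> = (\<Sum>z\<in>{z. between x z y}. ?h f (x, z) * ?h g (z, y))"
      using fin[of x y] by (intro sum.mono_neutral_cong_right finite_Q0) auto
    finally show ?thesis .
  qed
  have hom: "?h \<in> ring_hom (End_algebra \<Q> T) inc_algebra"
  proof (rule ring_hom_memI)
    fix f g assume "f \<in> carrier (End_algebra \<Q> T)" "g \<in> carrier (End_algebra \<Q> T)"
    then have f: "f \<in> Hom \<Q> T T" and g: "g \<in> Hom \<Q> T T" by (auto simp: End_algebra_def)
    have "?h f \<otimes>\<^bsub>inc_algebra\<^esub> ?h g \<in> carrier inc_algebra"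
      by (auto simp: inc_algebra_def between_def)
    then show "?h (f \<otimes>\<^bsub>End_algebra \<Q> T\<^esub> g) = ?h f \<otimes>\<^bsub>inc_algebra\<^esub> ?h g"
      using mult[OF f g] by (intro eqI hc) (auto simp: End_algebra_def inc_algebra_def)
    have "?h f \<oplus>\<^bsub>inc_algebra\<^esub> ?h g \<in> carrier inc_algebra"
      using hc[of f] hc[of g] by (auto simp: inc_algebra_def)
    moreover have "?h (mor_add \<Q> f g) (x, y) = ?h f (x, y) + ?h g (x, y)" if "has_nz_path x y" for x y
    proof -
      have x: "x \<in> Q0 a1 a2" and y: "y \<in> Q0 a1 a2" using has_nz_path_Q0[OF that] by auto
      show ?thesis
        using comp_add_left[OF r(2)[OF y] f g] comp_add_right[OF e(2)[OF f x y] e(2)[OF g x y] r(3)[OF x]]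
          coef_add[OF e(1)[OF f x y] e(1)[OF g x y]] by (simp add: entries_def)
    qed
    ultimately show "?h (f \<oplus>\<^bsub>End_algebra \<Q> T\<^esub> g) = ?h f \<oplus>\<^bsub>inc_algebra\<^esub> ?h g"
      by (intro eqI hc) (auto simp: End_algebra_def inc_algebra_def)
  next
    show "?h \<one>\<^bsub>End_algebra \<Q> T\<^esub> = \<one>\<^bsub>inc_algebra\<^esub>"
    proof (rule eqI[OF hc])
      show "(\<one>\<^bsub>inc_algebra\<^esub> :: vertex \<times> vertex \<Rightarrow> 'k) \<in> carrier inc_algebra"
        by (auto simp: inc_algebra_def)
      fix x y assume "has_nz_path x y"
      then have x: "x \<in> Q0 a1 a2" and y: "y \<in> Q0 a1 a2" using has_nz_path_Q0 by auto
      have "coef x x (mor_id \<Q> (MM x)) = (1 :: 'k)" using coef_basis_mor[of x x] x by (simp add: basis_mor_refl)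
      then show "?h \<one>\<^bsub>End_algebra \<Q> T\<^esub> (x, y) = \<one>\<^bsub>inc_algebra\<^esub> (x, y)"
        using comp_id(2)[OF r(2)[OF y]] r(4)[OF x y] x
        by (auto simp: End_algebra_def inc_algebra_def entries_def coef_zero)
    qed
  qed (rule hc)
  moreover have "bij_betw ?h (carrier (End_algebra \<Q> T)) (carrier inc_algebra)"
    unfolding bij_betw_def
  proof (intro conjI equalityI subsetI)
    show "inj_on ?h (carrier (End_algebra \<Q> T))"
    proof (rule inj_onI)
      fix f g assume "f \<in> carrier (End_algebra \<Q> T)" "g \<in> carrier (End_algebra \<Q> T)" and eq: "?h f = ?h g"
      then have f: "f \<in> Hom \<Q> T T" and g: "g \<in> Hom \<Q> T T" by (auto simp: End_algebra_def)
      show "f = g"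
      proof (rule dsum_eqI[OF T f g])
        fix x y assume x: "x \<in> Q0 a1 a2" and y: "y \<in> Q0 a1 a2"
        have "coef x y (\<pi> x \<star> (f \<star> \<iota> y)) = coef x y (\<pi> x \<star> (g \<star> \<iota> y))"
          using fun_cong[OF eq, of "(x, y)"] by (simp add: entries_def)
        then show "\<pi> x \<star> (f \<star> \<iota> y) = \<pi> x \<star> (g \<star> \<iota> y)"
          by (rule coef_eqI[OF x y e(1)[OF f x y] e(1)[OF g x y]])
      qed
    qed
    fix c :: "vertex \<times> vertex \<Rightarrow> 'k" assume c: "c \<in> carrier inc_algebra"
    obtain f where f: "f \<in> Hom \<Q> T T"
      "\<And>x y. x \<in> Q0 a1 a2 \<Longrightarrow> y \<in> Q0 a1 a2 \<Longrightarrow> \<pi> x \<star> (f \<star> \<iota> y) = mor_smult \<Q> (c (x, y)) (basis_mor x y)"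
      by (rule dsum_matrix[OF T smult_in_Hom[OF is_rep_M is_rep_M basis_mor_in_Hom], of "\<lambda>x y. c (x, y)"]) auto
    have "?h f = c"
    proof (rule eqI[OF hc c])
      fix x y assume nz: "has_nz_path x y"
      then have "x \<in> Q0 a1 a2" "y \<in> Q0 a1 a2" using has_nz_path_Q0 by auto
      then show "?h f (x, y) = c (x, y)" using nz by (simp add: entries_def f(2) coef_smult_basis_mor)
    qed
    then show "c \<in> ?h ` carrier (End_algebra \<Q> T)" using f(1) by (auto simp: End_algebra_def)
  qed (use hc in auto)
  ultimately show "?h \<in> ring_iso (End_algebra \<Q> T) inc_algebra" by (simp add: ring_iso_def)
  show "?h (mor_smult \<Q> c f) = (\<lambda>p. c * ?h f p)" if f: "f \<in> Hom \<Q> T T"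
  proof (rule eqI[OF hc])
    show "(\<lambda>p. c * ?h f p) \<in> carrier inc_algebra" using hc[of f] by (auto simp: inc_algebra_def)
    fix x y assume "has_nz_path x y"
    then have x: "x \<in> Q0 a1 a2" and y: "y \<in> Q0 a1 a2" using has_nz_path_Q0 by auto
    show "?h (mor_smult \<Q> c f) (x, y) = c * ?h f (x, y)"
      using comp_smult[OF r(2)[OF y] f] comp_smult[OF e(2)[OF f x y] r(3)[OF x]]
      by (simp add: entries_def coef_smult)
  qed
qed

lemma End_algebra_iso_inc: "algebra_iso (End_algebra \<Q> (T_module a1 a2 :: (vertex, arrow, 'k::field) rep)) inc_algebra"
proof -
  obtain \<iota> \<pi> where T: "is_dsum (T_module a1 a2 :: (vertex, arrow, 'k) rep) (Q0 a1 a2) MM \<iota> \<pi>" by (rule T_dsum)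
  show ?thesis
    unfolding algebra_iso_def using entries_iso[OF T]
    by (auto simp: End_algebra_def inc_algebra_def)
qed

text \<open>The anti-automorphism \<open>dual\<close> of the quiver maps nonzero paths to nonzero paths and reverses
  concatenations.\<close>

lemma inc_algebra_self_dual: "algebra_iso inc_algebra (op_algebra (inc_algebra :: ('k::field, _) module))"
proof -
  define h :: "(vertex \<times> vertex \<Rightarrow> 'k) \<Rightarrow> vertex \<times> vertex \<Rightarrow> 'k"
    where "h c = (\<lambda>(x, y). if has_nz_path x y then c (dual y, dual x) else 0)" for c
  have hh: "h (h c) = c" if c: "c \<in> carrier inc_algebra" for c
  proof
    fix p :: "vertex \<times> vertex"
    obtain x y where p: "p = (x, y)" by (cases p)
    show "h (h c) p = c p"
    proof (cases "has_nz_path x y")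
      case True
      then have xy: "x \<in> Q0 a1 a2" "y \<in> Q0 a1 a2" using has_nz_path_Q0 by auto
      show ?thesis using True has_nz_path_dual[OF xy] xy by (simp add: p h_def dual_dual)
    next
      case False
      then have "c (x, y) = 0" using c by (simp add: inc_algebra_def)
      then show ?thesis using False by (simp add: p h_def)
    qed
  qed
  have hc: "h c \<in> carrier inc_algebra" for c by (simp add: h_def inc_algebra_def)
  have mult: "(\<Sum>z\<in>{z. between (dual y) z (dual x)}. c (dual y, z) * d (z, dual x)) =
      (\<Sum>z\<in>{z. between x z y}. h d (x, z) * h c (z, y))" if "has_nz_path x y" for c d x y
  proof (rule sum.reindex_bij_witness[of _ dual dual])
    have xy: "x \<in> Q0 a1 a2" "y \<in> Q0 a1 a2" using has_nz_path_Q0[OF that] by auto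
    fix z assume "z \<in> {z. between (dual y) z (dual x)}"
    then have z: "between (dual y) z (dual x)" "z \<in> Q0 a1 a2" using has_nz_path_Q0 by (auto simp: between_def)
    show d: "dual (dual z) = z" using z by (simp add: dual_dual)
    show "dual z \<in> {z. between x z y}" using between_dual[OF xy dual_Q0[OF z(2)]] z by (simp add: d)
    then show "h d (x, dual z) * h c (dual z, y) = c (dual y, z) * d (z, dual x)"
      by (simp add: h_def between_def d)
  next
    have xy: "x \<in> Q0 a1 a2" "y \<in> Q0 a1 a2" using has_nz_path_Q0[OF that] by auto
    fix z assume "z \<in> {z. between x z y}"
    then have z: "between x z y" "z \<in> Q0 a1 a2" using has_nz_path_Q0 by (auto simp: between_def)
    show "dual (dual z) = z" using z by (simp add: dual_dual)
    show "dual z \<in> {z. between (dual y) z (dual x)}" using between_dual[OF xy z(2)] z by simp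
  qed
  have "h \<in> ring_hom inc_algebra (op_algebra inc_algebra)"
  proof (rule ring_hom_memI)
    fix c d :: "vertex \<times> vertex \<Rightarrow> 'k"
    show "h (c \<otimes>\<^bsub>inc_algebra\<^esub> d) = h c \<otimes>\<^bsub>op_algebra inc_algebra\<^esub> h d"
    proof
      fix p :: "vertex \<times> vertex"
      obtain x y where p: "p = (x, y)" by (cases p)
      have 1: "(h c \<otimes>\<^bsub>op_algebra inc_algebra\<^esub> h d) (x, y) = (\<Sum>z\<in>{z. between x z y}. h d (x, z) * h c (z, y))"
        by (simp add: op_algebra_def inc_algebra_def)
      have 2: "h (c \<otimes>\<^bsub>inc_algebra\<^esub> d) (x, y)
          = (if has_nz_path x y then \<Sum>z\<in>{z. between (dual y) z (dual x)}. c (dual y, z) * d (z, dual x) else 0)"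
        unfolding h_def by (simp add: inc_algebra_def)
      show "h (c \<otimes>\<^bsub>inc_algebra\<^esub> d) p = (h c \<otimes>\<^bsub>op_algebra inc_algebra\<^esub> h d) p"
      proof (cases "has_nz_path x y")
        case True
        show ?thesis unfolding p 1 2 using mult[OF True] True by simp
      next
        case False
        then have e: "{z. between x z y} = {}" by (auto simp: between_def)
        show ?thesis unfolding p 1 2 e using False by simp
      qed
    qed
  next
    show "h \<one>\<^bsub>inc_algebra\<^esub> = \<one>\<^bsub>op_algebra inc_algebra\<^esub>"
    proof
      fix p :: "vertex \<times> vertex"
      obtain x y where p: "p = (x, y)" by (cases p)
      show "h \<one>\<^bsub>inc_algebra\<^esub> p = (\<one>\<^bsub>op_algebra inc_algebra\<^esub> :: vertex \<times> vertex \<Rightarrow> 'k) p"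
      proof (cases "has_nz_path x y")
        case True
        then have xy: "x \<in> Q0 a1 a2" "y \<in> Q0 a1 a2" using has_nz_path_Q0 by auto
        have "dual y = dual x \<longleftrightarrow> x = y" using dual_dual[OF xy(1)] dual_dual[OF xy(2)] by metis
        then show ?thesis using True xy dual_Q0[OF xy(2)] by (simp add: p h_def op_algebra_def inc_algebra_def)
      next
        case False
        then have "\<not> (x = y \<and> x \<in> Q0 a1 a2)" by auto
        then show ?thesis using False by (simp add: p h_def op_algebra_def inc_algebra_def)
      qed
    qed
  qed (use hc in \<open>auto simp: op_algebra_def inc_algebra_def h_def fun_eq_iff\<close>)
  moreover have "bij_betw h (carrier inc_algebra) (carrier inc_algebra)"
    by (rule bij_betw_byWitness[of _ h]) (use hh hc in auto)
  ultimately show ?thesis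
    unfolding algebra_iso_def ring_iso_def
    by (intro bexI[of _ h]) (auto simp: op_algebra_def inc_algebra_def h_def fun_eq_iff)
qed

end

section \<open>The path algebra\<close>

context quiver begin

lemma path_end_Nil [simp]: "path_end G u [] = u"
  by (simp add: path_end_def)

lemma path_end_Cons [simp]: "path_end G u (e # p) = path_end G (head G e) p"
  by (cases p) (auto simp: path_end_def)

lemma path_end_append: "path_end G u (p @ q) = path_end G (path_end G u p) q"
  by (induction p arbitrary: u) auto

lemma path_end_take_drop:
  "path_end G (path_end G u (take i p)) (take j (drop i p)) = path_end G u (take (i + j) p)"
  by (simp add: path_end_append[symmetric] take_add)

lemma awalk_path_end: "awalk u p v \<Longrightarrow> path_end G u p = v"
  using cas_path_end by (auto simp: awalk_def)

lemma path_iff: "(u, p) \<in> paths G \<longleftrightarrow> awalk u p (path_end G u p)"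
  using awalk_path_end by (auto simp: paths_def)

lemma path_algebra_carrier:
  "f \<in> carrier (path_algebra G) \<longleftrightarrow> finite {p. f p \<noteq> 0} \<and> (\<forall>p. f p \<noteq> 0 \<longrightarrow> p \<in> paths G)"
  by (auto simp: path_algebra_def)

lemma path_algebra_add: "f \<oplus>\<^bsub>path_algebra G\<^esub> g = (\<lambda>p. f p + g p)"
  by (simp add: path_algebra_def)

lemma path_algebra_mult:
  "(f \<otimes>\<^bsub>path_algebra G\<^esub> g) (u, p) = (\<Sum>i\<le>length p. f (u, take i p) * g (path_end G u (take i p), drop i p))"
  by (simp add: path_algebra_def)

text \<open>Only associativity needs thought: both triple products are sums over all ways to cut a path twice,
  indexed by the two cutting points or by the first cutting point and the distance to the second.\<close>

lemma path_algebra_ring: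
  assumes "finite (verts G)"
  shows "ring (path_algebra G :: ('k::field, _) module)"
proof (rule ringI)
  let ?A = "path_algebra G :: ('k, ('v, 'e) qpath \<Rightarrow> 'k) module"
  have zero: "\<zero>\<^bsub>?A\<^esub> = (\<lambda>_. 0)" and one: "\<one>\<^bsub>?A\<^esub> = (\<lambda>(u, p). if u \<in> verts G \<and> p = [] then 1 else 0)"
    by (simp_all add: path_algebra_def)
  have add: "f \<oplus>\<^bsub>?A\<^esub> g \<in> carrier ?A" if fg: "f \<in> carrier ?A" "g \<in> carrier ?A" for f g
  proof -
    have s: "{p. f p + g p \<noteq> 0} \<subseteq> {p. f p \<noteq> 0} \<union> {p. g p \<noteq> 0}" by auto
    have "finite {p. f p + g p \<noteq> 0}"
      by (rule finite_subset[OF s]) (use fg in \<open>simp add: path_algebra_carrier\<close>)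
    moreover have "p \<in> paths G" if "f p + g p \<noteq> 0" for p
    proof -
      have "f p \<noteq> 0 \<or> g p \<noteq> 0" using that by (cases "f p = 0") simp_all
      then show ?thesis using fg by (auto simp only: path_algebra_carrier)
    qed
    ultimately show ?thesis by (simp add: path_algebra_carrier path_algebra_add)
  qed
  show "abelian_group ?A"
  proof (rule abelian_groupI)
    show "\<zero>\<^bsub>?A\<^esub> \<in> carrier ?A" by (simp add: path_algebra_carrier zero)
    show "f \<oplus>\<^bsub>?A\<^esub> g \<in> carrier ?A" if "f \<in> carrier ?A" "g \<in> carrier ?A" for f g
      using that by (rule add)
    show "f \<oplus>\<^bsub>?A\<^esub> g \<oplus>\<^bsub>?A\<^esub> h = f \<oplus>\<^bsub>?A\<^esub> (g \<oplus>\<^bsub>?A\<^esub> h)" for f g h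
      by (simp add: path_algebra_add add.assoc)
    show "f \<oplus>\<^bsub>?A\<^esub> g = g \<oplus>\<^bsub>?A\<^esub> f" for f g
      by (simp add: path_algebra_add add.commute)
    show "\<zero>\<^bsub>?A\<^esub> \<oplus>\<^bsub>?A\<^esub> f = f" for f
      by (simp add: path_algebra_add zero)
    fix f assume "f \<in> carrier ?A"
    then show "\<exists>g\<in>carrier ?A. g \<oplus>\<^bsub>?A\<^esub> f = \<zero>\<^bsub>?A\<^esub>"
      by (intro bexI[of _ "\<lambda>p. - f p"]) (simp_all add: path_algebra_carrier path_algebra_add zero)
  qed
  have closed: "f \<otimes>\<^bsub>?A\<^esub> g \<in> carrier ?A" if f: "f \<in> carrier ?A" and g: "g \<in> carrier ?A" for f g
  proof -
    have ex: "\<exists>i. f (u, take i p) \<noteq> 0 \<and> g (path_end G u (take i p), drop i p) \<noteq> 0"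
      if "(f \<otimes>\<^bsub>?A\<^esub> g) (u, p) \<noteq> 0" for u p
    proof -
      have "\<exists>i. f (u, take i p) * g (path_end G u (take i p), drop i p) \<noteq> 0"
      proof (rule ccontr)
        assume "\<nexists>i. f (u, take i p) * g (path_end G u (take i p), drop i p) \<noteq> 0"
        then have "(f \<otimes>\<^bsub>?A\<^esub> g) (u, p) = 0" unfolding path_algebra_mult by (intro sum.neutral) auto
        then show False using that by simp
      qed
      then obtain i where "f (u, take i p) * g (path_end G u (take i p), drop i p) \<noteq> 0" by blast
      then show ?thesis by auto
    qed
    have "{p. (f \<otimes>\<^bsub>?A\<^esub> g) p \<noteq> 0} \<subseteq> (\<lambda>((u, p), (v, q)). (u, p @ q)) ` ({p. f p \<noteq> 0} \<times> {p. g p \<noteq> 0})"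
    proof (rule subsetI)
      fix r assume r: "r \<in> {p. (f \<otimes>\<^bsub>?A\<^esub> g) p \<noteq> 0}"
      obtain u p where up: "r = (u, p)" by (cases r)
      then obtain i where "f (u, take i p) \<noteq> 0" "g (path_end G u (take i p), drop i p) \<noteq> 0" using r ex[of u p] by auto
      then show "r \<in> (\<lambda>((u, p), (v, q)). (u, p @ q)) ` ({p. f p \<noteq> 0} \<times> {p. g p \<noteq> 0})"
        unfolding up by (intro rev_image_eqI[of "((u, take i p), (path_end G u (take i p), drop i p))"]) auto
    qed
    then have "finite {p. (f \<otimes>\<^bsub>?A\<^esub> g) p \<noteq> 0}"
      by (rule finite_subset) (use f g in \<open>simp add: path_algebra_carrier\<close>)
    moreover have "(u, p) \<in> paths G" if fg0: "(f \<otimes>\<^bsub>?A\<^esub> g) (u, p) \<noteq> 0" for u p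
    proof -
      obtain i where "f (u, take i p) \<noteq> 0" "g (path_end G u (take i p), drop i p) \<noteq> 0" using ex[OF fg0] by blast
      then have "(u, take i p) \<in> paths G" "(path_end G u (take i p), drop i p) \<in> paths G"
        using f g by (simp_all add: path_algebra_carrier)
      then obtain v w where "awalk u (take i p) v" "awalk v (drop i p) w"
        unfolding path_iff by blast
      then have "awalk u (take i p @ drop i p) w" by (rule awalk_appendI)
      then show ?thesis by (auto simp: paths_def)
    qed
    ultimately show ?thesis by (auto simp: path_algebra_carrier)
  qed
  show "Group.monoid ?A"
  proof (rule monoidI)
    fix f g h assume f: "f \<in> carrier ?A" and g: "g \<in> carrier ?A" and h: "h \<in> carrier ?A"
    show "f \<otimes>\<^bsub>?A\<^esub> g \<otimes>\<^bsub>?A\<^esub> h = f \<otimes>\<^bsub>?A\<^esub> (g \<otimes>\<^bsub>?A\<^esub> h)"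
    proof
      fix r :: "('v, 'e) qpath"
      obtain u p where r: "r = (u, p)" by (cases r)
      define n where "n = length p"
      let ?e = "\<lambda>i. path_end G u (take i p)"
      \<comment> \<open>\<open>j\<close> and \<open>i\<close> are the positions of the two cuts, with \<open>j \<le> i\<close>\<close>
      define F where "F j i = f (u, take j p) * g (?e j, take (i - j) (drop j p)) * h (?e i, drop i p)" for j i
      have "(f \<otimes>\<^bsub>?A\<^esub> g \<otimes>\<^bsub>?A\<^esub> h) (u, p) = (\<Sum>i\<le>n. \<Sum>j\<le>i. F j i)"
        by (auto simp: path_algebra_mult F_def sum_distrib_right n_def min_def drop_take intro!: sum.cong)
      also have "\<dots> = (\<Sum>(i, j)\<in>(SIGMA i:{..n}. {..i}). F j i)"
        by (rule sum.Sigma) auto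
      also have "\<dots> = (\<Sum>(j, k)\<in>(SIGMA j:{..n}. {..n - j}). F j (j + k))"
        by (rule sum.reindex_bij_witness[of _ "\<lambda>(j, k). (j + k, j)" "\<lambda>(i, j). (j, i - j)"]) auto
      also have "\<dots> = (\<Sum>j\<le>n. \<Sum>k\<le>n - j. F j (j + k))"
        by (rule sum.Sigma[symmetric]) auto
      also have "\<dots> = (f \<otimes>\<^bsub>?A\<^esub> (g \<otimes>\<^bsub>?A\<^esub> h)) (u, p)"
        by (auto simp: path_algebra_mult F_def sum_distrib_left n_def path_end_take_drop add.commute mult.assoc intro!: sum.cong)
      finally show "(f \<otimes>\<^bsub>?A\<^esub> g \<otimes>\<^bsub>?A\<^esub> h) r = (f \<otimes>\<^bsub>?A\<^esub> (g \<otimes>\<^bsub>?A\<^esub> h)) r"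
        by (simp only: r)
    qed
  next
    have "{p. \<one>\<^bsub>?A\<^esub> p \<noteq> 0} = (\<lambda>v. (v, [])) ` verts G"
      by (auto simp: one split: if_splits)
    then show "\<one>\<^bsub>?A\<^esub> \<in> carrier ?A"
      using assms by (auto simp: path_algebra_carrier path_iff awalk_Nil_iff one split: if_splits)
  next
    fix f assume f: "f \<in> carrier ?A"
    have v: "u \<in> verts G" "path_end G u p \<in> verts G" if "f (u, p) \<noteq> 0" for u p
    proof -
      have "awalk u p (path_end G u p)" using f that by (auto simp: path_iff[symmetric] path_algebra_carrier)
      then show "u \<in> verts G" "path_end G u p \<in> verts G" by auto
    qed
    show "\<one>\<^bsub>?A\<^esub> \<otimes>\<^bsub>?A\<^esub> f = f"
    proof
      fix r :: "('v, 'e) qpath"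
      obtain u p where r: "r = (u, p)" by (cases r)
      have "(\<one>\<^bsub>?A\<^esub> \<otimes>\<^bsub>?A\<^esub> f) (u, p) = (\<Sum>i\<le>length p. if i = 0 then (if u \<in> verts G then f (u, p) else 0) else 0)"
        unfolding path_algebra_mult
      proof (rule sum.cong)
        fix i assume "i \<in> {..length p}"
        then have "take i p = [] \<longleftrightarrow> i = 0" by auto
        then show "\<one>\<^bsub>?A\<^esub> (u, take i p) * f (path_end G u (take i p), drop i p) =
            (if i = 0 then (if u \<in> verts G then f (u, p) else 0) else 0)" by (simp add: one)
      qed simp
      then show "(\<one>\<^bsub>?A\<^esub> \<otimes>\<^bsub>?A\<^esub> f) r = f r" using v(1)[of u p] by (auto simp: r)
    qed
    show "f \<otimes>\<^bsub>?A\<^esub> \<one>\<^bsub>?A\<^esub> = f"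
    proof
      fix r :: "('v, 'e) qpath"
      obtain u p where r: "r = (u, p)" by (cases r)
      have "(f \<otimes>\<^bsub>?A\<^esub> \<one>\<^bsub>?A\<^esub>) (u, p) =
          (\<Sum>i\<le>length p. if i = length p then (if path_end G u p \<in> verts G then f (u, p) else 0) else 0)"
        unfolding path_algebra_mult
      proof (rule sum.cong)
        fix i assume "i \<in> {..length p}"
        then have "drop i p = [] \<longleftrightarrow> i = length p" by auto
        then show "f (u, take i p) * \<one>\<^bsub>?A\<^esub> (path_end G u (take i p), drop i p) =
            (if i = length p then (if path_end G u p \<in> verts G then f (u, p) else 0) else 0)" by (simp add: one)
      qed simp
      then show "(f \<otimes>\<^bsub>?A\<^esub> \<one>\<^bsub>?A\<^esub>) r = f r" using v(2)[of u p] by (auto simp: r)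
    qed
  qed (rule closed)
  fix f g h :: "('v, 'e) qpath \<Rightarrow> 'k"
  show "(f \<oplus>\<^bsub>?A\<^esub> g) \<otimes>\<^bsub>?A\<^esub> h = f \<otimes>\<^bsub>?A\<^esub> h \<oplus>\<^bsub>?A\<^esub> g \<otimes>\<^bsub>?A\<^esub> h"
  proof
    fix r :: "('v, 'e) qpath"
    show "((f \<oplus>\<^bsub>?A\<^esub> g) \<otimes>\<^bsub>?A\<^esub> h) r = (f \<otimes>\<^bsub>?A\<^esub> h \<oplus>\<^bsub>?A\<^esub> g \<otimes>\<^bsub>?A\<^esub> h) r"
      by (cases r) (simp add: path_algebra_mult path_algebra_add distrib_right sum.distrib)
  qed
  show "h \<otimes>\<^bsub>?A\<^esub> (f \<oplus>\<^bsub>?A\<^esub> g) = h \<otimes>\<^bsub>?A\<^esub> f \<oplus>\<^bsub>?A\<^esub> h \<otimes>\<^bsub>?A\<^esub> g"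
  proof
    fix r :: "('v, 'e) qpath"
    show "(h \<otimes>\<^bsub>?A\<^esub> (f \<oplus>\<^bsub>?A\<^esub> g)) r = (h \<otimes>\<^bsub>?A\<^esub> f \<oplus>\<^bsub>?A\<^esub> h \<otimes>\<^bsub>?A\<^esub> g) r"
      by (cases r) (simp add: path_algebra_mult path_algebra_add distrib_left sum.distrib)
  qed
qed

lemma path_elem_carrier:
  assumes "(u, p) \<in> paths G" shows "(\<lambda>q. c * path_elem (u, p) q) \<in> carrier (path_algebra G)"
proof -
  have s: "{q. c * path_elem (u, p) q \<noteq> 0} \<subseteq> {(u, p)}" by (auto simp: path_elem_def)
  then show ?thesis using assms finite_subset[OF s] unfolding path_algebra_carrier by blast
qed

lemma path_elem_mult:
  "(\<lambda>r. c * path_elem (u, p) r) \<otimes>\<^bsub>path_algebra G\<^esub> (path_elem (path_end G u p, q)) = (\<lambda>r. c * path_elem (u, p @ q) r)"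
proof
  fix r :: "('v, 'e) qpath"
  obtain w s where r: "r = (w, s)" by (cases r)
  have *: "c * path_elem (u, p) (w, take i s) * path_elem (path_end G u p, q) (path_end G w (take i s), drop i s)
      = (if i = length p then c * path_elem (u, p @ q) (w, s) else 0)" if i: "i \<in> {..length s}" for i
  proof (cases "i = length p")
    case True
    then have "s = p @ q \<longleftrightarrow> take i s = p \<and> drop i s = q"
      using i by (metis append_eq_conv_conj append_take_drop_id)
    then show ?thesis using True by (simp add: path_elem_def)
  next
    case False
    then have "take i s \<noteq> p" using i by auto
    then show ?thesis using False by (simp add: path_elem_def)
  qed
  have "((\<lambda>r. c * path_elem (u, p) r) \<otimes>\<^bsub>path_algebra G\<^esub> (path_elem (path_end G u p, q))) (w, s)
      = (\<Sum>i\<le>length s. if i = length p then c * path_elem (u, p @ q) (w, s) else 0)"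
    unfolding path_algebra_mult using * by (rule sum.cong[OF refl])
  also have "\<dots> = c * path_elem (u, p @ q) (w, s)"
  proof (cases "length p \<le> length s")
    case False
    then have "s \<noteq> p @ q" by auto
    then show ?thesis using False by (simp add: path_elem_def)
  qed simp
  finally show "((\<lambda>r. c * path_elem (u, p) r) \<otimes>\<^bsub>path_algebra G\<^esub> (path_elem (path_end G u p, q))) r = c * path_elem (u, p @ q) r"
    by (simp only: r)
qed

text \<open>The support of \<open>f\<close> is finite, so its paths can be added one at a time.\<close>

lemma ideal_path_combination:
  assumes I: "ideal I (path_algebra G :: ('k::field, _) module)"
    and f: "f \<in> carrier (path_algebra G)"
    and paths: "\<And>p c. f p \<noteq> 0 \<Longrightarrow> (\<lambda>q. c * path_elem p q) \<in> I"
  shows "f \<in> I"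
proof -
  interpret ideal I "path_algebra G :: ('k, _) module" by (rule I)
  have "finite S \<Longrightarrow> (\<And>p c. p \<in> S \<Longrightarrow> (\<lambda>q. c * path_elem p q) \<in> I) \<Longrightarrow> (\<lambda>q. if q \<in> S then f q else 0) \<in> I" for S
  proof (induction S rule: finite_induct)
    case empty
    then show ?case using zero_closed additive_subgroup.zero_closed[OF additive_subgroup_axioms] by (simp add: path_algebra_def)
  next
    case (insert p S)
    have "(\<lambda>q. if q \<in> S then f q else 0) \<oplus>\<^bsub>path_algebra G\<^esub> (\<lambda>q. f p * path_elem p q) \<in> I"
      by (rule additive_subgroup.a_closed[OF is_additive_subgroup]) (use insert in auto)
    also have "(\<lambda>q. if q \<in> S then f q else 0) \<oplus>\<^bsub>path_algebra G\<^esub> (\<lambda>q. f p * path_elem p q) = (\<lambda>q. if q \<in> insert p S then f q else 0)"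
      using insert by (auto simp: path_algebra_def path_elem_def fun_eq_iff)
    finally show ?case .
  qed
  from this[of "{p. f p \<noteq> 0}"] have "(\<lambda>q. if f q \<noteq> 0 then f q else 0) \<in> I"
    using f paths by (auto simp: path_algebra_def)
  moreover have "(\<lambda>q. if f q \<noteq> 0 then f q else 0) = f" by auto
  ultimately show ?thesis by simp
qed

end

section \<open>Nonzero paths\<close>

context cycle_quiver begin

text \<open>A path is zero in the Jacobian algebra if and only if this number is at least \<open>a2\<close>.\<close>

definition cyc_count :: "arrow list \<Rightarrow> nat" where
  "cyc_count p = length (filter (\<lambda>e. e \<in> cycle_arrows a2) p)"

lemma cyc_count_simps [simp]: "cyc_count [] = 0" "cyc_count (e # p) = (if e \<in> cycle_arrows a2 then Suc (cyc_count p) else cyc_count p)"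
  "cyc_count (p @ q) = cyc_count p + cyc_count q"
  by (auto simp: cyc_count_def)

lemma cycle_arrows_iff [simp]:
  "(Rv i, Rv j) \<in> cycle_arrows a2 \<longleftrightarrow> i < a2 \<and> j = Suc i \<or> i = a2 \<and> j = 0"
  "(Sv i, w) \<notin> cycle_arrows a2" "(Tv i, w) \<notin> cycle_arrows a2" "(u, Tv i) \<notin> cycle_arrows a2"
  by (auto simp: cycle_arrows_def)

lemma arrow_facts:
  assumes "(u, w) \<in> arrows"
  shows "reaches u w"
    and "Suc (depth_in w + depth_out u) = depth_in u + depth_out w + cyc_count [(u, w)]"
    and "(foot u + cyc_count [(u, w)]) mod Suc a2 = foot w"
    and "u = Tv i \<Longrightarrow> cyc_count [(u, w)] = 0 \<and> (\<exists>j. w = Tv j)"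
  using assms by (cases rule: arrows.cases; auto)+

text \<open>Invariants of walks, by induction: for given ends, the length and the number of arrows of the cycle
  determine each other, this number is known modulo the length \<open>a2 + 1\<close> of the cycle, and
  the t-branch never leads back to the cycle.\<close>

lemma walk_facts:
  assumes "awalk x p y"
  shows "reaches x y \<and> length p + depth_in y + depth_out x = depth_in x + depth_out y + cyc_count p \<and>
    (foot x + cyc_count p) mod Suc a2 = foot y \<and> (\<forall>i. x = Tv i \<longrightarrow> cyc_count p = 0)"
  using assms
proof (induction p arbitrary: x)
  case Nil
  then show ?case using foot_le[of y] by (cases y) (auto simp: awalk_Nil_iff)
next
  case (Cons e p)
  obtain w where e: "e = (x, w)" "(x, w) \<in> arrows" "awalk w p y"
    using Cons.prems by (cases e) (auto simp: awalk_Cons_iff arcs_Q)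
  note IH = Cons.IH[OF e(3)] and a = arrow_facts[OF e(2)]
  have "reaches x y" using a(1) IH reaches_trans by blast
  moreover have "(foot x + cyc_count (e # p)) mod Suc a2 = foot y"
  proof -
    have "(foot x + cyc_count (e # p)) mod Suc a2 = ((foot x + cyc_count [(x, w)]) mod Suc a2 + cyc_count p) mod Suc a2"
      by (simp add: e(1) mod_simps)
    then show ?thesis using a(3) IH by simp
  qed
  moreover have "cyc_count (e # p) = 0" if "x = Tv i" for i
    using a(4)[OF that] IH by (auto simp: e(1) split: if_splits)
  moreover have "length (e # p) + depth_in y + depth_out x = depth_in x + depth_out y + cyc_count (e # p)"
    using a(2) IH by (auto simp: e(1) split: if_splits)
  ultimately show ?case by blast
qed

lemma cyc_dist_unique:
  assumes "i \<le> a2" "n \<le> a2" "(i + n) mod Suc a2 = j" shows "n = cyc_dist i j"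
proof (cases "i + n \<le> a2")
  case True
  then show ?thesis using assms by (simp add: cyc_dist_def)
next
  case False
  then have "(i + n) mod Suc a2 = i + n - Suc a2" using assms by (simp add: le_mod_geq)
  then show ?thesis using False assms by (auto simp: cyc_dist_def)
qed

lemma depth_mono: "reaches x y \<Longrightarrow> x \<in> Q0 a1 a2 \<Longrightarrow> y \<in> Q0 a1 a2 \<Longrightarrow> depth_in y \<le> depth_in x \<and> depth_out x \<le> depth_out y"
  by (cases x; cases y) auto

text \<open>A path with fewer than \<open>a2\<close> arrows of the cycle does not wrap around, so congruences modulo
  \<open>a2 + 1\<close> become equations.\<close>

lemma good_walk:
  assumes "awalk x p y" "cyc_count p < a2"
  shows "has_nz_path x y" "length p = path_len x y" "cyc_count p = cyc_dist (foot x) (foot y)"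
proof -
  have q: "x \<in> Q0 a1 a2" "y \<in> Q0 a1 a2" using assms(1) by auto
  note w = walk_facts[OF assms(1)]
  show c: "cyc_count p = cyc_dist (foot x) (foot y)"
    using w assms(2) foot_le[OF q(1)] by (intro cyc_dist_unique) auto
  show "has_nz_path x y" using w q c assms(2) by (simp add: has_nz_path_def)
  show "length p = path_len x y" 
  proof -
    have "length p + depth_in y + depth_out x = depth_in x + depth_out y + cyc_count p" "reaches x y" using w by auto
    with c depth_mono[OF _ q] show ?thesis unfolding path_len_def by auto
  qed
qed

lemma good_walk_cyc_count:
  assumes "awalk x p y" "has_nz_path x y" "length p = path_len x y"
  shows "cyc_count p = cyc_dist (foot x) (foot y)"
  using walk_facts[OF assms(1)] depth_mono[of x y] has_nz_path_Q0[OF assms(2)] assms(3) by (simp add: path_len_def)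

text \<open>Only \<open>r\<^sub>0\<close> can have two outgoing arrows, the one of the cycle and the one into the
  t-branch. The number of arrows of the cycle tells which of them is taken: the t-branch contains none.\<close>

lemma walk_unique:
  assumes "awalk x p y" "awalk x q y" "length p = length q"
  shows "p = q"
  using assms
proof (induction p arbitrary: x q)
  case (Cons e p)
  then obtain f q' where q: "q = f # q'" by (cases q) auto
  obtain w where e: "e = (x, w)" "(x, w) \<in> arrows" "awalk w p y"
    using Cons.prems by (cases e) (auto simp: awalk_Cons_iff arcs_Q)
  obtain w' where f: "f = (x, w')" "(x, w') \<in> arrows" "awalk w' q' y"
    using Cons.prems q by (cases f) (auto simp: awalk_Cons_iff arcs_Q)
  have c: "cyc_count (e # p) = cyc_count q"
    using walk_facts[OF Cons.prems(1)] walk_facts[OF Cons.prems(2)] Cons.prems(3) by linarith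
  have "w = w'"
  proof (rule ccontr)
    assume "w \<noteq> w'"
    then have "w = Tv 1 \<and> (x, w') \<in> cycle_arrows a2 \<or> w' = Tv 1 \<and> (x, w) \<in> cycle_arrows a2"
      using e(2) f(2) a2 unfolding arrows.simps by auto
    then show False
      using walk_facts[OF e(3)] walk_facts[OF f(3)] c e(1) f(1) q by (auto split: if_splits)
  qed
  then show ?case using Cons.IH[of w q'] e f q Cons.prems(3) by simp
qed simp

lemma walk_exists:
  assumes "has_nz_path x y" shows "\<exists>p. awalk x p y \<and> length p = path_len x y"
  using assms
proof (induction "path_len x y" arbitrary: x rule: less_induct)
  case less
  show ?case
  proof (cases "x = y")
    case True
    then show ?thesis using less has_nz_path_Q0[of x y] by (intro exI[of _ "[]"]) (simp add: awalk_Nil_iff)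
  next
    case False
    obtain x' where x': "(x, x') \<in> arrows" "between x x' y" "path_len x x' = 1"
      using first_step[OF less.prems False] by blast
    have l: "path_len x y = Suc (path_len x' y)" using path_len_add[OF x'(2)] x'(3) by simp
    then obtain p where "awalk x' p y" "length p = path_len x' y"
      using less.hyps[of x'] x'(2) by (auto simp: between_def)
    then show ?thesis using x'(1) l arrows_Q0[OF x'(1)]
      by (intro exI[of _ "(x, x') # p"]) (simp add: awalk_Cons_iff arcs_Q)
  qed
qed

text \<open>The list of arrows of the nonzero path between two vertices; it is meaningful only if
  \<open>has_nz_path\<close> holds.\<close>

definition nz_path :: "vertex \<Rightarrow> vertex \<Rightarrow> arrow list" where
  "nz_path x y = (THE p. awalk x p y \<and> length p = path_len x y)"

lemma nz_path_walk:
  assumes "has_nz_path x y" shows "awalk x (nz_path x y) y" "length (nz_path x y) = path_len x y"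
proof -
  have "\<exists>!p. awalk x p y \<and> length p = path_len x y" using walk_exists[OF assms] walk_unique by metis
  from theI'[OF this] show "awalk x (nz_path x y) y" "length (nz_path x y) = path_len x y"
    by (simp_all add: nz_path_def)
qed

lemma nz_path_eq: "has_nz_path x y \<Longrightarrow> awalk x p y \<Longrightarrow> length p = path_len x y \<Longrightarrow> nz_path x y = p"
  using walk_unique[OF nz_path_walk(1)] nz_path_walk(2) by metis

lemma nz_path_cyc_count: "has_nz_path x y \<Longrightarrow> cyc_count (nz_path x y) = cyc_dist (foot x) (foot y)"
  using good_walk_cyc_count[OF nz_path_walk(1)] nz_path_walk(2) by blast

text \<open>Cutting a nonzero path gives nonzero paths; hence the vertices on it correspond to the positions at
  which it is cut.\<close>

lemma nz_path_split:
  assumes nz: "has_nz_path x y" and i: "i \<le> path_len x y"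
  defines "z \<equiv> path_end \<Q> x (take i (nz_path x y))"
  shows "between x z y" "take i (nz_path x y) = nz_path x z" "drop i (nz_path x y) = nz_path z y" "path_len x z = i"
proof -
  let ?p = "nz_path x y"
  have "awalk x (take i ?p @ drop i ?p) y" using nz_path_walk(1)[OF nz] by simp
  then obtain w where w: "awalk x (take i ?p) w" "awalk w (drop i ?p) y" unfolding awalk_append_iff by blast
  then have z: "w = z" using awalk_path_end[OF w(1)] by (simp add: z_def)
  note w = w[unfolded z]
  have c: "cyc_count (take i ?p) + cyc_count (drop i ?p) = cyc_dist (foot x) (foot y)"
    using nz_path_cyc_count[OF nz] cyc_count_simps(3)[of "take i ?p" "drop i ?p"] by simp
  moreover have "cyc_dist (foot x) (foot y) < a2" using nz by (simp add: has_nz_path_def)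
  ultimately have "cyc_count (take i ?p) < a2" "cyc_count (drop i ?p) < a2" by linarith+
  note g1 = good_walk[OF w(1) this(1)] and g2 = good_walk[OF w(2) this(2)]
  show "between x z y" using nz g1 g2 c by (simp add: between_def)
  show "take i ?p = nz_path x z" using nz_path_eq[OF g1(1) w(1) g1(2)] by simp
  show "drop i ?p = nz_path z y" using nz_path_eq[OF g2(1) w(2) g2(2)] by simp
  show "path_len x z = i" using g1(2) i nz_path_walk(2)[OF nz] by simp
qed

lemma nz_path_append:
  assumes "between x z y" shows "nz_path x y = nz_path x z @ nz_path z y"
proof (rule nz_path_eq)
  have nz: "has_nz_path x z" "has_nz_path z y" "has_nz_path x y" using assms by (auto simp: between_def)
  show "has_nz_path x y" by (rule nz(3))
  show "awalk x (nz_path x z @ nz_path z y) y"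
    using nz_path_walk(1)[OF nz(1)] nz_path_walk(1)[OF nz(2)] by (rule awalk_appendI)
  show "length (nz_path x z @ nz_path z y) = path_len x y" using nz_path_walk(2) nz path_len_add[OF assms] by simp
qed

section \<open>The Jacobian algebra\<close>

text \<open>Reads off the coefficients of an element of the path algebra at the nonzero paths. Its kernel is the
  ideal of relations, so it identifies the Jacobian algebra with the model.\<close>

definition to_inc :: "((vertex, arrow) qpath \<Rightarrow> 'k::field) \<Rightarrow> vertex \<times> vertex \<Rightarrow> 'k" where
  "to_inc f = (\<lambda>(x, y). if has_nz_path x y then f (x, nz_path x y) else 0)"

lemma to_inc_carrier: "to_inc f \<in> carrier inc_algebra"
  by (simp add: to_inc_def inc_algebra_def)

text \<open>The product in the path algebra is a sum over the positions at which a path is cut, the product in the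
  model a sum over the vertices of the path.\<close>

lemma to_inc_mult: "to_inc (f \<otimes>\<^bsub>path_algebra \<Q>\<^esub> g) = to_inc f \<otimes>\<^bsub>inc_algebra\<^esub> to_inc g"
proof
  fix r :: "vertex \<times> vertex"
  obtain x y where r: "r = (x, y)" by (cases r)
  show "to_inc (f \<otimes>\<^bsub>path_algebra \<Q>\<^esub> g) r = (to_inc f \<otimes>\<^bsub>inc_algebra\<^esub> to_inc g) r"
  proof (cases "has_nz_path x y")
    case False
    then have "{z. between x z y} = {}" by (auto simp: between_def)
    then show ?thesis using False by (simp add: r to_inc_def inc_algebra_def)
  next
    case True
    let ?e = "\<lambda>i. path_end \<Q> x (take i (nz_path x y))"
    have "to_inc (f \<otimes>\<^bsub>path_algebra \<Q>\<^esub> g) (x, y)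
        = (\<Sum>i\<le>path_len x y. f (x, take i (nz_path x y)) * g (?e i, drop i (nz_path x y)))"
      using True nz_path_walk(2)[OF True] by (simp add: to_inc_def path_algebra_def)
    also have "\<dots> = (\<Sum>z\<in>{z. between x z y}. to_inc f (x, z) * to_inc g (z, y))"
    proof (rule sum.reindex_bij_witness[of _ "path_len x" ?e])
      fix i assume "i \<in> {..path_len x y}"
      then have i: "i \<le> path_len x y" by simp
      define z where "z = ?e i"
      have s: "between x z y" "take i (nz_path x y) = nz_path x z" "drop i (nz_path x y) = nz_path z y" "path_len x z = i"
        unfolding z_def by (rule nz_path_split[OF True i])+
      show "path_len x (?e i) = i" using s(4) by (simp add: z_def)
      show "?e i \<in> {z. between x z y}" using s(1) by (simp add: z_def)
      have "to_inc f (x, z) * to_inc g (z, y) = f (x, take i (nz_path x y)) * g (z, drop i (nz_path x y))"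
        using s(1) unfolding s(2,3) by (simp add: to_inc_def between_def)
      then show "to_inc f (x, ?e i) * to_inc g (?e i, y) = f (x, take i (nz_path x y)) * g (?e i, drop i (nz_path x y))"
        by (simp add: z_def)
    next
      fix z assume "z \<in> {z. between x z y}"
      then have z: "between x z y" "has_nz_path x z" by (auto simp: between_def)
      show "path_len x z \<in> {..path_len x y}" using path_len_add[OF z(1)] by simp
      show "?e (path_len x z) = z"
        using nz_path_append[OF z(1)] nz_path_walk(2)[OF z(2)] awalk_path_end[OF nz_path_walk(1)[OF z(2)]] by simp
    qed
    finally show ?thesis by (simp add: r inc_algebra_def)
  qed
qed

text \<open>The ring axioms are transported from \<open>End T\<close>.\<close>

lemma inc_algebra_ring: "ring (inc_algebra :: ('k::field, _) module)"
proof -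
  obtain \<iota> \<pi> where T: "is_dsum (T_module a1 a2 :: (vertex, arrow, 'k) rep) (Q0 a1 a2) MM \<iota> \<pi>" by (rule T_dsum)
  let ?T = "T_module a1 a2 :: (vertex, arrow, 'k) rep"
  have r: "is_rep \<Q> ?T" using T by (simp add: is_dsum_def)
  interpret E: ring "End_algebra \<Q> ?T" by (rule End_algebra_ring[OF r])
  have h: "entries \<iota> \<pi> \<in> ring_iso (End_algebra \<Q> ?T) inc_algebra" by (rule entries_iso(1)[OF T])
  have z: "mor_zero \<Q> ?T ?T \<in> Hom \<Q> ?T ?T" by (rule zero_in_Hom[OF r r])
  have "entries \<iota> \<pi> \<zero>\<^bsub>End_algebra \<Q> ?T\<^esub> = \<zero>\<^bsub>inc_algebra\<^esub>"
    using entries_iso(2)[OF T z, of 0] by (simp add: End_algebra_def inc_algebra_def)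
  then show ?thesis using E.ring_iso_imp_img_ring[OF h] by (simp add: inc_algebra_def)
qed

lemma to_inc_ring_hom: "to_inc \<in> ring_hom (path_algebra \<Q>) (inc_algebra :: ('k::field, _) module)"
proof (rule ring_hom_memI)
  show "to_inc \<one>\<^bsub>path_algebra \<Q>\<^esub> = (\<one>\<^bsub>inc_algebra\<^esub> :: vertex \<times> vertex \<Rightarrow> 'k)"
  proof
    fix r :: "vertex \<times> vertex"
    obtain x y where r: "r = (x, y)" by (cases r)
    have "nz_path x y = [] \<longleftrightarrow> x = y" if "has_nz_path x y"
      using nz_path_walk(2)[OF that] path_len_pos[OF that] by (cases "x = y") auto
    then show "to_inc \<one>\<^bsub>path_algebra \<Q>\<^esub> r = (\<one>\<^bsub>inc_algebra\<^esub> :: vertex \<times> vertex \<Rightarrow> 'k) r"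
      using has_nz_path_Q0[of x y] by (auto simp: r to_inc_def path_algebra_def inc_algebra_def)
  qed
qed (auto simp: to_inc_carrier to_inc_mult, auto simp: to_inc_def path_algebra_def inc_algebra_def fun_eq_iff)

lemma to_inc_surj: "to_inc ` carrier (path_algebra \<Q>) = (carrier inc_algebra :: (vertex \<times> vertex \<Rightarrow> 'k::field) set)"
proof (intro equalityI subsetI)
  fix c :: "vertex \<times> vertex \<Rightarrow> 'k" assume c: "c \<in> carrier inc_algebra"
  \<comment> \<open>the preimage is supported on the nonzero paths\<close>
  define f where "f = (\<lambda>(x, p). if \<exists>y. has_nz_path x y \<and> p = nz_path x y then c (x, path_end \<Q> x p) else 0)"
  have s: "{r. f r \<noteq> 0} \<subseteq> (\<lambda>(x, y). (x, nz_path x y)) ` {(x, y). has_nz_path x y}"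
    by (auto simp: f_def split: if_splits)
  have "finite {(x, y). has_nz_path x y}"
    by (rule finite_subset[of _ "Q0 a1 a2 \<times> Q0 a1 a2"]) (use has_nz_path_Q0 finite_Q0 in auto)
  then have "finite {r. f r \<noteq> 0}" using s finite_subset by blast
  moreover have "{r. f r \<noteq> 0} \<subseteq> paths \<Q>" using s nz_path_walk(1) by (fastforce simp: paths_def)
  ultimately have "f \<in> carrier (path_algebra \<Q>)" by (simp add: path_algebra_def)
  moreover have "to_inc f = c"
  proof
    fix r :: "vertex \<times> vertex"
    obtain x y where r: "r = (x, y)" by (cases r)
    show "to_inc f r = c r"
      using c awalk_path_end[OF nz_path_walk(1)[of x y]] by (cases "has_nz_path x y") (auto simp: r to_inc_def f_def inc_algebra_def)
  qed
  ultimately show "c \<in> to_inc ` carrier (path_algebra \<Q>)" by blast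
qed (use to_inc_carrier in auto)

text \<open>In a path, the arrows of the cycle are consecutive: the s-branch can only precede and the t-branch only
  follow them. If there are at least \<open>a2\<close> of them, the first \<open>a2\<close> form a
  relation.\<close>

lemma bad_walk_factor:
  assumes "awalk x p y" "a2 \<le> cyc_count p"
  shows "\<exists>p1 p2 p3. p = p1 @ p2 @ p3 \<and> set p2 \<subseteq> cycle_arrows a2 \<and> length p2 = a2"
proof -
  \<comment> \<open>strengthened for the induction: all arrows of the cycle are in the middle, and a walk that starts on the cycle has no initial part\<close>
  have "\<exists>q1 q2 q3. p = q1 @ q2 @ q3 \<and> set q2 \<subseteq> cycle_arrows a2 \<and> length q2 = cyc_count p \<and> (q1 = [] \<or> (\<exists>i. x = Sv i))"
    using assms(1)
  proof (induction p arbitrary: x)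
    case (Cons e p)
    obtain w where e: "e = (x, w)" "(x, w) \<in> arrows" "awalk w p y"
      using Cons.prems by (cases e) (auto simp: awalk_Cons_iff arcs_Q)
    obtain q1 q2 q3 where q: "p = q1 @ q2 @ q3" "set q2 \<subseteq> cycle_arrows a2" "length q2 = cyc_count p" "q1 = [] \<or> (\<exists>i. w = Sv i)"
      using Cons.IH[OF e(3)] by blast
    from e(2) consider (cycle) "e \<in> cycle_arrows a2" "\<forall>i. w \<noteq> Sv i" | (s) "e \<notin> cycle_arrows a2" "\<exists>i. x = Sv i"
      | (t) "e \<notin> cycle_arrows a2" "\<exists>i. w = Tv i"
      by (cases rule: arrows.cases) (auto simp: e(1))
    then show ?case
    proof cases
      case cycle
      then show ?thesis using q by (intro exI[of _ "[]"] exI[of _ "e # q2"] exI[of _ q3]) auto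
    next
      case s
      then show ?thesis using q by (intro exI[of _ "e # q1"] exI[of _ q2] exI[of _ q3]) auto
    next
      case t
      then have "cyc_count p = 0" using walk_facts[OF e(3)] by auto
      then show ?thesis using t by (intro exI[of _ "[]"] exI[of _ "[]"] exI[of _ "e # p"]) auto
    qed
  qed simp
  then obtain q1 q2 q3 where "p = q1 @ q2 @ q3" "set q2 \<subseteq> cycle_arrows a2" "length q2 = cyc_count p" by blast
  then show ?thesis using assms(2)
    by (intro exI[of _ q1] exI[of _ "take a2 q2"] exI[of _ "drop a2 q2 @ q3"]) (auto dest: in_set_takeD)
qed

text \<open>Relations contain \<open>a2\<close> arrows of the cycle, hence are no nonzero paths and are mapped to 0.
  Conversely, an element of the kernel is a combination of paths with at least \<open>a2\<close> arrows
  of the cycle, as all other paths are the unique nonzero ones; each such path has a relation as a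
  factor.\<close>

lemma to_inc_kernel:
  "a_kernel (path_algebra \<Q>) (inc_algebra :: ('k::field, _) module) to_inc
    = genideal (path_algebra \<Q>) (path_elem ` cycle_subpaths a1 a2)"
proof -
  let ?A = "path_algebra \<Q> :: ('k, (vertex, arrow) qpath \<Rightarrow> 'k) module"
  let ?B = "inc_algebra :: ('k, vertex \<times> vertex \<Rightarrow> 'k) module"
  let ?S = "path_elem ` cycle_subpaths a1 a2 :: ((vertex, arrow) qpath \<Rightarrow> 'k) set"
  interpret A: ring ?A by (rule path_algebra_ring) (simp add: finite_Q0)
  interpret B: ring ?B by (rule inc_algebra_ring)
  interpret ring_hom_ring ?A ?B to_inc
    by (rule ring_hom_ringI2[OF A.ring_axioms B.ring_axioms to_inc_ring_hom])
  have Sc: "?S \<subseteq> carrier ?A"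
    using path_elem_carrier[of _ _ 1] relations_paths by fastforce
  show ?thesis
  proof (rule equalityI)
    show "genideal ?A ?S \<subseteq> a_kernel ?A ?B to_inc"
    proof (rule A.genideal_minimal[OF kernel_is_ideal], rule subsetI)
      fix f assume f: "f \<in> ?S"
      then obtain u p where p: "f = path_elem (u, p)" "(u, p) \<in> cycle_subpaths a1 a2" by auto
      then have "set p \<subseteq> cycle_arrows a2" "length p = a2" by (auto simp: cycle_subpaths_def)
      then have "cyc_count p = a2" unfolding cyc_count_def by (subst filter_True) auto
      then have "nz_path x y \<noteq> p" if "has_nz_path x y" for x y
        using nz_path_cyc_count[OF that] that by (auto simp: has_nz_path_def)
      then have "to_inc f = \<zero>\<^bsub>?B\<^esub>"
        by (auto simp: to_inc_def inc_algebra_def p(1) path_elem_def fun_eq_iff)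
      then show "f \<in> a_kernel ?A ?B to_inc"
        using subsetD[OF Sc f] by (simp only: a_kernel_def' mem_Collect_eq simp_thms)
    qed
    show "a_kernel ?A ?B to_inc \<subseteq> genideal ?A ?S"
    proof (rule subsetI)
      fix f assume "f \<in> a_kernel ?A ?B to_inc"
      then have "f \<in> carrier ?A \<and> to_inc f = \<zero>\<^bsub>?B\<^esub>"
        by (simp only: a_kernel_def' mem_Collect_eq)
      moreover have "\<zero>\<^bsub>?B\<^esub> = (\<lambda>_. 0)" by (simp add: inc_algebra_def)
      ultimately have f: "f \<in> carrier ?A" "to_inc f = (\<lambda>_. 0)" by simp_all
      have I: "ideal (genideal ?A ?S) ?A" by (rule A.genideal_ideal[OF Sc])
      interpret I: ideal "genideal ?A ?S" ?A by (rule I)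
      show "f \<in> genideal ?A ?S"
      proof (rule ideal_path_combination[OF I f(1)])
        fix r and c :: 'k assume r: "f r \<noteq> 0"
        obtain x p where xp: "r = (x, p)" by (cases r)
        define y where "y = path_end \<Q> x p"
        have w: "awalk x p y" using f(1) r unfolding path_algebra_carrier xp y_def path_iff[symmetric] by blast
        have "a2 \<le> cyc_count p"
        proof (rule ccontr)
          assume "\<not> a2 \<le> cyc_count p"
          then have g: "has_nz_path x y" "nz_path x y = p" using good_walk[OF w] nz_path_eq[OF _ w] by auto
          have "to_inc f (x, y) = f r" using g by (simp add: to_inc_def xp)
          then show False using f(2) r by simp
        qed
        then obtain p1 p2 p3 where p: "p = p1 @ p2 @ p3" "set p2 \<subseteq> cycle_arrows a2" "length p2 = a2"
          using bad_walk_factor[OF w] by blast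
        obtain v v' where v: "awalk x p1 v" "awalk v p2 v'" "awalk v' p3 y"
          using w unfolding p(1) awalk_append_iff by blast
        note e = v[THEN awalk_path_end]
        have "(v, p2) \<in> cycle_subpaths a1 a2" using v(2) p by (auto simp: cycle_subpaths_def paths_def)
        then have "path_elem (v, p2) \<in> genideal ?A ?S" using A.genideal_self[OF Sc] by blast
        moreover have "(\<lambda>q. c * path_elem (x, p1) q) \<in> carrier ?A" "path_elem (v', p3) \<in> carrier ?A"
          using path_elem_carrier[of x p1 c] path_elem_carrier[of v' p3 1] v by (auto simp: paths_def)
        ultimately have *: "(\<lambda>q. c * path_elem (x, p1) q) \<otimes>\<^bsub>?A\<^esub> path_elem (v, p2) \<otimes>\<^bsub>?A\<^esub> path_elem (v', p3) \<in> genideal ?A ?S"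
          by (intro I.I_r_closed I.I_l_closed)
        have m1: "(\<lambda>q. c * path_elem (x, p1) q) \<otimes>\<^bsub>?A\<^esub> path_elem (v, p2) = (\<lambda>q. c * path_elem (x, p1 @ p2) q)"
          using path_elem_mult[of c x p1 p2] unfolding e(1) .
        have "path_end \<Q> x (p1 @ p2) = v'" by (simp only: path_end_append e)
        then have m2: "(\<lambda>q. c * path_elem (x, p1 @ p2) q) \<otimes>\<^bsub>?A\<^esub> path_elem (v', p3) = (\<lambda>q. c * path_elem (x, (p1 @ p2) @ p3) q)"
          using path_elem_mult[of c x "p1 @ p2" p3] by (simp only:)
        show "(\<lambda>q. c * path_elem r q) \<in> genideal ?A ?S"
          using * unfolding m1 m2 xp p(1) append_assoc .
      qed
    qed
  qed
qed

end

text \<open>Quotient algebras are rings because the underlying quotient ring is: the two records differ only in the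
  additional field for scalars.\<close>

lemma ring_cong:
  assumes "ring R" "carrier R = carrier S" "mult R = mult S" "one R = one S" "zero R = zero S" "add R = add S"
  shows "ring S"
  using assms(1)
  unfolding ring_def abelian_group_def abelian_monoid_def abelian_group_axioms_def ring_axioms_def
    Group.comm_monoid_def comm_monoid_axioms_def comm_group_def group_def group_axioms_def Group.monoid_def Units_def assms(2-6)
    monoid.simps partial_object.simps
  .

lemma algebra_iso_trans: "algebra_iso A B \<Longrightarrow> algebra_iso B C \<Longrightarrow> algebra_iso A C"
proof -
  assume "algebra_iso A B" "algebra_iso B C"
  then obtain f g where f: "f \<in> ring_iso A B" "\<forall>c. \<forall>x\<in>carrier A. f (c \<odot>\<^bsub>A\<^esub> x) = c \<odot>\<^bsub>B\<^esub> f x"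
    and g: "g \<in> ring_iso B C" "\<forall>c. \<forall>x\<in>carrier B. g (c \<odot>\<^bsub>B\<^esub> x) = c \<odot>\<^bsub>C\<^esub> g x"
    by (auto simp: algebra_iso_def)
  have "f x \<in> carrier B" if "x \<in> carrier A" for x using f(1) that by (auto simp: ring_iso_def ring_hom_def)
  then show "algebra_iso A C"
    unfolding algebra_iso_def using f g ring_iso_set_trans[OF f(1) g(1)] by (intro bexI[of _ "g \<circ> f"]) auto
qed

lemma algebra_iso_sym:
  assumes "ring A" "algebra_iso A B" "\<And>c x. x \<in> carrier A \<Longrightarrow> c \<odot>\<^bsub>A\<^esub> x \<in> carrier A"
  shows "algebra_iso B A"
proof -
  obtain f where f: "f \<in> ring_iso A B" "\<forall>c. \<forall>x\<in>carrier A. f (c \<odot>\<^bsub>A\<^esub> x) = c \<odot>\<^bsub>B\<^esub> f x"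
    using assms(2) by (auto simp: algebra_iso_def)
  let ?g = "inv_into (carrier A) f"
  have b: "bij_betw f (carrier A) (carrier B)" using f(1) by (simp add: ring_iso_def)
  have "?g (c \<odot>\<^bsub>B\<^esub> y) = c \<odot>\<^bsub>A\<^esub> ?g y" if y: "y \<in> carrier B" for c y
  proof -
    obtain x where x: "x \<in> carrier A" "y = f x" using b y by (auto simp: bij_betw_def)
    then have "?g (c \<odot>\<^bsub>B\<^esub> y) = ?g (f (c \<odot>\<^bsub>A\<^esub> x))" using f(2) by simp
    then show ?thesis using x assms(3) b by (simp add: bij_betw_def)
  qed
  then show ?thesis unfolding algebra_iso_def using ring_iso_set_sym[OF assms(1) f(1)] by blast
qed

lemma algebra_iso_op: "algebra_iso A B \<Longrightarrow> algebra_iso (op_algebra A) (op_algebra B)"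
  by (auto simp: algebra_iso_def op_algebra_def ring_iso_def ring_hom_def)

context cycle_quiver begin

text \<open>The isomorphism theorem for rings, extended to scalars. The scalar multiple of a coset is defined as a
  union over its representatives, so all of these must be shown to give the same coset; this follows
  from the injectivity of the induced map. The last two parts provide what the inversion of the
  isomorphism needs.\<close>

lemma jacobian_algebra_iso_inc:
  shows "algebra_iso (jacobian_algebra a1 a2 :: ('k::field, _) module) inc_algebra"
    and "ring (jacobian_algebra a1 a2 :: ('k, _) module)"
    and "X \<in> carrier (jacobian_algebra a1 a2) \<Longrightarrow>
      c \<odot>\<^bsub>jacobian_algebra a1 a2 :: ('k, _) module\<^esub> X \<in> carrier (jacobian_algebra a1 a2)"
proof -
  let ?A = "path_algebra \<Q> :: ('k, (vertex, arrow) qpath \<Rightarrow> 'k) module"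
  let ?B = "inc_algebra :: ('k, vertex \<times> vertex \<Rightarrow> 'k) module"
  let ?I = "genideal ?A (path_elem ` cycle_subpaths a1 a2)"
  let ?J = "jacobian_algebra a1 a2 :: ('k, _) module"
  interpret A: ring ?A by (rule path_algebra_ring) (simp add: finite_Q0)
  interpret B: ring ?B by (rule inc_algebra_ring)
  interpret ring_hom_ring ?A ?B to_inc
    by (rule ring_hom_ringI2[OF A.ring_axioms B.ring_axioms to_inc_ring_hom])
  let ?h = "\<lambda>X. the_elem (to_inc ` X)"
  have h: "?h \<in> ring_iso (?A Quot ?I) ?B"
    using FactRing_iso_set to_inc_surj by (simp add: to_inc_kernel)
  have h': "?h \<in> ring_iso ?J ?B"
    using h unfolding ring_iso_def ring_hom_def
    by (simp add: jacobian_algebra_def bound_quiver_algebra_def quotient_algebra_def)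
  have coset: "?h (?I +>\<^bsub>?A\<^esub> f) = to_inc f" if "f \<in> carrier ?A" for f
    using the_elem_simp[OF that] by (simp add: to_inc_kernel)
  interpret I: ideal ?I ?A using kernel_is_ideal by (simp add: to_inc_kernel)
  have inj: "inj_on ?h (carrier ?J)" using h' by (simp add: ring_iso_def bij_betw_def)
  have Jc: "carrier ?J = a_rcosets\<^bsub>?A\<^esub> ?I"
    by (simp add: jacobian_algebra_def bound_quiver_algebra_def quotient_algebra_def FactRing_def)
  have sm: "?h (c \<odot>\<^bsub>?J\<^esub> X) = c \<odot>\<^bsub>?B\<^esub> ?h X \<and> c \<odot>\<^bsub>?J\<^esub> X \<in> carrier ?J" if X: "X \<in> carrier ?J" for c X
  proof -
    have sm: "c \<odot>\<^bsub>?A\<^esub> g \<in> carrier ?A" if "g \<in> carrier ?A" for g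
    proof -
      have s: "{p. c * g p \<noteq> 0} \<subseteq> {p. g p \<noteq> 0}" by auto
      then show ?thesis using that finite_subset[OF s] by (auto simp: path_algebra_def)
    qed
    obtain f where f: "f \<in> carrier ?A" "X = ?I +>\<^bsub>?A\<^esub> f"
      using X unfolding Jc by (auto simp: A_RCOSETS_def')
    have fX: "f \<in> X" using I.a_rcos_self[OF f(1)] f(2) by simp
    have eq: "?I +>\<^bsub>?A\<^esub> (c \<odot>\<^bsub>?A\<^esub> g) = ?I +>\<^bsub>?A\<^esub> (c \<odot>\<^bsub>?A\<^esub> f)" if g: "g \<in> X" for g
    proof -
      have gA: "g \<in> carrier ?A" using g f I.a_elemrcos_carrier by blast
      have "?I +>\<^bsub>?A\<^esub> g = ?I +>\<^bsub>?A\<^esub> f"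
        using I.a_repr_independence'[OF _ f(1), of g] g f(2) by simp
      then have "to_inc g = to_inc f" using coset[OF gA] coset[OF f(1)] by simp
      then have "to_inc (c \<odot>\<^bsub>?A\<^esub> g) = to_inc (c \<odot>\<^bsub>?A\<^esub> f)"
        by (auto simp: to_inc_def path_algebra_def fun_eq_iff split: if_splits)
      then have "?h (?I +>\<^bsub>?A\<^esub> (c \<odot>\<^bsub>?A\<^esub> g)) = ?h (?I +>\<^bsub>?A\<^esub> (c \<odot>\<^bsub>?A\<^esub> f))"
        using coset sm gA f(1) by simp
      then show ?thesis
        using inj A.a_rcosetsI[OF I.a_subset sm[OF gA]] A.a_rcosetsI[OF I.a_subset sm[OF f(1)]]
        unfolding inj_on_def Jc by blast
    qed
    have "c \<odot>\<^bsub>?J\<^esub> X = (\<Union>g\<in>X. ?I +>\<^bsub>?A\<^esub> (c \<odot>\<^bsub>?A\<^esub> g))"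
      by (simp add: jacobian_algebra_def bound_quiver_algebra_def quotient_algebra_def)
    also have "\<dots> = ?I +>\<^bsub>?A\<^esub> (c \<odot>\<^bsub>?A\<^esub> f)" using eq fX by blast
    finally have cX: "c \<odot>\<^bsub>?J\<^esub> X = ?I +>\<^bsub>?A\<^esub> (c \<odot>\<^bsub>?A\<^esub> f)" .
    have "?h (c \<odot>\<^bsub>?J\<^esub> X) = to_inc (c \<odot>\<^bsub>?A\<^esub> f)"
      unfolding cX by (rule coset[OF sm[OF f(1)]])
    also have "\<dots> = c \<odot>\<^bsub>?B\<^esub> to_inc f"
      by (rule ext) (simp add: to_inc_def path_algebra_def inc_algebra_def split_def)
    also have "to_inc f = ?h X" unfolding f(2) by (rule coset[OF f(1), symmetric])
    finally have "?h (c \<odot>\<^bsub>?J\<^esub> X) = c \<odot>\<^bsub>?B\<^esub> ?h X" .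
    moreover have "c \<odot>\<^bsub>?J\<^esub> X \<in> carrier ?J"
      unfolding Jc cX by (rule A.a_rcosetsI[OF I.a_subset sm[OF f(1)]])
    ultimately show ?thesis by (rule conjI)
  qed
  show "algebra_iso ?J inc_algebra" unfolding algebra_iso_def
    by (rule bexI[OF _ h'], intro allI ballI) (rule conjunct1[OF sm])
  show "c \<odot>\<^bsub>?J\<^esub> X \<in> carrier ?J" if "X \<in> carrier ?J" by (rule conjunct2[OF sm[OF that]])
  have "ring (?A Quot ?I)" by (rule I.quotient_is_ring)
  then show "ring ?J"
    by (rule ring_cong) (simp_all add: jacobian_algebra_def bound_quiver_algebra_def quotient_algebra_def)
qed

end

section \<open>Radical morphisms and direct sums\<close>

context quiver begin

lemma id_in_iso: "is_rep G X \<Longrightarrow> is_iso G X X (mor_id G X)"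
  unfolding is_iso_def using id_in_Hom[of X] comp_id[OF id_in_Hom[of X]] by blast

lemma id_eq_zero_imp:
  fixes X :: "('v, 'e, 'k::field) rep"
  assumes e: "mor_id G X = mor_zero G X X"
  shows "is_zero_rep G X"
proof -
  have "rdim X v = 0" if v: "v \<in> verts G" for v
  proof (rule ccontr)
    assume n: "rdim X v \<noteq> 0"
    have "(1\<^sub>m (rdim X v) :: 'k mat) = 0\<^sub>m (rdim X v) (rdim X v)"
      using fun_cong[OF e, of v] v by (simp add: mor_id_def mor_zero_def)
    then have "(1\<^sub>m (rdim X v) :: 'k mat) $$ (0, 0) = 0\<^sub>m (rdim X v) (rdim X v) $$ (0, 0)" by simp
    then show False using n by simp
  qed
  then show ?thesis by (simp add: is_zero_rep_def)
qed

lemma zero_rep_id: "is_zero_rep G X \<Longrightarrow> mor_id G X = mor_zero G X X"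
  by (auto simp: is_zero_rep_def mor_id_def mor_zero_def fun_eq_iff intro!: eq_matI)

text \<open>A composite through a direct sum is the sum of the composites through the summands.\<close>

lemma dsum_comp_zero:
  assumes R: "is_dsum R I F \<iota> \<pi>" and W: "is_rep G W" "is_rep G V" and f: "f \<in> Hom G W R" and g: "g \<in> Hom G R V"
    and z: "\<And>i. i \<in> I \<Longrightarrow> g \<star> \<iota> i \<star> (\<pi> i \<star> f) = mor_zero G W V"
  shows "g \<star> f = mor_zero G W V"
proof -
  have r: "is_rep G R" "\<And>i. i \<in> I \<Longrightarrow> is_rep G (F i)" "\<And>i. i \<in> I \<Longrightarrow> \<iota> i \<in> Hom G (F i) R"
     "\<And>i. i \<in> I \<Longrightarrow> \<pi> i \<in> Hom G R (F i)"
    using R by (auto simp: is_dsum_def)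
  define S where "S = (\<lambda>i. \<iota> i \<star> (\<pi> i \<star> f))"
  have pf: "\<pi> i \<star> f \<in> Hom G W (F i)" if "i \<in> I" for i
    by (rule comp_in_Hom[OF r(4)[OF that] f W(1) r(1) r(2)[OF that]])
  have S: "S i \<in> Hom G W R" if "i \<in> I" for i
    unfolding S_def by (rule comp_in_Hom[OF r(3)[OF that] pf[OF that] W(1) r(2)[OF that] r(1)])
  have f': "f = mor_sum W R I S" unfolding S_def by (rule dsum_decompose[OF R W(1) f])
  have "g \<star> mor_sum W R I S = mor_sum W V I (\<lambda>i. g \<star> S i)" by (rule comp_sum_right[OF S g])
  also have "\<dots> = mor_zero G W V"
  proof (rule mor_sum_zero)
    fix i assume i: "i \<in> I"
    show "g \<star> S i = mor_zero G W V"
      unfolding S_def using comp_assoc[OF pf[OF i] r(3)[OF i] g] z[OF i] by simp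
  qed
  finally show ?thesis using f' by simp
qed

lemma summand_maps:
  assumes "direct_summand G P X R" "is_rep G R"
  obtains i p where "is_rep G X" "i \<in> Hom G X R" "p \<in> Hom G R X" "p \<star> i = mor_id G X"
proof -
  obtain Y where Y: "is_module G P X" "is_module G P Y" "rep_iso G R (rep_sum [X, Y])"
    using assms(1) by (auto simp: direct_summand_def)
  then obtain i p j q where "is_biproduct R X Y i p j q"
    using rep_iso_sum2_iff[OF assms(2) module_is_rep module_is_rep] by blast
  then show ?thesis using that by (auto simp: is_biproduct_def)
qed

text \<open>\<open>(1 - s) (1 + s) = 1\<close> if \<open>s\<^sup>2 = 0\<close>.\<close>

lemma id_minus_nilpotent_iso:
  assumes Z: "is_rep G Z" and s: "s \<in> Hom G Z Z" and ss: "s \<star> s = mor_zero G Z Z"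
  shows "is_iso G Z Z (mor_add G (mor_id G Z) (mor_smult G (- 1) s))"
proof -
  let ?i = "mor_id G Z" and ?o = "mor_zero G Z Z"
  have i: "?i \<in> Hom G Z Z" by (rule id_in_Hom[OF Z])
  have *: "mor_add G ?i (mor_smult G c s) \<star> mor_add G ?i (mor_smult G d s) = ?i" if "c + d = 0" for c d
  proof -
    have cs: "mor_smult G c s \<in> Hom G Z Z" and ds: "mor_smult G d s \<in> Hom G Z Z"
      using smult_in_Hom[OF Z Z s] by auto
    have t: "mor_add G ?i (mor_smult G d s) \<in> Hom G Z Z" by (rule add_in_Hom[OF Z Z i ds])
    have css: "mor_smult G c s \<star> mor_smult G d s = ?o"
      using comp_smult(2)[OF ds s] comp_smult(1)[OF s s] ss by simp
    have "mor_smult G c s \<star> mor_add G ?i (mor_smult G d s) = mor_smult G c s"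
      using comp_add_right[OF i ds cs] css comp_id(1)[OF cs] mor_add_zero(1)[OF cs] by simp
    moreover have "mor_add G (mor_smult G d s) (mor_smult G c s) = ?o"
      using mor_smult_add[OF s, of d c] that mor_smult_0[OF s] by (simp add: add.commute)
    ultimately show ?thesis
      using comp_add_left[OF t i cs] comp_id(2)[OF t] mor_add_assoc[OF i ds cs] mor_add_zero(1)[OF i] by simp
  qed
  have s1: "mor_add G ?i (mor_smult G c s) \<in> Hom G Z Z" for c
    by (rule add_in_Hom[OF Z Z i smult_in_Hom[OF Z Z s]])
  show ?thesis unfolding is_iso_def
    using s1[of "-1"] s1[of 1] *[of 1 "-1"] *[of "-1" 1] by auto
qed

end

section \<open>Indecomposable summands\<close>

context cycle_quiver begin

abbreviation "\<P> \<equiv> cycle_subpaths a1 a2"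

lemma id_M_nonzero: "x \<in> Q0 a1 a2 \<Longrightarrow> mor_id \<Q> (MM x) \<noteq> (mor_zero \<Q> (MM x) (MM x) :: (vertex, 'k::field) rep_mor)"
  using basis_mor_nonzero[of x x] by (simp add: basis_mor_refl)

lemma End_M:
  assumes "x \<in> Q0 a1 a2" "f \<in> Hom \<Q> (MM x) (MM x)"
  shows "f = mor_smult \<Q> (coef x x f) (mor_id \<Q> (MM x))"
  using Hom_M[OF assms(1,1,2)] by (simp add: basis_mor_refl[OF assms(1)])

text \<open>Since the endomorphisms of \<open>M(x)\<close> are scalars, a nonzero one can be rescaled to the
  identity.\<close>

lemma retract_M:
  fixes N :: "(vertex, arrow, 'k::field) rep"
  assumes x: "x \<in> Q0 a1 a2" and N: "is_module \<Q> \<P> N" and f: "f \<in> Hom \<Q> (MM x) N" and g: "g \<in> Hom \<Q> N (MM x)"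
    and nz: "g \<star> f \<noteq> mor_zero \<Q> (MM x) (MM x)"
  obtains f' where "f' \<in> Hom \<Q> (MM x) N" "g \<star> f' = mor_id \<Q> (MM x)"
proof -
  note N1 = module_is_rep[OF N]
  have gf: "g \<star> f \<in> Hom \<Q> (MM x) (MM x)" by (rule comp_in_Hom[OF g f is_rep_M N1 is_rep_M])
  let ?c = "coef x x (g \<star> f)" and ?i = "mor_id \<Q> (MM x) :: (vertex, 'k) rep_mor"
  have i: "?i \<in> Hom \<Q> (MM x) (MM x)" by (rule id_in_Hom[OF is_rep_M])
  have e: "g \<star> f = mor_smult \<Q> ?c ?i" by (rule End_M[OF x gf])
  then have c: "?c \<noteq> 0" using nz mor_smult_0[OF i] by metis
  have "g \<star> mor_smult \<Q> (1 / ?c) f = mor_smult \<Q> (1 / ?c) (g \<star> f)" by (rule comp_smult(1)[OF f g])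
  also have "\<dots> = mor_smult \<Q> (1 / ?c) (mor_smult \<Q> ?c ?i)" by (rule arg_cong[OF e])
  also have "\<dots> = mor_smult \<Q> (1 / ?c * ?c) ?i" by (rule mor_smult_smult[OF i])
  also have "\<dots> = ?i" using c mor_smult_1[OF i] by simp
  finally show ?thesis using that smult_in_Hom[OF is_rep_M N1 f] by blast
qed

text \<open>The same rescaling on the other side.\<close>

lemma coretract_M:
  fixes N :: "(vertex, arrow, 'k::field) rep"
  assumes x: "x \<in> Q0 a1 a2" and N: "is_rep \<Q> N" and f: "f \<in> Hom \<Q> (MM x) N" and g: "g \<in> Hom \<Q> N (MM x)"
    and nz: "g \<star> f \<noteq> mor_zero \<Q> (MM x) (MM x)"
  obtains g' where "g' \<in> Hom \<Q> N (MM x)" "g' \<star> f = mor_id \<Q> (MM x)"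
proof -
  have gf: "g \<star> f \<in> Hom \<Q> (MM x) (MM x)" by (rule comp_in_Hom[OF g f is_rep_M N is_rep_M])
  let ?c = "coef x x (g \<star> f)" and ?i = "mor_id \<Q> (MM x) :: (vertex, 'k) rep_mor"
  have i: "?i \<in> Hom \<Q> (MM x) (MM x)" by (rule id_in_Hom[OF is_rep_M])
  have e: "g \<star> f = mor_smult \<Q> ?c ?i" by (rule End_M[OF x gf])
  then have c: "?c \<noteq> 0" using nz mor_smult_0[OF i] by metis
  have "mor_smult \<Q> (1 / ?c) g \<star> f = mor_smult \<Q> (1 / ?c) (g \<star> f)" by (rule comp_smult(2)[OF f g])
  also have "\<dots> = mor_smult \<Q> (1 / ?c) (mor_smult \<Q> ?c ?i)" by (rule arg_cong[OF e])
  also have "\<dots> = ?i" using c mor_smult_smult[OF i] mor_smult_1[OF i] by simp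
  finally show ?thesis using that smult_in_Hom[OF N is_rep_M g] by blast
qed

lemma M_summandI:
  fixes N :: "(vertex, arrow, 'k::field) rep"
  assumes x: "x \<in> Q0 a1 a2" and N: "is_module \<Q> \<P> N" and f: "f \<in> Hom \<Q> (MM x) N" and g: "g \<in> Hom \<Q> N (MM x)"
    and gf: "g \<star> f = mor_id \<Q> (MM x)"
  shows "direct_summand \<Q> \<P> (MM x) N"
proof -
  obtain N' j q where N': "is_module \<Q> \<P> N'" "is_biproduct N (MM x) N' f g j q"
    using split_thin_retract[OF relations_paths N is_rep_M rdim_M_le f g gf] by blast
  then have "rep_iso \<Q> N (rep_sum [MM x, N'])"
    using rep_iso_sum2_iff[OF module_is_rep[OF N] is_rep_M module_is_rep[OF N'(1)]] by blast
  then show ?thesis using N'(1) is_module_M[OF x] by (auto simp: direct_summand_def)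
qed

lemma M_summand_T:
  assumes x: "x \<in> Q0 a1 a2"
  shows "direct_summand \<Q> \<P> (MM x) (T_module a1 a2 :: (vertex, arrow, 'k::field) rep)"
proof -
  obtain \<iota> \<pi> where T: "is_dsum (T_module a1 a2 :: (vertex, arrow, 'k) rep) (Q0 a1 a2) MM \<iota> \<pi>" by (rule T_dsum)
  show ?thesis
    by (rule M_summandI[OF x T_is_module, of "\<iota> x" "\<pi> x"]) (use T x in \<open>auto simp: is_dsum_def\<close>)
qed

lemma T_power_dsum:
  fixes T :: "(vertex, arrow, 'k::field) rep"
  assumes "is_rep \<Q> T"
  obtains \<iota> \<pi> where "is_dsum (rep_sum (replicate n T)) {0..<n} (\<lambda>_. T) \<iota> \<pi>"
  using rep_sum_dsum[of "[0..<n]" "\<lambda>_. T"] assms by (auto simp: map_replicate_const)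

lemma M_in_add:
  assumes x: "x \<in> Q0 a1 a2"
  shows "in_add \<Q> \<P> (T_module a1 a2) (MM x :: (vertex, arrow, 'k::field) rep)"
proof -
  let ?T = "T_module a1 a2 :: (vertex, arrow, 'k) rep"
  note T1 = T_is_module[where 'k = 'k] note T2 = module_is_rep[OF T1]
  obtain \<iota> \<pi> where R: "is_dsum (rep_sum (replicate 1 ?T)) {0..<1::nat} (\<lambda>_. ?T) \<iota> \<pi>" by (rule T_power_dsum[OF T2, where n = 1])
  let ?R = "rep_sum (replicate 1 ?T)"
  have R1: "is_module \<Q> \<P> ?R" by (rule module_dsum[OF relations_paths R]) (rule T1)
  have r: "is_rep \<Q> ?R" "\<iota> 0 \<in> Hom \<Q> ?T ?R" "\<pi> 0 \<in> Hom \<Q> ?R ?T" "\<pi> 0 \<star> \<iota> 0 = mor_id \<Q> ?T"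
    using R by (auto simp: is_dsum_def)
  obtain i p where ip: "i \<in> Hom \<Q> (MM x) ?T" "p \<in> Hom \<Q> ?T (MM x)" "p \<star> i = mor_id \<Q> (MM x)"
    using summand_maps[OF M_summand_T[OF x] T2] by blast
  have i': "\<iota> 0 \<star> i \<in> Hom \<Q> (MM x) ?R" by (rule comp_in_Hom[OF r(2) ip(1) is_rep_M T2 r(1)])
  have p': "p \<star> \<pi> 0 \<in> Hom \<Q> ?R (MM x)" by (rule comp_in_Hom[OF ip(2) r(3) r(1) T2 is_rep_M])
  have "p \<star> \<pi> 0 \<star> (\<iota> 0 \<star> i) = mor_id \<Q> (MM x)"
    using comp_assoc[OF i' r(3) ip(2)] comp_assoc[OF ip(1) r(2) r(3), symmetric] r(4) comp_id(2)[OF ip(1)] ip(3) by simp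
  from M_summandI[OF x R1 i' p' this] show ?thesis unfolding in_add_def by blast
qed

lemma M_not_zero: "x \<in> Q0 a1 a2 \<Longrightarrow> \<not> is_zero_rep \<Q> (MM x :: (vertex, arrow, 'k::field) rep)"
  using zero_rep_id[of "MM x :: (vertex, arrow, 'k) rep"] id_M_nonzero[of x] by blast

text \<open>A decomposition gives an idempotent endomorphism of \<open>M(x)\<close>. This is a scalar, hence 0 or 1,
  and one of the two summands vanishes.\<close>

lemma M_indecomposable:
  assumes x: "x \<in> Q0 a1 a2"
  shows "indecomposable \<Q> \<P> (MM x :: (vertex, arrow, 'k::field) rep)"
  unfolding indecomposable_def
proof (intro conjI allI impI)
  let ?X = "MM x :: (vertex, arrow, 'k) rep"
  show "is_module \<Q> \<P> ?X" by (rule is_module_M[OF x])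
  show "\<not> is_zero_rep \<Q> ?X" by (rule M_not_zero[OF x])
  fix Y Z :: "(vertex, arrow, 'k) rep"
  assume YZ: "is_module \<Q> \<P> Y \<and> is_module \<Q> \<P> Z \<and> rep_iso \<Q> ?X (rep_sum [Y, Z])"
  then obtain i p j q where B: "is_biproduct ?X Y Z i p j q"
    using rep_iso_sum2_iff[OF is_rep_M module_is_rep module_is_rep] by blast
  have b: "is_rep \<Q> Y" "is_rep \<Q> Z" "i \<in> Hom \<Q> Y ?X" "p \<in> Hom \<Q> ?X Y" "j \<in> Hom \<Q> Z ?X" "q \<in> Hom \<Q> ?X Z"
      "p \<star> i = mor_id \<Q> Y" "q \<star> j = mor_id \<Q> Z" "p \<star> j = mor_zero \<Q> Z Y" "q \<star> i = mor_zero \<Q> Y Z"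
    using B by (auto simp: is_biproduct_def)
  have e: "i \<star> p \<in> Hom \<Q> ?X ?X" by (rule comp_in_Hom[OF b(3,4) is_rep_M b(1) is_rep_M])
  have id: "mor_id \<Q> ?X \<in> Hom \<Q> ?X ?X" by (rule id_in_Hom[OF is_rep_M])
  have "i \<star> p \<star> (i \<star> p) = i \<star> p"
    using comp_assoc[OF e b(4) b(3)] comp_assoc[OF b(4) b(3) b(4), symmetric] b(7) comp_id(2)[OF b(4)] by simp
  then have "coef x x (i \<star> p) * coef x x (i \<star> p) = coef x x (i \<star> p)"
    using coef_comp[OF x x x e e] x by simp
  then consider "coef x x (i \<star> p) = 0" | "coef x x (i \<star> p) = 1" by auto
  then show "is_zero_rep \<Q> Y \<or> is_zero_rep \<Q> Z"
  proof cases
    case 1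
    then have z: "i \<star> p = mor_zero \<Q> ?X ?X" using End_M[OF x e] mor_smult_0[OF id] by simp
    have "p = p \<star> (i \<star> p)" using comp_assoc[OF b(4) b(3) b(4), symmetric] b(7) comp_id(2)[OF b(4)] by simp
    then have "p = mor_zero \<Q> ?X Y" using z comp_zero(1)[OF b(4)] by simp
    then have "mor_id \<Q> Y = mor_zero \<Q> Y Y" using b(7) comp_zero(2)[OF b(3)] by simp
    then show ?thesis using id_eq_zero_imp by blast
  next
    case 2
    then have z: "i \<star> p = mor_id \<Q> ?X" using End_M[OF x e] mor_smult_1[OF id] by simp
    have "q = q \<star> (i \<star> p)" using z comp_id(1)[OF b(6)] by simp
    also have "\<dots> = q \<star> i \<star> p" by (rule comp_assoc[OF b(4) b(3) b(6), symmetric])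
    also have "\<dots> = mor_zero \<Q> ?X Z" using b(10) comp_zero(2)[OF b(4)] by simp
    finally have "mor_id \<Q> Z = mor_zero \<Q> Z Z" using b(8) comp_zero(2)[OF b(5)] by simp
    then show ?thesis using id_eq_zero_imp by blast
  qed
qed

text \<open>A composite \<open>M(y) \<rightarrow> M(x) \<rightarrow> M(y)\<close> with \<open>x \<noteq> y\<close>
  is zero, because lengths add along nonzero paths. This makes the modules pairwise non-isomorphic and
  all morphisms between different ones radical.\<close>

lemma comp_M_back:
  assumes "x \<in> Q0 a1 a2" "y \<in> Q0 a1 a2" "x \<noteq> y" "f \<in> Hom \<Q> (MM y) (MM x)" "g \<in> Hom \<Q> (MM x) (MM y)"
  shows "g \<star> f = mor_zero \<Q> (MM y) (MM y)"
  using comp_M[OF assms(2,2,1,5,4)] between_antisym[of y x] assms(3) by auto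

lemma M_iso_imp_eq:
  assumes "x \<in> Q0 a1 a2" "y \<in> Q0 a1 a2" "rep_iso \<Q> (MM x :: (vertex, arrow, 'k::field) rep) (MM y)"
  shows "x = y"
proof (rule ccontr)
  assume "x \<noteq> y"
  from assms(3) obtain f g where "f \<in> Hom \<Q> (MM x :: (vertex, arrow, 'k) rep) (MM y)" "g \<in> Hom \<Q> (MM y) (MM x :: (vertex, arrow, 'k) rep)"
    "g \<star> f = mor_id \<Q> (MM x :: (vertex, arrow, 'k) rep)" by (auto simp: rep_iso_def is_iso_def)
  then show False using comp_M_back[OF assms(2,1)] \<open>x \<noteq> y\<close> id_M_nonzero[OF assms(1)] by metis
qed

text \<open>By induction on the length: a product \<open>c (x, z) * c (z, y)\<close> contains a diagonal entry or an
  entry belonging to a shorter path.\<close>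

lemma inc_idempotent_zero_diagonal:
  fixes c :: "vertex \<times> vertex \<Rightarrow> 'k::field"
  assumes c: "c \<in> carrier inc_algebra" "c \<otimes>\<^bsub>inc_algebra\<^esub> c = c" and d: "\<And>x. c (x, x) = 0"
  shows "c (x, y) = 0"
proof (induction "path_len x y" arbitrary: x y rule: less_induct)
  case less
  show ?case
  proof (cases "has_nz_path x y")
    case True
    have "c (x, z) * c (z, y) = 0" if z: "between x z y" for z
    proof (cases "z = y")
      case False
      then have "path_len x z < path_len x y"
        using path_len_add[OF z] path_len_pos[of z y] z by (auto simp: between_def)
      then show ?thesis using less[of x z] by simp
    qed (simp add: d)
    then have "(\<Sum>z\<in>{z. between x z y}. c (x, z) * c (z, y)) = 0" by (intro sum.neutral ballI) blast
    then have "(c \<otimes>\<^bsub>inc_algebra\<^esub> c) (x, y) = 0" by (simp add: inc_algebra_def)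
    then show ?thesis using c(2) by simp
  qed (use c(1) in \<open>simp add: inc_algebra_def\<close>)
qed

text \<open>The idempotent \<open>e\<close> of \<open>T\<close> that belongs to \<open>N\<close> is nonzero, hence
  has a nonzero diagonal entry, at \<open>x\<close> say. Then \<open>M(x)\<close> maps to
  \<open>N\<close> and back with nonzero composite, so it splits off from \<open>N\<close>, and the
  complement vanishes by indecomposability. This direct argument takes the place of the Krull-Schmidt
  theorem.\<close>

lemma indecomposable_summand_T:
  fixes N :: "(vertex, arrow, 'k::field) rep"
  assumes N: "indecomposable \<Q> \<P> N" and s: "direct_summand \<Q> \<P> N (T_module a1 a2)"
  shows "\<exists>x\<in>Q0 a1 a2. rep_iso \<Q> N (MM x)"
proof -
  let ?T = "T_module a1 a2 :: (vertex, arrow, 'k) rep"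
  have N1: "is_module \<Q> \<P> N" and N0: "\<not> is_zero_rep \<Q> N" using N by (auto simp: indecomposable_def)
  note N2 = module_is_rep[OF N1]
  obtain \<iota> \<pi> where T: "is_dsum ?T (Q0 a1 a2) MM \<iota> \<pi>" by (rule T_dsum)
  have r: "is_rep \<Q> ?T" "\<And>x. x \<in> Q0 a1 a2 \<Longrightarrow> \<iota> x \<in> Hom \<Q> (MM x) ?T" "\<And>x. x \<in> Q0 a1 a2 \<Longrightarrow> \<pi> x \<in> Hom \<Q> ?T (MM x)"
    using T by (auto simp: is_dsum_def)
  obtain i p where ip: "i \<in> Hom \<Q> N ?T" "p \<in> Hom \<Q> ?T N" "p \<star> i = mor_id \<Q> N"
    using summand_maps[OF s r(1)] by blast
  define e where "e = i \<star> p"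
  have e: "e \<in> Hom \<Q> ?T ?T" unfolding e_def by (rule comp_in_Hom[OF ip(1,2) r(1) N2 r(1)])
  have pe: "p \<star> e = p" unfolding e_def
    using comp_assoc[OF ip(2) ip(1) ip(2), symmetric] ip(3) comp_id(2)[OF ip(2)] by simp
  have ee: "e \<star> e = e" unfolding e_def
    using comp_assoc[OF e[unfolded e_def] ip(2) ip(1)] pe[unfolded e_def] by simp
  show ?thesis
  proof (cases "\<exists>x\<in>Q0 a1 a2. coef x x (\<pi> x \<star> (e \<star> \<iota> x)) \<noteq> 0")
    case True
    then obtain x where x: "x \<in> Q0 a1 a2" "coef x x (\<pi> x \<star> (e \<star> \<iota> x)) \<noteq> 0" by blast
    have f: "p \<star> \<iota> x \<in> Hom \<Q> (MM x) N" by (rule comp_in_Hom[OF ip(2) r(2)[OF x(1)] is_rep_M r(1) N2])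
    have g: "\<pi> x \<star> i \<in> Hom \<Q> N (MM x)" by (rule comp_in_Hom[OF r(3)[OF x(1)] ip(1) N2 r(1) is_rep_M])
    have "\<pi> x \<star> i \<star> (p \<star> \<iota> x) = \<pi> x \<star> (e \<star> \<iota> x)"
      unfolding e_def using comp_assoc[OF f ip(1) r(3)[OF x(1)]] comp_assoc[OF r(2)[OF x(1)] ip(2) ip(1)] by simp
    then have "\<pi> x \<star> i \<star> (p \<star> \<iota> x) \<noteq> mor_zero \<Q> (MM x) (MM x)"
      using x(2) coef_zero[of x x] by auto
    then obtain f' where f': "f' \<in> Hom \<Q> (MM x) N" "\<pi> x \<star> i \<star> f' = mor_id \<Q> (MM x)"
      using retract_M[OF x(1) N1 f g] by blast
    obtain N' j q where B: "is_module \<Q> \<P> N'" "is_biproduct N (MM x) N' f' (\<pi> x \<star> i) j q"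
      using split_thin_retract[OF relations_paths N1 is_rep_M rdim_M_le f'(1) g f'(2)] by blast
    then have "rep_iso \<Q> N (rep_sum [MM x, N'])"
      using rep_iso_sum2_iff[OF N2 is_rep_M module_is_rep[OF B(1)]] by blast
    then have "is_zero_rep \<Q> N'"
      using N B(1) is_module_M[OF x(1)] M_not_zero[OF x(1)] unfolding indecomposable_def by blast
    then have z: "mor_id \<Q> N' = mor_zero \<Q> N' N'" by (rule zero_rep_id)
    have b: "q \<in> Hom \<Q> N N'" "j \<in> Hom \<Q> N' N" "mor_add \<Q> (f' \<star> (\<pi> x \<star> i)) (j \<star> q) = mor_id \<Q> N"
      using B(2) by (auto simp: is_biproduct_def)
    have "q = mor_zero \<Q> N N'" using z comp_id(2)[OF b(1)] comp_zero(2)[OF b(1)] by metis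
    then have "j \<star> q = mor_zero \<Q> N N" using comp_zero(1)[OF b(2)] by simp
    then have "f' \<star> (\<pi> x \<star> i) = mor_id \<Q> N"
      using b(3) mor_add_zero(1)[OF comp_in_Hom[OF f'(1) g N2 is_rep_M N2]] by simp
    then have "rep_iso \<Q> N (MM x)" unfolding rep_iso_def is_iso_def using f' g by blast
    then show ?thesis using x(1) by blast
  next
    case False
    let ?E = "End_algebra \<Q> ?T" and ?h = "entries \<iota> \<pi>"
    have h: "?h \<in> ring_iso ?E inc_algebra" by (rule entries_iso(1)[OF T])
    have eE: "e \<in> carrier ?E" using e by (simp add: End_algebra_def)
    have "?h (e \<otimes>\<^bsub>?E\<^esub> e) = ?h e \<otimes>\<^bsub>inc_algebra\<^esub> ?h e"
      using h eE by (auto simp: ring_iso_def ring_hom_def)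
    then have 1: "?h e \<otimes>\<^bsub>inc_algebra\<^esub> ?h e = ?h e" using ee by (simp add: End_algebra_def)
    have 2: "?h e \<in> carrier inc_algebra" using h eE by (auto simp: ring_iso_def ring_hom_def)
    have 3: "?h e (x, x) = 0" for x
    proof (cases "x \<in> Q0 a1 a2")
      case True
      then show ?thesis using False by (simp add: entries_def)
    next
      case False
      then show ?thesis by (simp add: entries_def coef_def)
    qed
    have "?h e (x, y) = 0" for x y by (rule inc_idempotent_zero_diagonal[OF 2 1 3])
    then have "?h e = (\<lambda>_. 0)" by auto
    also have "\<dots> = ?h (mor_smult \<Q> 0 e)" using entries_iso(2)[OF T e, of 0] by simp
    finally have "?h e = ?h (mor_zero \<Q> ?T ?T)" using mor_smult_0[OF e] by simp
    moreover have "inj_on ?h (Hom \<Q> ?T ?T)" using h by (simp add: ring_iso_def bij_betw_def End_algebra_def)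
    ultimately have "e = mor_zero \<Q> ?T ?T" using e zero_in_Hom[OF r(1) r(1)] by (simp add: inj_on_eq_iff)
    then have "p = mor_zero \<Q> ?T N" using pe comp_zero(1)[OF ip(2)] by simp
    then have "mor_id \<Q> N = mor_zero \<Q> N N" using ip(3) comp_zero(2)[OF ip(1)] by simp
    then show ?thesis using N0 id_eq_zero_imp by blast
  qed
qed

lemma T_indecomposable_summands:
  "indecomposable_summands \<Q> \<P> (T_module a1 a2 :: (vertex, arrow, 'k::field) rep) (MM ` Q0 a1 a2)"
  unfolding indecomposable_summands_def
proof (intro conjI ballI allI impI)
  fix X Y :: "(vertex, arrow, 'k) rep" assume "X \<in> MM ` Q0 a1 a2"
  then obtain x where x: "x \<in> Q0 a1 a2" "X = MM x" by blast
  show "indecomposable \<Q> \<P> X" unfolding x(2) by (rule M_indecomposable[OF x(1)])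
  show "direct_summand \<Q> \<P> X (T_module a1 a2)" unfolding x(2) by (rule M_summand_T[OF x(1)])
  assume "Y \<in> MM ` Q0 a1 a2" and XY: "rep_iso \<Q> X Y"
  then obtain y where y: "y \<in> Q0 a1 a2" "Y = MM y" by blast
  show "X = Y" unfolding x(2) y(2) using M_iso_imp_eq[OF x(1) y(1) XY[unfolded x(2) y(2)]] by (rule arg_cong)
next
  fix N :: "(vertex, arrow, 'k) rep"
  assume N: "indecomposable \<Q> \<P> N \<and> direct_summand \<Q> \<P> N (T_module a1 a2)"
  obtain x where "x \<in> Q0 a1 a2" "rep_iso \<Q> N (MM x)"
    using indecomposable_summand_T[OF conjunct1[OF N] conjunct2[OF N]] by (rule bexE)
  then show "\<exists>X\<in>MM ` Q0 a1 a2. rep_iso \<Q> N X" by (intro bexI[of _ "MM x"] imageI)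
qed

section \<open>Irreducible morphisms\<close>

lemma zero_not_iso: "x \<in> Q0 a1 a2 \<Longrightarrow> \<not> is_iso \<Q> (MM x) (MM x) (mor_zero \<Q> (MM x) (MM x) :: (vertex, 'k::field) rep_mor)"
proof
  assume x: "x \<in> Q0 a1 a2" and "is_iso \<Q> (MM x) (MM x) (mor_zero \<Q> (MM x) (MM x) :: (vertex, 'k) rep_mor)"
  then obtain g where "g \<in> Hom \<Q> (MM x) (MM x)" "g \<star> mor_zero \<Q> (MM x) (MM x) = (mor_id \<Q> (MM x) :: (vertex, 'k) rep_mor)"
    by (auto simp: is_iso_def)
  then show False using comp_zero(1) id_M_nonzero[OF x] by metis
qed

text \<open>A morphism with a left inverse is not radical, and by rescaling any nonzero composite yields a left
  inverse.\<close>

lemma rad_from_M: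
  assumes y: "y \<in> Q0 a1 a2" and Z: "is_module \<Q> \<P> Z" and g: "g \<in> rad_mor \<Q> (MM y) Z" and a: "a \<in> Hom \<Q> Z (MM y)"
  shows "a \<star> g = mor_zero \<Q> (MM y) (MM y :: (vertex, arrow, 'k::field) rep)"
proof (rule ccontr)
  assume nz: "a \<star> g \<noteq> mor_zero \<Q> (MM y) (MM y)"
  note Z1 = module_is_rep[OF Z]
  have g1: "g \<in> Hom \<Q> (MM y) Z" using g by (simp add: rad_mor_def)
  obtain a' where a': "a' \<in> Hom \<Q> Z (MM y)" "a' \<star> g = mor_id \<Q> (MM y)"
    by (rule coretract_M[OF y Z1 g1 a nz])
  let ?i = "mor_id \<Q> (MM y) :: (vertex, 'k) rep_mor"
  have i: "?i \<in> Hom \<Q> (MM y) (MM y)" by (rule id_in_Hom[OF is_rep_M])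
  have "is_iso \<Q> (MM y) (MM y) (mor_add \<Q> ?i (mor_smult \<Q> (- 1) (a' \<star> g)))"
    using g a'(1) by (simp add: rad_mor_def)
  then show False unfolding a'(2) mor_add_neg[OF i] using zero_not_iso[OF y] by blast
qed

text \<open>The radical is defined by endomorphisms of the source. A right inverse \<open>b'\<close> of
  \<open>h\<close> is annihilated by \<open>1 - b' h\<close>, which therefore is not invertible.\<close>

lemma rad_to_M:
  assumes x: "x \<in> Q0 a1 a2" and Z: "is_module \<Q> \<P> Z" and h: "h \<in> rad_mor \<Q> Z (MM x)" and b: "b \<in> Hom \<Q> (MM x) Z"
  shows "h \<star> b = mor_zero \<Q> (MM x) (MM x :: (vertex, arrow, 'k::field) rep)"
proof (rule ccontr)
  assume nz: "h \<star> b \<noteq> mor_zero \<Q> (MM x) (MM x)"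
  note Z1 = module_is_rep[OF Z]
  have h1: "h \<in> Hom \<Q> Z (MM x)" using h by (simp add: rad_mor_def)
  obtain b' where b': "b' \<in> Hom \<Q> (MM x) Z" "h \<star> b' = mor_id \<Q> (MM x)" by (rule retract_M[OF x Z b h1 nz])
  let ?i = "mor_id \<Q> Z" let ?w = "mor_add \<Q> ?i (mor_smult \<Q> (- 1) (b' \<star> h))"
  have i: "?i \<in> Hom \<Q> Z Z" by (rule id_in_Hom[OF Z1])
  have bh: "b' \<star> h \<in> Hom \<Q> Z Z" by (rule comp_in_Hom[OF b'(1) h1 Z1 is_rep_M Z1])
  have nbh: "mor_smult \<Q> (- 1) (b' \<star> h) \<in> Hom \<Q> Z Z" by (rule smult_in_Hom[OF Z1 Z1 bh])
  have w: "?w \<in> Hom \<Q> Z Z" by (rule add_in_Hom[OF Z1 Z1 i nbh])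
  have "is_iso \<Q> Z Z ?w" using h b'(1) by (simp add: rad_mor_def)
  then obtain l where l: "l \<in> Hom \<Q> Z Z" "l \<star> ?w = ?i" by (auto simp: is_iso_def)
  have "b' \<star> h \<star> b' = b'" using comp_assoc[OF b'(1) h1 b'(1)] b'(2) comp_id(1)[OF b'(1)] by simp
  then have "?w \<star> b' = mor_zero \<Q> (MM x) Z"
    using comp_add_left[OF b'(1) i nbh] comp_id(2)[OF b'(1)] comp_smult(2)[OF b'(1) bh] mor_add_neg[OF b'(1)] by simp
  then have "b' = mor_zero \<Q> (MM x) Z"
    using comp_assoc[OF b'(1) w l(1)] l(2) comp_id(2)[OF b'(1)] comp_zero(1)[OF l(1)] by simp
  then have "mor_id \<Q> (MM x) = (mor_zero \<Q> (MM x) (MM x) :: (vertex, 'k) rep_mor)"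
    using b'(2) comp_zero(1)[OF h1] by simp
  then show False using id_M_nonzero[OF x] by blast
qed

lemma rad_M_neq:
  assumes "x \<in> Q0 a1 a2" "y \<in> Q0 a1 a2" "x \<noteq> y"
  shows "rad_mor \<Q> (MM y) (MM x :: (vertex, arrow, 'k::field) rep) = Hom \<Q> (MM y) (MM x)"
  unfolding rad_mor_def
  by (auto simp: comp_M_back[OF assms] mor_add_zero(1)[OF id_in_Hom[OF is_rep_M]] id_in_iso[OF is_rep_M])

lemma rad_M_refl:
  assumes x: "x \<in> Q0 a1 a2" and f: "f \<in> rad_mor \<Q> (MM x) (MM x :: (vertex, arrow, 'k::field) rep)"
  shows "f = mor_zero \<Q> (MM x) (MM x)"
proof -
  have "f \<in> Hom \<Q> (MM x) (MM x)" using f by (simp add: rad_mor_def)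
  then show ?thesis using rad_from_M[OF x is_module_M[OF x] f id_in_Hom[OF is_rep_M]] comp_id(2) by metis
qed

lemma zero_in_rad:
  assumes "x \<in> Q0 a1 a2" "y \<in> Q0 a1 a2"
  shows "mor_zero \<Q> (MM y) (MM x) \<in> rad_mor \<Q> (MM y) (MM x :: (vertex, arrow, 'k::field) rep)"
  unfolding rad_mor_def
  by (auto simp: zero_in_Hom[OF is_rep_M is_rep_M] mor_add_zero(1)[OF id_in_Hom[OF is_rep_M]] id_in_iso[OF is_rep_M])

text \<open>The nonzero paths of length one. They are the arrows of the quiver of \<open>End T\<close>, reversed.\<close>

definition End_arrow :: "vertex \<Rightarrow> vertex \<Rightarrow> bool" where
  "End_arrow x y \<longleftrightarrow> has_nz_path x y \<and> path_len x y = 1"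

lemma End_arrow_facts: assumes "End_arrow x y" shows "x \<in> Q0 a1 a2" "y \<in> Q0 a1 a2" "x \<noteq> y" "has_nz_path x y"
  using assms has_nz_path_Q0 by (auto simp: End_arrow_def)

text \<open>A summand \<open>Z\<close> of a power of \<open>T\<close> is factored through the copies of the
  \<open>M(z)\<close>. The composite through \<open>M(z)\<close> can be nonzero only if \<open>z\<close>
  lies on the path from \<open>x\<close> to \<open>y\<close>. This path has length one, so
  \<open>z\<close> is one of its ends, and there one of the two factors is a radical endomorphism of
  \<open>M(z)\<close>, hence zero.\<close>

lemma rad_comp_zero:
  fixes Z :: "(vertex, arrow, 'k::field) rep"
  assumes xy: "End_arrow x y" and Z: "in_add \<Q> \<P> (T_module a1 a2) Z"
    and g: "g \<in> rad_mor \<Q> (MM y) Z" and h: "h \<in> rad_mor \<Q> Z (MM x)"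
  shows "h \<star> g = mor_zero \<Q> (MM y) (MM x)"
proof -
  let ?T = "T_module a1 a2 :: (vertex, arrow, 'k) rep"
  note q = End_arrow_facts[OF xy]
  obtain n where n: "direct_summand \<Q> \<P> Z (rep_sum (replicate n ?T))" using Z by (auto simp: in_add_def)
  obtain \<iota> \<pi> where T: "is_dsum ?T (Q0 a1 a2) MM \<iota> \<pi>" by (rule T_dsum)
  have r: "is_rep \<Q> ?T" "\<And>x. x \<in> Q0 a1 a2 \<Longrightarrow> \<iota> x \<in> Hom \<Q> (MM x) ?T" "\<And>x. x \<in> Q0 a1 a2 \<Longrightarrow> \<pi> x \<in> Hom \<Q> ?T (MM x)"
    using T by (auto simp: is_dsum_def)
  let ?R = "rep_sum (replicate n ?T)"
  obtain \<iota>' \<pi>' where R: "is_dsum ?R {0..<n} (\<lambda>_. ?T) \<iota>' \<pi>'" by (rule T_power_dsum[OF r(1), where n = n])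
  have r': "is_rep \<Q> ?R" "\<And>k. k \<in> {0..<n} \<Longrightarrow> \<iota>' k \<in> Hom \<Q> ?T ?R" "\<And>k. k \<in> {0..<n} \<Longrightarrow> \<pi>' k \<in> Hom \<Q> ?R ?T"
    using R by (auto simp: is_dsum_def)
  have Zm: "is_module \<Q> \<P> Z" using n by (simp add: direct_summand_def)
  note Z1 = module_is_rep[OF Zm]
  obtain i p where ip: "i \<in> Hom \<Q> Z ?R" "p \<in> Hom \<Q> ?R Z" "p \<star> i = mor_id \<Q> Z"
    using summand_maps[OF n r'(1)] by blast
  have g1: "g \<in> Hom \<Q> (MM y) Z" and h1: "h \<in> Hom \<Q> Z (MM x)" using g h by (auto simp: rad_mor_def)
  have ig: "i \<star> g \<in> Hom \<Q> (MM y) ?R" by (rule comp_in_Hom[OF ip(1) g1 is_rep_M Z1 r'(1)])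
  have hp: "h \<star> p \<in> Hom \<Q> ?R (MM x)" by (rule comp_in_Hom[OF h1 ip(2) r'(1) Z1 is_rep_M])
  have "h \<star> g = h \<star> p \<star> (i \<star> g)"
    using comp_assoc[OF ig ip(2) h1] comp_assoc[OF g1 ip(1) ip(2), symmetric] ip(3) comp_id(2)[OF g1] by simp
  also have "\<dots> = mor_zero \<Q> (MM y) (MM x)"
  proof (rule dsum_comp_zero[OF R is_rep_M is_rep_M ig hp])
    fix k assume k: "k \<in> {0..<n}"
    have a: "\<pi>' k \<star> i \<in> Hom \<Q> Z ?T" by (rule comp_in_Hom[OF r'(3)[OF k] ip(1) Z1 r'(1) r(1)])
    have b: "p \<star> \<iota>' k \<in> Hom \<Q> ?T Z" by (rule comp_in_Hom[OF ip(2) r'(2)[OF k] r(1) r'(1) Z1])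
    have ag: "\<pi>' k \<star> i \<star> g \<in> Hom \<Q> (MM y) ?T" by (rule comp_in_Hom[OF a g1 is_rep_M Z1 r(1)])
    have hb: "h \<star> (p \<star> \<iota>' k) \<in> Hom \<Q> ?T (MM x)" by (rule comp_in_Hom[OF h1 b r(1) Z1 is_rep_M])
    have e: "h \<star> p \<star> \<iota>' k = h \<star> (p \<star> \<iota>' k)" "\<pi>' k \<star> (i \<star> g) = \<pi>' k \<star> i \<star> g"
      using comp_assoc[OF r'(2)[OF k] ip(2) h1] comp_assoc[OF g1 ip(1) r'(3)[OF k]] by simp_all
    show "h \<star> p \<star> \<iota>' k \<star> (\<pi>' k \<star> (i \<star> g)) = mor_zero \<Q> (MM y) (MM x)"
      unfolding e
    proof (rule dsum_comp_zero[OF T is_rep_M is_rep_M ag hb])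
      fix z assume z: "z \<in> Q0 a1 a2"
      have za: "\<pi> z \<star> (\<pi>' k \<star> i) \<in> Hom \<Q> Z (MM z)"
        by (rule comp_in_Hom[OF r(3)[OF z] a Z1 r(1) is_rep_M])
      have bz: "p \<star> \<iota>' k \<star> \<iota> z \<in> Hom \<Q> (MM z) Z"
        by (rule comp_in_Hom[OF b r(2)[OF z] is_rep_M r(1) Z1])
      have zag: "\<pi> z \<star> (\<pi>' k \<star> i) \<star> g \<in> Hom \<Q> (MM y) (MM z)"
        by (rule comp_in_Hom[OF za g1 is_rep_M Z1 is_rep_M])
      have hbz: "h \<star> (p \<star> \<iota>' k \<star> \<iota> z) \<in> Hom \<Q> (MM z) (MM x)"
        by (rule comp_in_Hom[OF h1 bz is_rep_M Z1 is_rep_M])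
      have e: "h \<star> (p \<star> \<iota>' k) \<star> \<iota> z = h \<star> (p \<star> \<iota>' k \<star> \<iota> z)" "\<pi> z \<star> (\<pi>' k \<star> i \<star> g) = \<pi> z \<star> (\<pi>' k \<star> i) \<star> g"
        using comp_assoc[OF r(2)[OF z] b h1] comp_assoc[OF g1 a r(3)[OF z]] by simp_all
      have "h \<star> (p \<star> \<iota>' k \<star> \<iota> z) \<star> (\<pi> z \<star> (\<pi>' k \<star> i) \<star> g) = mor_zero \<Q> (MM y) (MM x)"
      proof (cases "between x z y")
        case False
        then show ?thesis using comp_M[OF q(1,2) z hbz zag] by simp
      next
        case True
        then have "path_len x z + path_len z y = 1" using path_len_add[OF True] xy by (simp add: End_arrow_def)
        then have "z = x \<or> z = y"
          using path_len_pos[of x z] path_len_pos[of z y] True by (fastforce simp: between_def)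
        then show ?thesis
        proof
          assume "z = x"
          then have "h \<star> (p \<star> \<iota>' k \<star> \<iota> z) = mor_zero \<Q> (MM z) (MM x)"
            using rad_to_M[OF q(1) Zm h] bz by simp
          then show ?thesis using comp_zero(2)[OF zag] by simp
        next
          assume "z = y"
          then have "\<pi> z \<star> (\<pi>' k \<star> i) \<star> g = mor_zero \<Q> (MM y) (MM z)"
            using rad_from_M[OF q(2) Zm g] za by simp
          then show ?thesis using comp_zero(1)[OF hbz] by simp
        qed
      qed
      then show "h \<star> (p \<star> \<iota>' k) \<star> \<iota> z \<star> (\<pi> z \<star> (\<pi>' k \<star> i \<star> g)) = mor_zero \<Q> (MM y) (MM x)"
        by (simp only: e)
    qed
  qed
  finally show ?thesis .
qed

text \<open>The square of the radical is spanned by the composites that vanish by the previous lemma.\<close>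

lemma rad2_End_arrow:
  assumes xy: "End_arrow x y" and f: "f \<in> rad2_add \<Q> \<P> (T_module a1 a2) (MM y) (MM x :: (vertex, arrow, 'k::field) rep)"
  shows "f = mor_zero \<Q> (MM y) (MM x)"
  using f
proof induction
  case (add f Z g h)
  then have "h \<star> g = mor_zero \<Q> (MM y) (MM x)" by (intro rad_comp_zero[OF xy])
  then show ?case using add mor_add_zero(1)[OF zero_in_Hom[OF is_rep_M is_rep_M]] by simp
qed simp

text \<open>A nonzero path that is longer than an arrow factors through its first step, and both factors are
  radical.\<close>

lemma rad2_not_End_arrow:
  assumes x: "x \<in> Q0 a1 a2" and y: "y \<in> Q0 a1 a2" and xy: "\<not> End_arrow x y" "x \<noteq> y"
    and f: "f \<in> Hom \<Q> (MM y) (MM x :: (vertex, arrow, 'k::field) rep)"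
  shows "f \<in> rad2_add \<Q> \<P> (T_module a1 a2) (MM y) (MM x)"
proof (cases "has_nz_path x y")
  case False
  have "f = mor_smult \<Q> (coef x y f) (mor_zero \<Q> (MM y) (MM x))"
    using Hom_M[OF x y f] unfolding basis_mor_zero[OF False] .
  also have "\<dots> = mor_zero \<Q> (MM y) (MM x)" by (rule mor_smult_zero)
  finally show ?thesis by (simp only: rad2_add.zero)
next
  case True
  obtain z where z: "(x, z) \<in> arrows" "between x z y" "path_len x z = 1" by (rule first_step[OF True xy(2)])
  then have zq: "z \<in> Q0 a1 a2" using arrows_Q0 by blast
  have zx: "x \<noteq> z" "z \<noteq> y" using z(3) xy(1) True by (auto simp: End_arrow_def)
  let ?g = "mor_smult \<Q> (coef x y f) (basis_mor z y) :: (vertex, 'k) rep_mor"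
  have g: "?g \<in> rad_mor \<Q> (MM y) (MM z)"
    unfolding rad_M_neq[OF zq y zx(2)] by (rule smult_in_Hom[OF is_rep_M is_rep_M basis_mor_in_Hom[OF zq y]])
  have h: "basis_mor x z \<in> rad_mor \<Q> (MM z) (MM x :: (vertex, arrow, 'k) rep)"
    unfolding rad_M_neq[OF x zq zx(1)] by (rule basis_mor_in_Hom[OF x zq])
  have "basis_mor x z \<star> ?g = mor_smult \<Q> (coef x y f) (basis_mor x z \<star> basis_mor z y)"
    by (rule comp_smult(1)[OF basis_mor_in_Hom[OF zq y] basis_mor_in_Hom[OF x zq]])
  also have "\<dots> = f" using z(2) Hom_M[OF x y f] by (simp add: basis_mor_comp[OF x y zq])
  finally have e: "basis_mor x z \<star> ?g = f" .
  have "mor_add \<Q> (mor_zero \<Q> (MM y) (MM x)) (basis_mor x z \<star> ?g) \<in> rad2_add \<Q> \<P> (T_module a1 a2) (MM y) (MM x)"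
    by (rule rad2_add.add[OF rad2_add.zero M_in_add[OF zq] g h])
  then show ?thesis unfolding e using mor_add_zero(2)[OF f] by simp
qed

text \<open>A factorisation without a split mono or split epi would consist of radical morphisms: by rescaling,
  \<open>u g = 0\<close> and \<open>h k = 0\<close> for all \<open>u\<close> and \<open>k\<close>, so
  that \<open>(k h)\<^sup>2 = 0\<close>. But composites of radical morphisms vanish.\<close>

lemma basis_mor_irreducible:
  assumes xy: "End_arrow x y"
  shows "irreducible_in_add \<Q> \<P> (T_module a1 a2) (MM y) (MM x) (basis_mor x y :: (vertex, 'k::field) rep_mor)"
  unfolding irreducible_in_add_def
proof (intro conjI allI impI)
  note q = End_arrow_facts[OF xy]
  let ?X = "MM y :: (vertex, arrow, 'k) rep" and ?Y = "MM x :: (vertex, arrow, 'k) rep"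
  show b: "(basis_mor x y :: (vertex, 'k) rep_mor) \<in> Hom \<Q> ?X ?Y" by (rule basis_mor_in_Hom[OF q(1,2)])
  show "\<not> split_mono \<Q> ?X ?Y (basis_mor x y)"
    using comp_M_back[OF q(1,2,3) b] id_M_nonzero[OF q(2)] unfolding split_mono_def by metis
  show "\<not> split_epi \<Q> ?X ?Y (basis_mor x y)"
    using comp_M_back[OF q(2,1) q(3)[symmetric] _ b] id_M_nonzero[OF q(1)] unfolding split_epi_def by metis
  fix Z and g h :: "(vertex, 'k) rep_mor"
  assume a: "in_add \<Q> \<P> (T_module a1 a2) Z \<and> g \<in> Hom \<Q> ?X Z \<and> h \<in> Hom \<Q> Z ?Y \<and> basis_mor x y = h \<star> g"
  then have Zm: "is_module \<Q> \<P> Z" by (auto simp: in_add_def direct_summand_def)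
  note Z1 = module_is_rep[OF Zm]
  have g: "g \<in> Hom \<Q> ?X Z" and h: "h \<in> Hom \<Q> Z ?Y" using a by auto
  show "split_mono \<Q> ?X Z g \<or> split_epi \<Q> Z ?Y h"
  proof (rule ccontr)
    assume n: "\<not> (split_mono \<Q> ?X Z g \<or> split_epi \<Q> Z ?Y h)"
    have "u \<star> g = mor_zero \<Q> ?X ?X" if u: "u \<in> Hom \<Q> Z ?X" for u
      using coretract_M[OF q(2) Z1 g u] n unfolding split_mono_def by blast
    then have gr: "g \<in> rad_mor \<Q> ?X Z"
      unfolding rad_mor_def using g by (auto simp: mor_add_zero(1)[OF id_in_Hom[OF is_rep_M]] id_in_iso[OF is_rep_M])
    have hr: "h \<in> rad_mor \<Q> Z ?Y"
      unfolding rad_mor_def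
    proof (intro CollectI conjI ballI h)
      fix k assume k: "k \<in> Hom \<Q> ?Y Z"
      have hk: "h \<star> k = mor_zero \<Q> ?Y ?Y"
        using retract_M[OF q(1) Zm k h] n unfolding split_epi_def by blast
      have kh: "k \<star> h \<in> Hom \<Q> Z Z" by (rule comp_in_Hom[OF k h Z1 is_rep_M Z1])
      have "k \<star> h \<star> (k \<star> h) = mor_zero \<Q> Z Z"
        using comp_assoc[OF kh h k] comp_assoc[OF h k h, symmetric] hk comp_zero(2)[OF h] comp_zero(1)[OF k] by simp
      then show "is_iso \<Q> Z Z (mor_add \<Q> (mor_id \<Q> Z) (mor_smult \<Q> (- 1) (k \<star> h)))"
        by (rule id_minus_nilpotent_iso[OF Z1 kh])
    qed
    have "h \<star> g = mor_zero \<Q> ?X ?Y" using a by (intro rad_comp_zero[OF xy _ gr hr]) simp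
    then have "basis_mor x y = mor_zero \<Q> ?X ?Y" using a by simp
    then show False by (rule notE[OF basis_mor_nonzero[OF q(4)]])
  qed
qed

lemma lincomb_sum:
  assumes "B \<subseteq> Hom \<Q> X Y"
  shows "mor_lincomb \<Q> X Y B c = mor_sum X Y B (\<lambda>b. mor_smult \<Q> (c b) b)"
proof
  fix v
  show "mor_lincomb \<Q> X Y B c v = mor_sum X Y B (\<lambda>b. mor_smult \<Q> (c b) b) v"
  proof (cases "v \<in> verts \<Q>")
    case True
    have "dim_row (b v) = rdim Y v" "dim_col (b v) = rdim X v" if "b \<in> B" for b
      using Hom_dim[of b X Y v] assms that True by auto
    then show ?thesis using True by (auto simp: mor_lincomb_def mor_sum_def mor_smult_def intro!: eq_matI sum.cong)
  qed (simp_all add: mor_lincomb_def mor_sum_def)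
qed

lemma lincomb_empty: "mor_lincomb \<Q> X Y {} c = mor_zero \<Q> X Y"
  by (auto simp: mor_lincomb_def mor_zero_def fun_eq_iff intro!: eq_matI)

lemma lincomb_in_Hom:
  assumes "is_rep \<Q> X" "is_rep \<Q> Y" "B \<subseteq> Hom \<Q> X Y" shows "mor_lincomb \<Q> X Y B c \<in> Hom \<Q> X Y"
  unfolding lincomb_sum[OF assms(3)] using assms by (intro sum_in_Hom smult_in_Hom) auto

lemma coef_lincomb:
  assumes "finite B" "B \<subseteq> Hom \<Q> (MM y) (MM x)"
  shows "coef x y (mor_lincomb \<Q> (MM y) (MM x) B c) = (\<Sum>b\<in>B. c b * coef x y b)"
  unfolding lincomb_sum[OF assms(2)]
  by (subst coef_sum[OF assms(1)]) (use assms(2) in \<open>auto simp: coef_smult intro!: smult_in_Hom is_rep_M\<close>)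

lemma coef_difference:
  assumes "f \<in> Hom \<Q> (MM y) (MM x)" "g \<in> Hom \<Q> (MM y) (MM x)"
  shows "coef x y (mor_add \<Q> f (mor_smult \<Q> (- 1) g)) = coef x y f - coef x y g"
  using coef_add[OF assms(1) smult_in_Hom[OF is_rep_M is_rep_M assms(2)], of "-1"] by (simp add: coef_smult)

lemma difference_in_Hom:
  assumes "f \<in> Hom \<Q> (MM y) (MM x)" "g \<in> Hom \<Q> (MM y) (MM x)"
  shows "mor_add \<Q> f (mor_smult \<Q> (- 1) g) \<in> Hom \<Q> (MM y) (MM x)"
  using assms by (intro add_in_Hom smult_in_Hom is_rep_M)

text \<open>The radical is the line spanned by \<open>basis_mor x y\<close>, and its square is zero.\<close>

lemma irr_basis_End_arrow_exists:
  assumes xy: "End_arrow x y"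
  shows "irr_basis \<Q> \<P> (T_module a1 a2) (MM y) (MM x) {basis_mor x y :: (vertex, 'k::field) rep_mor}"
proof -
  note q = End_arrow_facts[OF xy]
  let ?b = "basis_mor x y :: (vertex, 'k) rep_mor"
  let ?X = "MM y :: (vertex, arrow, 'k) rep" and ?Y = "MM x :: (vertex, arrow, 'k) rep"
  have b: "?b \<in> Hom \<Q> ?X ?Y" by (rule basis_mor_in_Hom[OF q(1,2)])
  have "\<exists>!c. c \<in> {?b} \<rightarrow>\<^sub>E UNIV \<and>
      mor_add \<Q> f (mor_smult \<Q> (- 1) (mor_lincomb \<Q> ?X ?Y {?b} c)) \<in> rad2_add \<Q> \<P> (T_module a1 a2) ?X ?Y"
    if f: "f \<in> rad_mor \<Q> ?X ?Y" for f
  proof -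
    have f1: "f \<in> Hom \<Q> ?X ?Y" using f by (simp add: rad_mor_def)
    have l: "mor_lincomb \<Q> ?X ?Y {?b} c \<in> Hom \<Q> ?X ?Y" for c
      by (rule lincomb_in_Hom[OF is_rep_M is_rep_M]) (use b in simp)
    have lc: "coef x y (mor_lincomb \<Q> ?X ?Y {?b} c) = c ?b" for c
      using coef_lincomb[of "{?b}" y x c] b coef_basis_mor[OF q(4), where 'a = 'k] by simp
    have *: "mor_add \<Q> f (mor_smult \<Q> (- 1) (mor_lincomb \<Q> ?X ?Y {?b} c)) \<in> rad2_add \<Q> \<P> (T_module a1 a2) ?X ?Y
        \<longleftrightarrow> c ?b = coef x y f" for c
    proof
      assume "mor_add \<Q> f (mor_smult \<Q> (- 1) (mor_lincomb \<Q> ?X ?Y {?b} c)) \<in> rad2_add \<Q> \<P> (T_module a1 a2) ?X ?Y"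
      then have "mor_add \<Q> f (mor_smult \<Q> (- 1) (mor_lincomb \<Q> ?X ?Y {?b} c)) = mor_zero \<Q> ?X ?Y"
        by (rule rad2_End_arrow[OF xy])
      then have "coef x y f - c ?b = 0"
        using coef_difference[OF f1 l, of c] coef_zero[of x y, where 'a = 'k] lc by metis
      then show "c ?b = coef x y f" by simp
    next
      assume "c ?b = coef x y f"
      then have "coef x y (mor_add \<Q> f (mor_smult \<Q> (- 1) (mor_lincomb \<Q> ?X ?Y {?b} c))) = coef x y (mor_zero \<Q> ?X ?Y)"
        using coef_difference[OF f1 l, of c] lc coef_zero[of x y, where 'a = 'k] by simp
      then have "mor_add \<Q> f (mor_smult \<Q> (- 1) (mor_lincomb \<Q> ?X ?Y {?b} c)) = mor_zero \<Q> ?X ?Y"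
        by (rule coef_eqI[OF q(1,2) difference_in_Hom[OF f1 l] zero_in_Hom[OF is_rep_M is_rep_M]])
      then show "mor_add \<Q> f (mor_smult \<Q> (- 1) (mor_lincomb \<Q> ?X ?Y {?b} c)) \<in> rad2_add \<Q> \<P> (T_module a1 a2) ?X ?Y"
        by (simp add: rad2_add.zero)
    qed
    show ?thesis unfolding *
    proof (rule ex1I[of _ "\<lambda>b\<in>{?b}. coef x y f"])
      fix c assume "c \<in> {?b} \<rightarrow>\<^sub>E UNIV \<and> c ?b = coef x y f"
      then show "c = (\<lambda>b\<in>{?b}. coef x y f)" by (intro PiE_ext[of c "{?b}" "\<lambda>_. UNIV"]) auto
    qed simp
  qed
  then show ?thesis
    unfolding irr_basis_def using basis_mor_irreducible[OF xy] b rad_M_neq[OF q(1,2,3)] by auto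
qed

text \<open>The radical modulo its square is a line. The definition of a basis asks for unique coefficients; two
  different members would allow a nontrivial combination that represents 0.\<close>

lemma irr_basis_End_arrow_unique:
  assumes xy: "End_arrow x y" and B: "irr_basis \<Q> \<P> (T_module a1 a2) (MM y) (MM x :: (vertex, arrow, 'k::field) rep) B"
  shows "\<exists>b. B = {b}"
proof -
  note q = End_arrow_facts[OF xy]
  let ?X = "MM y :: (vertex, arrow, 'k) rep" and ?Y = "MM x :: (vertex, arrow, 'k) rep"
  have fin: "finite B" and BH: "B \<subseteq> Hom \<Q> ?X ?Y"
    using B by (auto simp: irr_basis_def rad_mor_def)
  have ex1: "\<exists>!c. c \<in> B \<rightarrow>\<^sub>E UNIV \<and>
      mor_add \<Q> f (mor_smult \<Q> (- 1) (mor_lincomb \<Q> ?X ?Y B c)) \<in> rad2_add \<Q> \<P> (T_module a1 a2) ?X ?Y"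
    if "f \<in> rad_mor \<Q> ?X ?Y" for f using B that by (auto simp: irr_basis_def)
  have "B \<noteq> {}"
  proof
    assume e: "B = {}"
    have b: "basis_mor x y \<in> Hom \<Q> ?X ?Y" by (rule basis_mor_in_Hom[OF q(1,2)])
    then have "basis_mor x y \<in> rad_mor \<Q> ?X ?Y" unfolding rad_M_neq[OF q(1,2,3)] .
    then obtain c where "mor_add \<Q> (basis_mor x y) (mor_smult \<Q> (- 1) (mor_lincomb \<Q> ?X ?Y {} c)) \<in> rad2_add \<Q> \<P> (T_module a1 a2) ?X ?Y"
      using ex1 e by blast
    then have "basis_mor x y \<in> rad2_add \<Q> \<P> (T_module a1 a2) ?X ?Y"
      using mor_add_zero(1)[OF b] by (simp add: lincomb_empty)
    then have "basis_mor x y = mor_zero \<Q> ?X ?Y" by (rule rad2_End_arrow[OF xy])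
    then show False by (rule notE[OF basis_mor_nonzero[OF q(4)]])
  qed
  moreover have "b1 = b2" if b: "b1 \<in> B" "b2 \<in> B" for b1 b2
  proof (rule ccontr)
    assume ne: "b1 \<noteq> b2"
    define c where "c = (\<lambda>b\<in>B. if b = b1 then coef x y b2 else if b = b2 then - coef x y b1 else 0)"
    have good: "mor_add \<Q> (mor_zero \<Q> ?X ?Y) (mor_smult \<Q> (- 1) (mor_lincomb \<Q> ?X ?Y B d)) \<in> rad2_add \<Q> \<P> (T_module a1 a2) ?X ?Y"
      if d: "(\<Sum>b\<in>B. d b * coef x y b) = 0" for d
    proof -
      have l: "mor_lincomb \<Q> ?X ?Y B d \<in> Hom \<Q> ?X ?Y" by (rule lincomb_in_Hom[OF is_rep_M is_rep_M BH])
      have "coef x y (mor_lincomb \<Q> ?X ?Y B d) = coef x y (mor_zero \<Q> ?X ?Y)"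
        using coef_lincomb[OF fin BH, of d] d coef_zero[of x y, where 'a = 'k] by simp
      then have "mor_lincomb \<Q> ?X ?Y B d = mor_zero \<Q> ?X ?Y"
        by (rule coef_eqI[OF q(1,2) l zero_in_Hom[OF is_rep_M is_rep_M]])
      then show ?thesis by (simp add: mor_add_zero(1)[OF zero_in_Hom[OF is_rep_M is_rep_M]] rad2_add.zero)
    qed
    have "(\<Sum>b\<in>B. c b * coef x y b) = (\<Sum>b\<in>{b1, b2}. c b * coef x y b)"
      using b fin by (intro sum.mono_neutral_right) (auto simp: c_def)
    also have "\<dots> = 0" using b ne by (simp add: c_def)
    finally have 1: "mor_add \<Q> (mor_zero \<Q> ?X ?Y) (mor_smult \<Q> (- 1) (mor_lincomb \<Q> ?X ?Y B c)) \<in> rad2_add \<Q> \<P> (T_module a1 a2) ?X ?Y"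
      by (rule good)
    have 2: "mor_add \<Q> (mor_zero \<Q> ?X ?Y) (mor_smult \<Q> (- 1) (mor_lincomb \<Q> ?X ?Y B (\<lambda>b\<in>B. 0))) \<in> rad2_add \<Q> \<P> (T_module a1 a2) ?X ?Y"
      by (rule good) simp
    \<comment> \<open>\<open>c\<close> and 0 both represent the zero morphism\<close>
    have "c = (\<lambda>b\<in>B. 0)"
      using ex1[OF zero_in_rad[OF q(1,2)]] 1 2 by (metis (no_types, lifting) PiE_restrict UNIV_I c_def restrict_PiE_iff)
    then have "c b1 = 0" "c b2 = 0" using b by auto
    then have "coef x y b1 = coef x y b2" using b ne by (auto simp: c_def)
    then show False using coef_eqI[OF q(1,2), of b1 b2] b BH ne by blast
  qed
  ultimately show ?thesis by blast
qed

text \<open>Here the radical coincides with its square. All coefficients then represent every radical morphism, and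
  they are unique only for the empty set.\<close>

lemma irr_basis_not_End_arrow:
  assumes x: "x \<in> Q0 a1 a2" and y: "y \<in> Q0 a1 a2" and xy: "\<not> End_arrow x y"
  shows "irr_basis \<Q> \<P> (T_module a1 a2) (MM y) (MM x :: (vertex, arrow, 'k::field) rep) B \<longleftrightarrow> B = {}"
proof -
  let ?X = "MM y :: (vertex, arrow, 'k) rep" and ?Y = "MM x :: (vertex, arrow, 'k) rep"
  let ?R = "rad2_add \<Q> \<P> (T_module a1 a2) ?X ?Y"
  have refl: "f = mor_zero \<Q> ?X ?Y" if "f \<in> rad_mor \<Q> ?X ?Y" "x = y" for f
    using rad_M_refl[OF x, of f] that by simp
  have rad: "f \<in> ?R" if "f \<in> rad_mor \<Q> ?X ?Y" for f
  proof (cases "x = y")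
    case True
    show ?thesis unfolding refl[OF that True] by (rule rad2_add.zero)
  next
    case False
    show ?thesis by (rule rad2_not_End_arrow[OF x y xy False]) (use that in \<open>simp add: rad_mor_def\<close>)
  qed
  have lin: "mor_lincomb \<Q> ?X ?Y B c \<in> rad_mor \<Q> ?X ?Y" if B: "B \<subseteq> rad_mor \<Q> ?X ?Y" for c B
  proof (cases "x = y")
    case True
    have BH: "B \<subseteq> Hom \<Q> ?X ?Y" using B by (auto simp: rad_mor_def)
    have "mor_lincomb \<Q> ?X ?Y B c = mor_zero \<Q> ?X ?Y"
      unfolding lincomb_sum[OF BH]
    proof (rule mor_sum_zero)
      fix b assume b: "b \<in> B"
      have "mor_smult \<Q> (c b) b = mor_smult \<Q> (c b) (mor_zero \<Q> ?X ?Y)"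
        by (rule arg_cong[OF refl[OF subsetD[OF B b] True]])
      then show "mor_smult \<Q> (c b) b = mor_zero \<Q> ?X ?Y" by (simp only: mor_smult_zero)
    qed
    then show ?thesis by (simp only: zero_in_rad[OF x y])
  next
    case False
    show ?thesis using B unfolding rad_M_neq[OF x y False] by (rule lincomb_in_Hom[OF is_rep_M is_rep_M])
  qed
  have neg: "mor_add \<Q> (mor_zero \<Q> ?X ?Y) (mor_smult \<Q> (- 1) f) \<in> ?R" if f: "f \<in> rad_mor \<Q> ?X ?Y" for f
  proof -
    have f1: "f \<in> Hom \<Q> ?X ?Y" using f by (simp add: rad_mor_def)
    have nf: "mor_smult \<Q> (- 1) f \<in> Hom \<Q> ?X ?Y" by (rule smult_in_Hom[OF is_rep_M is_rep_M f1])
    have "mor_smult \<Q> (- 1) f \<in> rad_mor \<Q> ?X ?Y"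
    proof (cases "x = y")
      case True
      then have "f = mor_zero \<Q> ?X ?Y" by (rule refl[OF f])
      then show ?thesis using f by simp
    next
      case False
      show ?thesis using nf unfolding rad_M_neq[OF x y False] .
    qed
    then show ?thesis using rad mor_add_zero(2)[OF nf] by simp
  qed
  show ?thesis
  proof
    assume B: "irr_basis \<Q> \<P> (T_module a1 a2) ?X ?Y B"
    then have BR: "B \<subseteq> rad_mor \<Q> ?X ?Y" by (simp add: irr_basis_def)
    have ex1: "\<forall>f\<in>rad_mor \<Q> ?X ?Y. \<exists>!c. c \<in> B \<rightarrow>\<^sub>E UNIV \<and>
        mor_add \<Q> f (mor_smult \<Q> (- 1) (mor_lincomb \<Q> ?X ?Y B c)) \<in> ?R"
      by (rule conjunct2[OF conjunct2[OF conjunct2[OF B[unfolded irr_basis_def]]]])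
    have u: "\<exists>!c. c \<in> B \<rightarrow>\<^sub>E UNIV \<and>
        mor_add \<Q> (mor_zero \<Q> ?X ?Y) (mor_smult \<Q> (- 1) (mor_lincomb \<Q> ?X ?Y B c)) \<in> ?R"
      by (rule bspec[OF ex1 zero_in_rad[OF x y]])
    have all: "(\<lambda>b\<in>B. d) \<in> B \<rightarrow>\<^sub>E UNIV \<and>
        mor_add \<Q> (mor_zero \<Q> ?X ?Y) (mor_smult \<Q> (- 1) (mor_lincomb \<Q> ?X ?Y B (\<lambda>b\<in>B. d))) \<in> ?R" for d :: 'k
      using neg[OF lin[OF BR]] by simp
    \<comment> \<open>any two families of coefficients represent zero, so they agree\<close>
    have "(\<lambda>b\<in>B. 0 :: 'k) = (\<lambda>b\<in>B. 1)" using u all[of 0] all[of 1] by blast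
    then show "B = {}" by (metis ex_in_conv restrict_apply' zero_neq_one)
  next
    assume e: "B = {}"
    have "\<exists>!c. c \<in> {} \<rightarrow>\<^sub>E UNIV \<and> mor_add \<Q> f (mor_smult \<Q> (- 1) (mor_lincomb \<Q> ?X ?Y {} c)) \<in> ?R"
      if f: "f \<in> rad_mor \<Q> ?X ?Y" for f
    proof -
      have "f \<in> Hom \<Q> ?X ?Y" using f by (simp add: rad_mor_def)
      then show ?thesis using rad[OF f] mor_add_zero(1) by (auto simp: lincomb_empty)
    qed
    then show "irr_basis \<Q> \<P> (T_module a1 a2) ?X ?Y B" by (simp add: irr_basis_def e)
  qed
qed

section \<open>The quiver of the endomorphism algebra\<close>

lemma End_arrow_iff: "End_arrow x y \<longleftrightarrow> (x, y) \<in> arrows \<and> has_nz_path x y"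
proof
  assume xy: "End_arrow x y"
  note q = End_arrow_facts[OF xy]
  obtain z where z: "(x, z) \<in> arrows" "between x z y" "path_len x z = 1" by (rule first_step[OF q(4,3)])
  then have "path_len z y = 0" using path_len_add[OF z(2)] xy by (simp add: End_arrow_def)
  then have "z = y" using path_len_pos[of z y] z(2) by (fastforce simp: between_def)
  then show "(x, y) \<in> arrows \<and> has_nz_path x y" using z q by simp
qed (simp add: End_arrow_def arrow_path_len)

text \<open>An arrow is itself a relation exactly if it lies on the cycle and relations have length one.\<close>

lemma arrow_has_nz_path_iff:
  assumes "(x, y) \<in> arrows" shows "has_nz_path x y \<longleftrightarrow> a2 \<noteq> 1 \<or> (x, y) \<notin> cycle_arrows a2"
proof -
  have "cyc_dist (foot x) (foot y) = (if (x, y) \<in> cycle_arrows a2 then 1 else 0)"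
    using assms a2 by (cases rule: arrows.cases) (auto simp: cyc_dist_def)
  moreover have "has_nz_path x y \<longleftrightarrow> cyc_dist (foot x) (foot y) < a2"
    using arrow_path_len(1)[OF assms] arrows_Q0[OF assms] by (simp add: has_nz_path_def)
  ultimately have "has_nz_path x y \<longleftrightarrow> (if (x, y) \<in> cycle_arrows a2 then 1 < a2 else 0 < a2)"
    by simp
  moreover have "1 < a2 \<longleftrightarrow> a2 \<noteq> 1" "0 < a2" using a2 by linarith+
  ultimately show ?thesis by metis
qed

lemma End_arrow_set: "{(x, y). End_arrow x y} = (if a2 = 1 then {} else cycle_arrows a2) \<union> s_arrows a1 a2 \<union> t_arrows a1"
proof -
  have "arrows = cycle_arrows a2 \<union> s_arrows a1 a2 \<union> t_arrows a1" using arcs_Q by (simp add: Q_def)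
  moreover have "s_arrows a1 a2 \<inter> cycle_arrows a2 = {}" "t_arrows a1 \<inter> cycle_arrows a2 = {}"
    by (auto simp: s_arrows_def t_arrows_def split: if_splits)
  moreover have "{(x, y). End_arrow x y} = {e \<in> arrows. a2 \<noteq> 1 \<or> e \<notin> cycle_arrows a2}"
    using arrow_has_nz_path_iff by (auto simp: End_arrow_iff)
  ultimately show ?thesis by auto
qed

lemma jacobian_arcs: "arcs (jacobian_quiver a1 a2) = {(x, y). End_arrow x y}"
proof (cases "a2 = 1")
  case True
  then show ?thesis using jacobian_quiver_1[of a1] a1 End_arrow_set by simp
next
  case False
  then have "jacobian_quiver a1 a2 = \<Q>" using a2 by (intro jacobian_quiver_ge_2) simp
  then show ?thesis using End_arrow_set False by (simp add: Q_def)
qed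

lemma jacobian_simps [simp]:
  "verts (jacobian_quiver a1 a2) = Q0 a1 a2" "tail (jacobian_quiver a1 a2) = fst" "head (jacobian_quiver a1 a2) = snd"
  by (simp_all add: jacobian_quiver_def quiver_of_bound_quiver_algebra_def)

lemma M_inj: "inj_on (MM :: vertex \<Rightarrow> (vertex, arrow, 'k::field) rep) (Q0 a1 a2)"
proof (rule inj_onI)
  fix x y assume xy: "x \<in> Q0 a1 a2" "y \<in> Q0 a1 a2" and e: "MM x = (MM y :: (vertex, arrow, 'k) rep)"
  have "v \<in> suppM a1 a2 x \<longleftrightarrow> v \<in> suppM a1 a2 y" for v
    using arg_cong[OF e, of "\<lambda>X. rdim X v"] by (auto simp: M_rdim split: if_splits)
  then show "x = y" using suppM_inj[OF xy] by blast
qed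

text \<open>The irreducible morphism that represents an arrow is picked by an indefinite choice of a basis, so it
  need not be \<open>basis_mor x y\<close>; but every basis is a singleton, which is all that the quiver
  depends on.\<close>

definition chosen :: "vertex \<Rightarrow> vertex \<Rightarrow> (vertex, 'k::field) rep_mor" where
  "chosen x y = (THE b. (SOME B. irr_basis \<Q> \<P> (T_module a1 a2) (MM y) (MM x :: (vertex, arrow, 'k) rep) B) = {b})"

lemma chosen_basis:
  assumes "x \<in> Q0 a1 a2" "y \<in> Q0 a1 a2"
  shows "(SOME B. irr_basis \<Q> \<P> (T_module a1 a2) (MM y) (MM x :: (vertex, arrow, 'k::field) rep) B)
    = (if End_arrow x y then {chosen x y} else {})"
proof (cases "End_arrow x y")
  case True
  let ?B = "SOME B. irr_basis \<Q> \<P> (T_module a1 a2) (MM y) (MM x :: (vertex, arrow, 'k) rep) B"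
  have "irr_basis \<Q> \<P> (T_module a1 a2) (MM y) (MM x :: (vertex, arrow, 'k) rep) ?B"
    by (rule someI[of _ "{basis_mor x y}"]) (rule irr_basis_End_arrow_exists[OF True])
  then obtain b where "?B = {b}" using irr_basis_End_arrow_unique[OF True] by blast
  then show ?thesis using True by (simp add: chosen_def)
next
  case False
  show ?thesis unfolding irr_basis_not_End_arrow[OF assms False] using False by simp
qed

text \<open>The bijection on arrows; it reverses the direction.\<close>

definition End_arcs :: "(vertex \<times> vertex) \<Rightarrow> (vertex, arrow, 'k::field) rep \<times> (vertex, 'k) rep_mor \<times> (vertex, arrow, 'k) rep" where
  "End_arcs = (\<lambda>(x, y). (MM y, chosen x y, MM x))"

lemma arcs_End_quiver:
  "arcs (End_quiver \<Q> \<P> (T_module a1 a2) (MM ` Q0 a1 a2)) = (End_arcs :: _ \<Rightarrow> (vertex, arrow, 'k::field) rep \<times> _) ` {(x, y). End_arrow x y}"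
    (is "?L = ?R")
proof (rule equalityI)
  show "?L \<subseteq> ?R"
  proof (rule subsetI)
    fix e assume "e \<in> ?L"
    then obtain x y f where e: "e = (MM y, f, MM x)" "x \<in> Q0 a1 a2" "y \<in> Q0 a1 a2"
      "f \<in> (SOME B. irr_basis \<Q> \<P> (T_module a1 a2) (MM y) (MM x :: (vertex, arrow, 'k) rep) B)"
      by (auto simp: End_quiver_def)
    then have "End_arrow x y" "f = chosen x y" using chosen_basis[OF e(2,3), where 'k = 'k] by (auto split: if_splits)
    then show "e \<in> ?R" using e(1) by (auto simp: End_arcs_def)
  qed
  show "?R \<subseteq> ?L"
  proof (rule subsetI)
    fix e assume "e \<in> ?R"
    then obtain x y where e: "e = (MM y, chosen x y, MM x :: (vertex, arrow, 'k) rep)" "End_arrow x y"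
      by (auto simp: End_arcs_def)
    then show "e \<in> ?L"
      using chosen_basis[OF End_arrow_facts(1,2)[OF e(2)], where 'k = 'k] End_arrow_facts(1,2)[OF e(2)]
      by (auto simp: End_quiver_def)
  qed
qed

lemma End_quiver_simps:
  "verts (End_quiver \<Q> \<P> T Vs) = Vs" "tail (End_quiver \<Q> \<P> T Vs) = fst" "head (End_quiver \<Q> \<P> T Vs) = snd \<circ> snd"
  by (auto simp: End_quiver_def fun_eq_iff)

lemma quiver_iso:
  "induces_quiver_iso (MM :: vertex \<Rightarrow> (vertex, arrow, 'k::field) rep) (op_quiver (jacobian_quiver a1 a2))
    (End_quiver \<Q> \<P> (T_module a1 a2) (MM ` Q0 a1 a2))"
proof -
  let ?J = "op_quiver (jacobian_quiver a1 a2)"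
  let ?E = "End_quiver \<Q> \<P> (T_module a1 a2) (MM ` Q0 a1 a2) ::
    ((vertex, arrow, 'k) rep, (vertex, arrow, 'k) rep \<times> (vertex, 'k) rep_mor \<times> (vertex, arrow, 'k) rep) pre_digraph"
  define h where "h = \<lparr>iso_verts = MM :: vertex \<Rightarrow> (vertex, arrow, 'k) rep,
    iso_arcs = End_arcs :: vertex \<times> vertex \<Rightarrow> (vertex, arrow, 'k) rep \<times> (vertex, 'k) rep_mor \<times> (vertex, arrow, 'k) rep,
    iso_head = snd \<circ> snd, iso_tail = fst\<rparr>"
  have "wf_digraph ?J"
    by (rule wf_digraph.intro) (auto simp: op_quiver_def jacobian_arcs dest: End_arrow_facts(1,2))
  moreover have "inj_on (End_arcs :: vertex \<times> vertex \<Rightarrow> (vertex, arrow, 'k) rep \<times> _) (arcs ?J)"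
    using M_inj[where 'k = 'k] End_arrow_facts(1,2) by (auto simp: op_quiver_def jacobian_arcs inj_on_def End_arcs_def)
  ultimately have "pre_digraph.digraph_isomorphism ?J h"
    unfolding pre_digraph.digraph_isomorphism_def using M_inj[where 'k = 'k]
    by (auto simp: h_def op_quiver_def End_arcs_def)
  moreover have "?E = app_iso h ?J"
    using arcs_End_quiver[where 'k = 'k]
    by (intro pre_digraph.equality) (simp_all add: app_iso_def h_def op_quiver_def jacobian_arcs End_quiver_simps)
  ultimately show ?thesis unfolding induces_quiver_iso_def by (intro exI[of _ h]) (simp add: h_def)
qed

lemma arcs_ends_End_quiver:
  "arcs_ends (End_quiver \<Q> \<P> (T_module a1 a2) (MM ` Q0 a1 a2))
    = (\<lambda>(x, y). (MM y :: (vertex, arrow, 'k::field) rep, MM x)) `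
        ((if a2 = 1 then {} else cycle_arrows a2) \<union> s_arrows a1 a2 \<union> t_arrows a1)"
  unfolding End_arrow_set[symmetric] arcs_ends_def arcs_End_quiver image_image
  by (intro image_cong) (auto simp: arc_to_ends_def End_quiver_simps End_arcs_def)

end

theorem theorem6p9:
  fixes a1 a2 :: nat
    and T :: "(vertex, arrow, 'k::alg_closed_field) rep"
    and A :: "('k, ((vertex, arrow) qpath \<Rightarrow> 'k) set) module"
  assumes "1 \<le> a1" and "1 \<le> a2"
  defines "A \<equiv> jacobian_algebra a1 a2"
    and "T \<equiv> T_module a1 a2"
    and "QE \<equiv> End_quiver (Q a1 a2) (cycle_subpaths a1 a2) T (M a1 a2 ` Q0 a1 a2)"
  shows "algebra_iso (End_algebra (Q a1 a2) T) (op_algebra A)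
    \<and> algebra_iso (End_algebra (Q a1 a2) T) A
    \<and> indecomposable_summands (Q a1 a2) (cycle_subpaths a1 a2) T (M a1 a2 ` Q0 a1 a2)
    \<and> induces_quiver_iso (M a1 a2) (op_quiver (jacobian_quiver a1 a2)) QE
    \<and> arcs_ends QE =
        (if a2 = 1 then {}
         else {(M a1 a2 (Rv 0), M a1 a2 (Rv a2))} \<union>
              {(M a1 a2 (Rv (i + 1)), M a1 a2 (Rv i)) | i. i < a2})
        \<union> (if a1 = 1 then {}
           else {(M a1 a2 (Rv a2), M a1 a2 (Sv (a1 - 1)))} \<union>
                {(M a1 a2 (Sv (i + 1)), M a1 a2 (Sv i)) | i. 1 \<le> i \<and> i + 1 \<le> a1 - 1})
        \<union> (if a1 = 1 then {}
           else {(M a1 a2 (Tv (i + 1)), M a1 a2 (Tv i)) | i. 1 \<le> i \<and> i + 1 \<le> a1 - 1} \<union>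
                {(M a1 a2 (Tv 1), M a1 a2 (Rv 0))})"
proof (intro conjI)
  interpret cycle_quiver a1 a2 by unfold_locales (rule assms)+
  have sym: "algebra_iso inc_algebra A"
    unfolding A_def by (rule algebra_iso_sym[OF jacobian_algebra_iso_inc(2,1,3)])
  have E: "algebra_iso (End_algebra (Q a1 a2) T) inc_algebra"
    unfolding T_def by (rule End_algebra_iso_inc)
  show "algebra_iso (End_algebra (Q a1 a2) T) A" by (rule algebra_iso_trans[OF E sym])
  show "algebra_iso (End_algebra (Q a1 a2) T) (op_algebra A)"
    by (rule algebra_iso_trans[OF algebra_iso_trans[OF E inc_algebra_self_dual] algebra_iso_op[OF sym]])
  show "indecomposable_summands (Q a1 a2) (cycle_subpaths a1 a2) T (M a1 a2 ` Q0 a1 a2)"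
    unfolding T_def by (rule T_indecomposable_summands)
  show "induces_quiver_iso (M a1 a2) (op_quiver (jacobian_quiver a1 a2)) QE"
    unfolding QE_def T_def by (rule quiver_iso)
  have c: "(\<lambda>(x, y). (M a1 a2 y :: (vertex, arrow, 'k) rep, M a1 a2 x)) ` cycle_arrows a2 =
      {(M a1 a2 (Rv 0), M a1 a2 (Rv a2))} \<union> {(M a1 a2 (Rv (i + 1)), M a1 a2 (Rv i)) | i. i < a2}"
    unfolding cycle_arrows_def by (auto simp: image_iff)
  have s: "(\<lambda>(x, y). (M a1 a2 y :: (vertex, arrow, 'k) rep, M a1 a2 x)) ` s_arrows a1 a2 =
      (if a1 = 1 then {} else {(M a1 a2 (Rv a2), M a1 a2 (Sv (a1 - 1)))} \<union>
        {(M a1 a2 (Sv (i + 1)), M a1 a2 (Sv i)) | i. 1 \<le> i \<and> i + 1 \<le> a1 - 1})"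
    unfolding s_arrows_def by (auto simp: image_iff)
  have t: "(\<lambda>(x, y). (M a1 a2 y :: (vertex, arrow, 'k) rep, M a1 a2 x)) ` t_arrows a1 =
      (if a1 = 1 then {} else {(M a1 a2 (Tv (i + 1)), M a1 a2 (Tv i)) | i. 1 \<le> i \<and> i + 1 \<le> a1 - 1} \<union>
        {(M a1 a2 (Tv 1), M a1 a2 (Rv 0))})"
    unfolding t_arrows_def by (auto simp: image_iff)
  have i: "f ` (if a2 = 1 then {} else cycle_arrows a2) = (if a2 = 1 then {} else f ` cycle_arrows a2)"
    for f :: "arrow \<Rightarrow> (vertex, arrow, 'k) rep \<times> (vertex, arrow, 'k) rep" by simp
  show "arcs_ends QE =
        (if a2 = 1 then {}
         else {(M a1 a2 (Rv 0), M a1 a2 (Rv a2))} \<union>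
              {(M a1 a2 (Rv (i + 1)), M a1 a2 (Rv i)) | i. i < a2})
        \<union> (if a1 = 1 then {}
           else {(M a1 a2 (Rv a2), M a1 a2 (Sv (a1 - 1)))} \<union>
                {(M a1 a2 (Sv (i + 1)), M a1 a2 (Sv i)) | i. 1 \<le> i \<and> i + 1 \<le> a1 - 1})
        \<union> (if a1 = 1 then {}
           else {(M a1 a2 (Tv (i + 1)), M a1 a2 (Tv i)) | i. 1 \<le> i \<and> i + 1 \<le> a1 - 1} \<union>
                {(M a1 a2 (Tv 1), M a1 a2 (Rv 0))})"
    unfolding QE_def T_def arcs_ends_End_quiver image_Un i c s t ..
qed

end
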